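(* Let $n\ge1$, $i\in\{1,\ldots,n\}$, $k\in\mathbb{N}$ and $j_1,\ldots,j_{k+1}\in\{1,\ldots,n\}$. Then $$x_{j_{k+1}}^+(z)_\bullet x_{j_k}^-(z)_\bullet\cdots{}_\bullet x_{j_2}^-(z)_\bullet x_{j_1}^-(z)_\bullet\mathcal{Y}_i(z)\neq0\quad\text{if and only if}\quad e_{j_{k+1}}f_{j_k}\cdots f_{j_2}f_{j_1}v_{\lambda_i}\neq0.$$
   Context: **Notation.** $n\ge1$ is an integer, $q$ an indeterminate, $F=\mathbb{C}(q^{1/2})$, $[m]=\frac{q^m-q^{-m}}{q-q^{-1}}$. $(a_{ij})_{i,j=1}^n$ is the Cartan matrix of type $A_n$; $\alpha_1,\ldots,\alpha_n$ and $\lambda_1,\ldots,\lambda_n$ are the simple roots and fundamental weights of $\mathfrak{sl}_{n+1}$; $Q=\bigoplus\mathbb{Z}\alpha_i\subset P=\bigoplus\mathbb{Z}\lambda_i$; $(\cdot,\cdot)$ is the symmetric bilinear form with $(\alpha_i,\alpha_j)=a_{ij}$, $(\lambda_i,\alpha_j)=\delta_{ij}$. **The space $V$.** $K(1)$ is the symmetric algebra over $F$ on the symbols $a_i(-r)$, $1\le i\le n$, $r\in\mathbb{Z}_{>0}$; $a_i(-r)$ acts by multiplication and $a_i(r)$, $r>0$, acts as the derivation annihilating $1$ such that $[a_i(r),a_j(s)]=\delta_{r+s,0}\frac{[a_{ij}r][r]}{r}$ for all $r,s\in\mathbb{Z}\setminus\{0\}$. $\mathbb{C}\{P\}$ is the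 (twisted group) algebra, with scalars in $F$, generated by the invertible elements $e^{\alpha_2},\ldots,e^{\alpha_n},e^{\lambda_n}$ with relations $e^{\alpha_i}e^{\alpha_j}=(-1)^{(\alpha_i,\alpha_j)}e^{\alpha_j}e^{\alpha_i}$, $e^{\alpha_i}e^{\lambda_n}=(-1)^{\delta_{in}}e^{\lambda_n}e^{\alpha_i}$ ($2\le i,j\le n$). For $\alpha=m_2\alpha_2+\cdots+m_n\alpha_n+m_{n+1}\lambda_n\in P$ put $e^\alpha=(e^{\alpha_2})^{m_2}\cdots(e^{\alpha_n})^{m_n}(e^{\lambda_n})^{m_{n+1}}$. Let $V=K(1)\otimes\mathbb{C}\{P\}$, $1=1\otimes e^0\in V$. The $e^\alpha$ act by left multiplication on $\mathbb{C}\{P\}$; $z^{\partial_\alpha}e^\beta=z^{(\alpha,\beta)}e^\beta$; $(-1)^{m\partial_\alpha}e^\beta=(-1)^{m(\alpha,\beta)}e^\beta$ with $(-1)^s=e^{\pi\sqrt{-1}s}$. **Operators.** For $j=1,\ldots,n$: $$x_j^\pm(z)=\exp\Big(\pm\sum_{r\ge1}\tfrac{q^{\mp r/2}}{[r]}a_j(-r)z^r\Big)\exp\Big(\mp\sum_{r\ge1}\tfrac{q^{\mp r/2}}{[r]}a_j(r)z^{-r}\Big)\otimes e^{\pm\alpha_j}z^{\pm\partial_{\alpha_j}}\in\mathrm{Hom}(V,V((z))).$$ For $l\ne0$ let $a_i^*(l)=\sum_{j=1}^n m_i^{(j)}a_j(l)$ with $m_i^{(j)}=\frac{[jl][(n-i+1)l]}{[(n+1)l][l]}$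 if $j\le i$ and $m_i^{(j)}=\frac{[il][(n-j+1)l]}{[(n+1)l][l]}$ if $j>i$. For $i=1,\ldots,n$, $$\mathcal{Y}_i(z)=\exp\Big(\sum_{r\ge1}\tfrac{q^{r/2}}{[r]}a_i^*(-r)z^r\Big)\exp\Big(-\sum_{r\ge1}\tfrac{q^{r/2}}{[r]}a_i^*(r)z^{-r}\Big)\otimes e^{\lambda_i}(-1)^{(1-\delta_{in})i\,\partial_{\lambda_n}}z^{\partial_{\lambda_i}}\in\mathrm{Hom}(V,V((z^{1/(n+1)}))).$$ **Products.** A pair $(a(z),b(z))$, $a(z)\in\mathrm{Hom}(V,V((z)))$, $b(z)\in\mathrm{Hom}(V,V((z^{1/(n+1)})))$, is quasi compatible if there is a nonzero polynomial $p(z_1,z_2)\in F[z_1,z_2]$ with $p(z_1,z_2)a(z_1)b(z_2)\in\mathrm{Hom}(V,V((z_1,z_2^{1/(n+1)})))$. For such a pair, the products $a(z)_rb(z)$, $r\in\mathbb{Z}$, are defined by $$\sum_{r\in\mathbb{Z}}(a(z)_rb(z))z_0^{-r-1}=\iota_{z,z_0}\big(p(z_0+z,z)^{-1}\big)\,\big(p(z_1,z)a(z_1)b(z)\big)\big|_{z_1=z+z_0},$$ where $\iota_{z,z_0}$ expands in $F((z))((z_0))$ (i.e. in nonnegative powers of $z_0$ up to a finite pole), and $z_1=z+z_0$ is likewise expanded in nonnegative powers of $z_0$; this is independent of $p$. For $c(z)\in\mathrm{Hom}(V,V((z^{1/(n+1)})))$ write $\mathrm{wt}\,c(z)=\alpha\in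 P$ if $c(z)1=d(z)\otimes e^\alpha$ for some $d(z)\in K(1)((z^{1/(n+1)}))$; e.g. $\mathrm{wt}\,x_j^\pm(z)=\pm\alpha_j$, $\mathrm{wt}\,\mathcal{Y}_i(z)=\lambda_i$. For a quasi compatible pair define $$a(z)_\bullet b(z)=\sum_{t\in\frac12\mathbb{Z}}\Big(\frac{1}{zq^t}\Big)^{(\mathrm{wt}\,a(z),\mathrm{wt}\,b(z))+1}q^t\,a(zq^t)_0b(z)$$ (a finite sum; $a(zq^t)_0b(z)$ is the zeroth product of the operators $a(zq^t)$ and $b(z)$; the product with $b(z)=0$ is $0$). Iterated products are nested from the right: $a_1(z)_\bullet a_2(z)_\bullet b(z)=a_1(z)_\bullet(a_2(z)_\bullet b(z))$. **$U_q(\mathfrak{sl}_{n+1})$.** The associative unital $F$-algebra generated by $e_i,f_i,K_i^{\pm1}$, $1\le i\le n$, with relations $K_iK_j=K_jK_i$, $K_iK_i^{-1}=K_i^{-1}K_i=1$, $K_ie_jK_i^{-1}=q^{(\alpha_i,\alpha_j)}e_j$, $K_if_jK_i^{-1}=q^{-(\alpha_i,\alpha_j)}f_j$, $[e_i,f_j]=\delta_{ij}\frac{K_i-K_i^{-1}}{q-q^{-1}}$, and the $q$-Serre relations $\sum_{s=0}^m(-1)^s\frac{[m]!}{[s]![m-s]!}y_i^{m-s}y_jy_i^s=0$ for $i\ne j$, $m=1-a_{ij}$, $y=e$ and $y=f$ (here $[0]!=1$, $[k]!=[k]\cdots[1]$). $L(\lambda_i)$ is the irreducible highest weight module of highest weight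 $\lambda_i$ (so $K_j v_{\lambda_i}=q^{\delta_{ij}}v_{\lambda_i}$, $e_jv_{\lambda_i}=0$), with highest weight vector $v_{\lambda_i}$. *)

theory Defs
  imports
    "HOL-Computational_Algebra.Computational_Algebra"
    "HOL-Library.Poly_Mapping"
    Complex_Main
begin

section \<open>The ground field and quantum integers\<close>

text \<open>The field \<open>\<complex>(q\<^sup>1\<^sup>/\<^sup>2)\<close>; the polynomial indeterminate is \<open>q\<^sup>1\<^sup>/\<^sup>2\<close>.\<close>

type_synonym qfield = "complex poly fract"

definition qconst :: "complex \<Rightarrow> qfield" where
  "qconst c = Fract [:c:] 1"

definition qhalf :: qfield where
  "qhalf = Fract [:0, 1:] 1"

text \<open>The power \<open>q\<^sup>x\<close>, meaningful only for \<open>x\<close> in \<open>\<half>\<int>\<close>, where the floor is exact.\<close>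

definition qpow :: "rat \<Rightarrow> qfield" where
  "qpow x = qhalf powi \<lfloor>2 * x\<rfloor>"

definition qint :: "int \<Rightarrow> qfield" where
  "qint m = (qpow (of_int m) - qpow (- of_int m)) / (qpow 1 - qpow (-1))"

definition qfact :: "nat \<Rightarrow> qfield" where
  "qfact m = (\<Prod>k = 1..m. qint (int k))"


section \<open>Root data of type \<open>A\<^sub>n\<close>\<close>

definition cartan :: "nat \<Rightarrow> nat \<Rightarrow> int" where
  "cartan i j = (if i = j then 2 else if i = Suc j \<or> j = Suc i then -1 else 0)"

text \<open>A weight is given by its coordinates with respect to the fundamental weights.\<close>

type_synonym weight = "nat \<Rightarrow>\<^sub>0 int"

definition weight_lattice :: "nat \<Rightarrow> weight set" where
  "weight_lattice n = {\<mu>. Poly_Mapping.keys \<mu> \<subseteq> {1..n}}"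

definition fund_weight :: "nat \<Rightarrow> weight" where
  "fund_weight i = Poly_Mapping.single i 1"

definition simple_root :: "nat \<Rightarrow> nat \<Rightarrow> weight" where
  "simple_root n j = (\<Sum>i = 1..n. Poly_Mapping.single i (cartan i j))"

text \<open>The Gram matrix of the fundamental weights is the inverse of the Cartan matrix; the
  characterizing values of the form are \<open>form_fund_simple\<close> and \<open>form_simple_simple\<close> below.\<close>

definition form :: "nat \<Rightarrow> weight \<Rightarrow> weight \<Rightarrow> rat" where
  "form n \<mu> \<nu> = (\<Sum>i = 1..n. \<Sum>j = 1..n.
     of_int (Poly_Mapping.lookup \<mu> i) * of_int (Poly_Mapping.lookup \<nu> j) *
       (of_nat (min i j) * (of_nat (n + 1) - of_nat (max i j)) / of_nat (n + 1)))"

lemma lookup_simple_root: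
  "Poly_Mapping.lookup (simple_root n j) i = (if i \<in> {1..n} then cartan i j else 0)"
proof -
  have "Poly_Mapping.lookup (simple_root n j) i = (\<Sum>k = 1..n. if k = i then cartan k j else 0)"
    unfolding simple_root_def lookup_sum
    by (intro sum.cong) (auto simp: lookup_single when_def)
  then show ?thesis by (simp add: sum.delta)
qed

lemma form_commute: "form n \<mu> \<nu> = form n \<nu> \<mu>"
  unfolding form_def
  by (subst sum.swap) (simp add: mult_ac min.commute max.commute)

lemma form_add_left: "form n (\<mu> + \<mu>') \<nu> = form n \<mu> \<nu> + form n \<mu>' \<nu>"
  by (simp add: form_def lookup_add distrib_right sum.distrib add_divide_distrib)

lemma form_add_right: "form n \<nu> (\<mu> + \<mu>') = form n \<nu> \<mu> + form n \<nu> \<mu>'"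
  by (metis form_add_left form_commute)

lemma sum_cartan:
  fixes g :: "nat \<Rightarrow> 'a::comm_ring_1"
  assumes "j \<in> {1..n}" "g 0 = 0" "g (Suc n) = 0"
  shows "(\<Sum>b = 1..n. of_int (cartan b j) * g b) = 2 * g j - g (j - 1) - g (Suc j)"
proof -
  have "(\<Sum>b = 1..n. of_int (cartan b j) * g b) = (\<Sum>b \<in> {0..Suc n}. of_int (cartan b j) * g b)"
    using assms(2,3) by (intro sum.mono_neutral_left) (auto simp: not_le le_Suc_eq)
  also have "\<dots> = (\<Sum>b \<in> {j - 1, j, Suc j}. of_int (cartan b j) * g b)"
    using assms(1) by (intro sum.mono_neutral_right) (auto simp: cartan_def)
  also have "\<dots> = 2 * g j - g (j - 1) - g (Suc j)"
    using assms(1) by (cases j) (auto simp: cartan_def)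
  finally show ?thesis .
qed

lemma form_fund_left:
  assumes "i \<in> {1..n}"
  shows "form n (fund_weight i) \<nu> = (\<Sum>j = 1..n. of_int (Poly_Mapping.lookup \<nu> j) *
    (of_nat (min i j) * (of_nat (n + 1) - of_nat (max i j)) / of_nat (n + 1)))"
proof -
  have "form n (fund_weight i) \<nu> = (\<Sum>k = 1..n. if k = i then (\<Sum>j = 1..n. of_int (Poly_Mapping.lookup \<nu> j) *
    (of_nat (min k j) * (of_nat (n + 1) - of_nat (max k j)) / of_nat (n + 1))) else 0)"
    unfolding form_def fund_weight_def
    by (intro sum.cong) (auto simp: lookup_single when_def)
  then show ?thesis using assms by (simp add: sum.delta)
qed

lemma form_fund_simple:
  assumes "i \<in> {1..n}" "j \<in> {1..n}"
  shows "form n (fund_weight i) (simple_root n j) = (if i = j then 1 else 0)"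
proof -
  define g :: "nat \<Rightarrow> rat" where
    "g b = of_nat (min i b) * (of_nat (n + 1) - of_nat (max i b)) / of_nat (n + 1)" for b
  have "form n (fund_weight i) (simple_root n j) = (\<Sum>b = 1..n. of_int (cartan b j) * g b)"
    unfolding form_fund_left[OF assms(1)] g_def
    by (intro sum.cong) (auto simp: lookup_simple_root)
  also have "\<dots> = 2 * g j - g (j - 1) - g (Suc j)"
    using assms by (intro sum_cartan) (auto simp: g_def max_def)
  also have "\<dots> = (if i = j then 1 else 0)"
  proof -
    have N: "of_nat (n + 1) \<noteq> (0 :: rat)" by (simp del: of_nat_Suc of_nat_add)
    have "(2 * g j - g (j - 1) - g (Suc j)) * of_nat (n + 1) =
      2 * (of_nat (min i j) * (of_nat (n + 1) - of_nat (max i j)))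
      - of_nat (min i (j-1)) * (of_nat (n + 1) - of_nat (max i (j-1)))
      - of_nat (min i (Suc j)) * (of_nat (n + 1) - of_nat (max i (Suc j)))"
      using N unfolding g_def by (simp add: left_diff_distrib del: of_nat_add of_nat_Suc)
    also have "\<dots> = (if i = j then 1 else 0) * of_nat (n + 1)"
    proof (cases i j rule: linorder_cases)
      case less
      then show ?thesis using assms by (cases j) (auto simp: algebra_simps)
    next
      case equal
      then show ?thesis using assms by (cases j) (auto simp: algebra_simps)
    next
      case greater
      then show ?thesis using assms
        by (cases j; cases "i = Suc j") (auto simp: algebra_simps min_def max_def)
    qed
    finally show ?thesis using N by (metis mult_right_cancel)
  qed
  finally show ?thesis .
qed

lemma form_zero_left: "form n 0 \<nu> = 0"
  by (simp add: form_def)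

lemma form_sum_left: "form n (sum f A) \<nu> = (\<Sum>a\<in>A. form n (f a) \<nu>)"
  by (induction A rule: infinite_finite_induct) (auto simp: form_add_left form_zero_left)

lemma form_single_left:
  "form n (Poly_Mapping.single i c) \<nu> = of_int c * form n (fund_weight i) \<nu>"
  unfolding form_def fund_weight_def
  by (auto simp: sum_distrib_left lookup_single when_def intro!: sum.cong)

lemma form_simple_simple:
  assumes "i \<in> {1..n}" "j \<in> {1..n}"
  shows "form n (simple_root n i) (simple_root n j) = of_int (cartan i j)"
proof -
  have "form n (simple_root n i) (simple_root n j)
      = (\<Sum>k = 1..n. of_int (cartan k i) * form n (fund_weight k) (simple_root n j))"
    unfolding simple_root_def[of n i] form_sum_left form_single_left ..
  also have "\<dots> = (\<Sum>k = 1..n. if k = j then of_int (cartan k i) else 0)"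
    using assms by (intro sum.cong) (auto simp: form_fund_simple)
  also have "\<dots> = of_int (cartan i j)"
    using assms by (simp add: sum.delta cartan_def)
  finally show ?thesis .
qed


section \<open>The twisted group algebra\<close>

text \<open>The coordinates of \<open>\<alpha> = m\<^sub>2 \<alpha>\<^sub>2 + \<dots> + m\<^sub>n \<alpha>\<^sub>n + m\<^sub>n\<^sub>+\<^sub>1 \<lambda>\<^sub>n\<close>, see \<open>weight_expansion\<close>.\<close>

definition coord :: "nat \<Rightarrow> weight \<Rightarrow> nat \<Rightarrow> int" where
  "coord n \<mu> k = (if k = n + 1 then (\<Sum>i = 1..n. (int n + 1 - int i) * Poly_Mapping.lookup \<mu> i)
                  else - (\<Sum>i = 1..<k. (int k - int i) * Poly_Mapping.lookup \<mu> i))"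

text \<open>\<open>g\<^sub>k g\<^sub>l = (-1)\<^bsup>comm_exp n k l\<^esup> g\<^sub>l g\<^sub>k\<close> for the generators \<open>g\<^sub>k = e\<^bsup>\<alpha>\<^sub>k\<^esup>\<close> (\<open>2 \<le> k \<le> n\<close>) and
  \<open>g\<^sub>n\<^sub>+\<^sub>1 = e\<^bsup>\<lambda>\<^sub>n\<^esup>\<close>, where \<open>k < l\<close>.\<close>

definition comm_exp :: "nat \<Rightarrow> nat \<Rightarrow> nat \<Rightarrow> int" where
  "comm_exp n k l = (if l = n + 1 then (if k = n then 1 else 0) else cartan k l)"

text \<open>The algebra has the basis of the ordered monomials \<open>e\<^sup>\<alpha>\<close>, and reordering the product of two
  of them gives \<open>e\<^sup>\<alpha> e\<^sup>\<beta> = cocycle n \<alpha> \<beta> e\<^sup>\<alpha>\<^sup>+\<^sup>\<beta>\<close>.\<close>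

definition cocycle_exp :: "nat \<Rightarrow> weight \<Rightarrow> weight \<Rightarrow> int" where
  "cocycle_exp n \<alpha> \<beta> = (\<Sum>k = 2..n. \<Sum>l = k + 1..n + 1. comm_exp n k l * coord n \<alpha> l * coord n \<beta> k)"

definition cocycle :: "nat \<Rightarrow> weight \<Rightarrow> weight \<Rightarrow> qfield" where
  "cocycle n \<alpha> \<beta> = (-1) powi cocycle_exp n \<alpha> \<beta>"

lemma coord_add: "coord n (\<mu> + \<nu>) k = coord n \<mu> k + coord n \<nu> k"
  by (simp add: coord_def lookup_add distrib_left sum.distrib)

lemma weight_expansion:
  assumes "\<mu> \<in> weight_lattice n" "n \<ge> 1"
  shows "\<mu> = (\<Sum>k = 2..n. frag_cmul (coord n \<mu> k) (simple_root n k)) +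
             frag_cmul (coord n \<mu> (n + 1)) (fund_weight n)"
proof (rule poly_mapping_eqI)
  fix i
  let ?R = "(\<Sum>k = 2..n. frag_cmul (coord n \<mu> k) (simple_root n k)) +
             frag_cmul (coord n \<mu> (n + 1)) (fund_weight n)"
  have R: "Poly_Mapping.lookup ?R i = (\<Sum>k = 2..n. coord n \<mu> k * (if i \<in> {1..n} then cartan i k else 0))
      + coord n \<mu> (n + 1) * (if i = n then 1 else 0)"
    by (simp add: lookup_add lookup_sum lookup_simple_root fund_weight_def lookup_single when_def)
  show "Poly_Mapping.lookup \<mu> i = Poly_Mapping.lookup ?R i"
  proof (cases "i \<in> {1..n}")
    case False
    then have "Poly_Mapping.lookup \<mu> i = 0"
      using assms(1) by (auto simp: weight_lattice_def in_keys_iff)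
    then show ?thesis using False assms(2) unfolding R by auto
  next
    case True
    define S where "S k = (\<Sum>l = 1..<k. (int k - int l) * Poly_Mapping.lookup \<mu> l)" for k
    define g where "g k = (if k \<le> n then - S k else 0)" for k
    have S_Suc: "S (Suc k) = S k + (\<Sum>l = 1..<Suc k. Poly_Mapping.lookup \<mu> l)" for k
    proof -
      have "S (Suc k) = (\<Sum>l = 1..<Suc k. (int k - int l) * Poly_Mapping.lookup \<mu> l + Poly_Mapping.lookup \<mu> l)"
        unfolding S_def by (intro sum.cong) (auto simp: algebra_simps)
      also have "\<dots> = (\<Sum>l = 1..<Suc k. (int k - int l) * Poly_Mapping.lookup \<mu> l)
          + (\<Sum>l = 1..<Suc k. Poly_Mapping.lookup \<mu> l)"
        by (rule sum.distrib)
      also have "(\<Sum>l = 1..<Suc k. (int k - int l) * Poly_Mapping.lookup \<mu> l) = S k"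
        unfolding S_def by (cases k) auto
      finally show ?thesis .
    qed
    obtain i' where i': "i = Suc i'" using True by (cases i) auto
    have S3: "S (Suc i) - 2 * S i + S (i - 1) = Poly_Mapping.lookup \<mu> i"
      using S_Suc[of i] S_Suc[of i'] unfolding i' by simp
    have last: "coord n \<mu> (n + 1) = S (n + 1)"
      unfolding coord_def S_def using assms(2)
      by (simp add: atLeastLessThanSuc_atLeastAtMost add.commute del: sum.op_ivl_Suc sum.cl_ivl_Suc)
    have "(\<Sum>k = 2..n. coord n \<mu> k * cartan i k) = (\<Sum>k = 2..n. cartan k i * g k)"
      by (intro sum.cong) (auto simp: coord_def g_def S_def cartan_def)
    also have "\<dots> = (\<Sum>k = 1..n. cartan k i * g k)"
    proof (intro sum.mono_neutral_left ballI)
      fix k assume "k \<in> {1..n} - {2..n}"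
      then have "k = 1" by auto
      then show "cartan k i * g k = 0" by (simp add: g_def S_def)
    qed auto
    also have "\<dots> = 2 * g i - g (i - 1) - g (Suc i)"
      using sum_cartan[of i n g] True by (simp add: g_def S_def)
    finally show ?thesis
      using True S3 unfolding R unfolding last by (cases "i = n") (auto simp: g_def)
  qed
qed

lemma cocycle_exp_add_left: "cocycle_exp n (\<alpha> + \<alpha>') \<beta> = cocycle_exp n \<alpha> \<beta> + cocycle_exp n \<alpha>' \<beta>"
  by (simp add: cocycle_exp_def coord_add distrib_left distrib_right sum.distrib)

lemma cocycle_exp_add_right: "cocycle_exp n \<alpha> (\<beta> + \<beta>') = cocycle_exp n \<alpha> \<beta> + cocycle_exp n \<alpha> \<beta>'"
  by (simp add: cocycle_exp_def coord_add distrib_left sum.distrib)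

lemma cocycle_ordered:
  assumes "\<And>l. l > k0 \<Longrightarrow> coord n \<alpha> l = 0" "\<And>k. k < k0 \<Longrightarrow> coord n \<beta> k = 0"
  shows "cocycle n \<alpha> \<beta> = 1"
proof -
  have *: "comm_exp n k l * coord n \<alpha> l * coord n \<beta> k = 0" if "k < l" for k l
    using assms(1)[of l] assms(2)[of k] that by (cases "l > k0") auto
  have "cocycle_exp n \<alpha> \<beta> = 0"
    unfolding cocycle_exp_def by (intro sum.neutral ballI *) auto
  then show ?thesis by (simp add: cocycle_def)
qed

lemma coord_simple_root:
  assumes "j \<in> {2..n}" "k \<in> {2..n + 1}"
  shows "coord n (simple_root n j) k = (if k = j then 1 else 0)"
proof -
  let ?S = "\<Sum>i = 1..k - 1. of_int (cartan i j) * (int k - int i)"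
  have S: "coord n (simple_root n j) k = (if k = n + 1 then ?S else - ?S)"
  proof -
    have "{1..<k} = {1..k - 1}" using assms(2) by auto
    then show ?thesis using assms(2) unfolding coord_def
      by (auto simp: lookup_simple_root mult.commute intro!: sum.cong)
  qed
  show ?thesis
  proof (cases "j < k")
    case True
    define g where "g i = (if i = 0 then 0 else int k - int i)" for i
    have "?S = (\<Sum>i = 1..k - 1. of_int (cartan i j) * g i)"
      by (intro sum.cong) (auto simp: g_def)
    also have "\<dots> = 2 * g j - g (j - 1) - g (Suc j)"
      using assms True by (intro sum_cartan) (auto simp: g_def)
    also have "\<dots> = 0"
      using assms True by (auto simp: g_def of_nat_diff)
    finally show ?thesis using True S by auto
  next
    case False
    have "?S = (\<Sum>i = 1..k - 1. if i = k - 1 then (if k = j then -1 else 0) else 0)"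
      using False assms by (intro sum.cong) (auto simp: cartan_def)
    also have "\<dots> = (if k = j then -1 else 0)"
      using assms by (auto simp: sum.delta)
    finally show ?thesis using False assms S by auto
  qed
qed

lemma coord_fund_weight_last:
  assumes "n \<ge> 1" "k \<in> {2..n + 1}"
  shows "coord n (fund_weight n) k = (if k = n + 1 then 1 else 0)"
proof -
  have "(\<Sum>i = 1..n. (int n + 1 - int i) * Poly_Mapping.lookup (fund_weight n) i)
      = (\<Sum>i = 1..n. if i = n then 1 else 0)"
    by (intro sum.cong) (auto simp: fund_weight_def lookup_single when_def)
  then show ?thesis using assms
    by (auto simp: coord_def fund_weight_def lookup_single when_def sum.delta)
qed

lemma cocycle_exp_generators:
  assumes "a \<in> {2..n + 1}" "b \<in> {2..n + 1}"
    and \<alpha>: "\<And>l. l \<in> {2..n + 1} \<Longrightarrow> coord n \<alpha> l = (if l = a then 1 else 0)"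
    and \<beta>: "\<And>l. l \<in> {2..n + 1} \<Longrightarrow> coord n \<beta> l = (if l = b then 1 else 0)"
  shows "cocycle_exp n \<alpha> \<beta> = (if b < a then comm_exp n b a else 0)"
proof -
  have "cocycle_exp n \<alpha> \<beta> = (\<Sum>k = 2..n. if k = b then
          (\<Sum>l = k + 1..n + 1. if l = a then comm_exp n k l else 0) else 0)"
  proof (unfold cocycle_exp_def, intro sum.cong refl)
    fix k assume k: "k \<in> {2..n}"
    show "(\<Sum>l = k + 1..n + 1. comm_exp n k l * coord n \<alpha> l * coord n \<beta> k) =
      (if k = b then (\<Sum>l = k + 1..n + 1. if l = a then comm_exp n k l else 0) else 0)"
    proof (cases "k = b")
      case True
      then have "coord n \<beta> k = 1" using k by (simp add: \<beta>)
      moreover have "coord n \<alpha> l = (if l = a then 1 else 0)" if "l \<in> {k + 1..n + 1}" for l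
        using that k by (simp add: \<alpha>)
      ultimately show ?thesis using True by (intro trans[OF sum.cong if_P[symmetric]]) auto
    qed (use k \<beta> in auto)
  qed
  also have "\<dots> = (\<Sum>k = 2..n. if k = b then (if a \<in> {k + 1..n + 1} then comm_exp n k a else 0) else 0)"
    by (intro sum.cong refl if_cong) (simp only: sum.delta finite_atLeastAtMost)
  finally show ?thesis using assms(1,2) by (auto simp: sum.delta)
qed

lemma cocycle_simple_simple:
  assumes "i \<in> {2..n}" "j \<in> {2..n}"
  shows "cocycle n (simple_root n i) (simple_root n j) =
    (-1) powi cartan i j * cocycle n (simple_root n j) (simple_root n i)"
proof -
  have "cocycle_exp n (simple_root n i) (simple_root n j) = (if j < i then comm_exp n j i else 0)"
    "cocycle_exp n (simple_root n j) (simple_root n i) = (if i < j then comm_exp n i j else 0)"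
    using assms by (intro cocycle_exp_generators coord_simple_root; simp)+
  then show ?thesis using assms
    by (cases i j rule: linorder_cases) (auto simp: cocycle_def comm_exp_def cartan_def power_int_minus)
qed

lemma cocycle_simple_fund:
  assumes "i \<in> {2..n}"
  shows "cocycle n (simple_root n i) (fund_weight n) =
    (if i = n then -1 else 1) * cocycle n (fund_weight n) (simple_root n i)"
proof -
  have "cocycle_exp n (simple_root n i) (fund_weight n) = (if n + 1 < i then comm_exp n (n + 1) i else 0)"
    "cocycle_exp n (fund_weight n) (simple_root n i) = (if i < n + 1 then comm_exp n i (n + 1) else 0)"
    using assms by (intro cocycle_exp_generators coord_simple_root coord_fund_weight_last; simp)+
  then show ?thesis using assms
    by (auto simp: cocycle_def comm_exp_def)
qed


section \<open>The space \<open>V\<close>\<close>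

text \<open>The variable \<open>(i, r)\<close> with \<open>r > 0\<close> stands for the symbol \<open>a\<^sub>i(-r)\<close>. An element of \<open>V\<close> is
  the family of its \<open>K(1)\<close>-valued coefficients with respect to the \<open>e\<^sup>\<alpha>\<close>.\<close>

type_synonym fock = "((nat \<times> nat) \<Rightarrow>\<^sub>0 nat) \<Rightarrow>\<^sub>0 qfield"
type_synonym vspace = "weight \<Rightarrow>\<^sub>0 fock"

definition fock_carrier :: "nat \<Rightarrow> fock set" where
  "fock_carrier n = {p. \<forall>m \<in> Poly_Mapping.keys p. Poly_Mapping.keys m \<subseteq> {1..n} \<times> {0<..}}"

definition V :: "nat \<Rightarrow> vspace set" where
  "V n = {v. Poly_Mapping.keys v \<subseteq> weight_lattice n \<and> (\<forall>\<beta>. Poly_Mapping.lookup v \<beta> \<in> fock_carrier n)}"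

definition fconst :: "qfield \<Rightarrow> fock" where
  "fconst c = Poly_Mapping.single 0 c"

definition fvar :: "nat \<times> nat \<Rightarrow> fock" where
  "fvar x = Poly_Mapping.single (Poly_Mapping.single x 1) 1"

definition fscale :: "qfield \<Rightarrow> fock \<Rightarrow> fock" where
  "fscale c p = fconst c * p"

definition vscale :: "qfield \<Rightarrow> vspace \<Rightarrow> vspace" where
  "vscale c v = Poly_Mapping.map (fscale c) v"

definition vacuum :: vspace where
  "vacuum = Poly_Mapping.single 0 1"

text \<open>The derivation of the polynomial ring taking the value \<open>d x\<close> on each variable \<open>x\<close>.\<close>

definition fock_deriv :: "(nat \<times> nat \<Rightarrow> fock) \<Rightarrow> fock \<Rightarrow> fock" where
  "fock_deriv d p = (\<Sum>m \<in> Poly_Mapping.keys p. \<Sum>x \<in> Poly_Mapping.keys m.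
     Poly_Mapping.single (m - Poly_Mapping.single x 1) (Poly_Mapping.lookup p m * of_nat (Poly_Mapping.lookup m x)) * d x)"

text \<open>The operator \<open>a\<^sub>i(r)\<close> for \<open>r \<noteq> 0\<close>.\<close>

definition heis :: "nat \<Rightarrow> int \<Rightarrow> fock \<Rightarrow> fock" where
  "heis i r p =
     (if r < 0 then fvar (i, nat (- r)) * p
      else fock_deriv (\<lambda>(j, s). if int s = r
             then fconst (qint (cartan i j * r) * qint r / of_int r) else 0) p)"

lemma poly_mapping_sum_single:
  fixes p :: "'a \<Rightarrow>\<^sub>0 'b::comm_monoid_add"
  shows "p = (\<Sum>m \<in> Poly_Mapping.keys p. Poly_Mapping.single m (Poly_Mapping.lookup p m))"
proof (rule poly_mapping_eqI)
  fix k
  have "Poly_Mapping.lookup (\<Sum>m \<in> Poly_Mapping.keys p. Poly_Mapping.single m (Poly_Mapping.lookup p m)) k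
      = (\<Sum>m \<in> Poly_Mapping.keys p. if m = k then Poly_Mapping.lookup p m else 0)"
    unfolding lookup_sum by (intro sum.cong) (auto simp: lookup_single when_def)
  then show "Poly_Mapping.lookup p k =
      Poly_Mapping.lookup (\<Sum>m \<in> Poly_Mapping.keys p. Poly_Mapping.single m (Poly_Mapping.lookup p m)) k"
    by (auto simp: sum.delta in_keys_iff)
qed

lemma poly_mapping_add_induct [case_names single add]:
  fixes p :: "'a \<Rightarrow>\<^sub>0 'b::comm_monoid_add"
  assumes "\<And>m c. P (Poly_Mapping.single m c)" "\<And>p q. P p \<Longrightarrow> P q \<Longrightarrow> P (p + q)"
  shows "P p"
proof -
  have "P (\<Sum>m \<in> A. Poly_Mapping.single m (Poly_Mapping.lookup p m))" if "finite A" for A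
    using that by induction (use assms(1)[of undefined 0] in \<open>auto intro: assms\<close>)
  then show ?thesis by (subst poly_mapping_sum_single) auto
qed

lemma fock_deriv_superset:
  assumes "finite A" "Poly_Mapping.keys p \<subseteq> A"
  shows "fock_deriv d p = (\<Sum>m \<in> A. \<Sum>x \<in> Poly_Mapping.keys m.
     Poly_Mapping.single (m - Poly_Mapping.single x 1)
       (Poly_Mapping.lookup p m * of_nat (Poly_Mapping.lookup m x)) * d x)"
  unfolding fock_deriv_def using assms
  by (intro sum.mono_neutral_left) (auto simp: in_keys_iff)

lemma fock_deriv_add: "fock_deriv d (p + q) = fock_deriv d p + fock_deriv d q"
proof -
  let ?A = "Poly_Mapping.keys p \<union> Poly_Mapping.keys q"
  have "Poly_Mapping.keys (p + q) \<subseteq> ?A" by (rule keys_add)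
  then show ?thesis
    by (simp add: fock_deriv_superset[of ?A] lookup_add distrib_right single_add sum.distrib)
qed

lemma fock_deriv_single:
  "fock_deriv d (Poly_Mapping.single m c) = (\<Sum>x \<in> Poly_Mapping.keys m.
     Poly_Mapping.single (m - Poly_Mapping.single x 1) (c * of_nat (Poly_Mapping.lookup m x)) * d x)"
  by (subst fock_deriv_superset[of "{m}"]) auto

lemma fock_deriv_fconst: "fock_deriv d (fconst c) = 0"
  by (simp add: fconst_def fock_deriv_single)

lemma fock_deriv_fvar: "fock_deriv d (fvar x) = d x"
  by (simp add: fvar_def fock_deriv_single)

lemma fock_deriv_mult: "fock_deriv d (p * q) = fock_deriv d p * q + p * fock_deriv d q"
proof (induction p rule: poly_mapping_add_induct)
  case (add p1 p2)
  then show ?case by (simp add: fock_deriv_add algebra_simps)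
next
  case (single m c)
  show ?case
  proof (induction q rule: poly_mapping_add_induct)
    case (add q1 q2)
    then show ?case by (simp add: fock_deriv_add algebra_simps)
  next
    case (single m' c')
    define t where "t m c x = Poly_Mapping.single (m - Poly_Mapping.single x 1)
      (c * of_nat (Poly_Mapping.lookup m x)) * d x" for m :: "(nat \<times> nat) \<Rightarrow>\<^sub>0 nat" and c :: qfield and x
    have t0: "t m c x = 0" if "x \<notin> Poly_Mapping.keys m" for m c x
      using that by (simp add: t_def in_keys_iff)
    have sup: "fock_deriv d (Poly_Mapping.single m c) = (\<Sum>x \<in> A. t m c x)"
      if "finite A" "Poly_Mapping.keys m \<subseteq> A" for m c A
      unfolding fock_deriv_single t_def[symmetric] using that
      by (intro sum.mono_neutral_left) (auto simp: t0)
    let ?A = "Poly_Mapping.keys m \<union> Poly_Mapping.keys m'"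
    have shift: "m1 + m2 - Poly_Mapping.single x 1 = m1 - Poly_Mapping.single x 1 + m2"
      if "Poly_Mapping.lookup m1 x \<noteq> 0" for m1 m2 :: "(nat \<times> nat) \<Rightarrow>\<^sub>0 nat" and x
      using that by (intro poly_mapping_eqI)
        (auto simp: lookup_add lookup_minus lookup_single when_def)
    have part: "Poly_Mapping.single (m1 + m2 - Poly_Mapping.single x 1) (a * of_nat (Poly_Mapping.lookup m1 x))
       = Poly_Mapping.single (m1 - Poly_Mapping.single x 1 + m2) (a * of_nat (Poly_Mapping.lookup m1 x))"
      for m1 m2 :: "(nat \<times> nat) \<Rightarrow>\<^sub>0 nat" and x and a :: qfield
      using shift[of m1 x m2] by (cases "Poly_Mapping.lookup m1 x = 0") auto
    have "t (m + m') (c * c') x = t m c x * Poly_Mapping.single m' c' + Poly_Mapping.single m c * t m' c' x" for x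
    proof -
      have "t (m + m') (c * c') x =
        Poly_Mapping.single (m + m' - Poly_Mapping.single x 1) (c * c' * of_nat (Poly_Mapping.lookup m x)) * d x +
        Poly_Mapping.single (m' + m - Poly_Mapping.single x 1) (c * c' * of_nat (Poly_Mapping.lookup m' x)) * d x"
        by (simp add: t_def lookup_add distrib_left single_add distrib_right add.commute)
      then show ?thesis
        unfolding part by (simp add: t_def mult_single mult_ac add_ac flip: mult.assoc)
    qed
    then show ?case
      using keys_add[of m m'] by (simp add: mult_single sup[of ?A] sum_distrib_left sum_distrib_right sum.distrib)
  qed
qed

lemma fock_deriv_commute:
  "fock_deriv (\<lambda>x. fconst (a x)) (fock_deriv (\<lambda>x. fconst (b x)) p) =
   fock_deriv (\<lambda>x. fconst (b x)) (fock_deriv (\<lambda>x. fconst (a x)) p)"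
    (is "?A (?B p) = ?B (?A p)")
proof (induction p rule: poly_mapping_add_induct)
  case (add p q)
  then show ?case by (simp add: fock_deriv_add)
next
  case (single m c)
  have mult: "?A (?B (p * q)) = ?B (?A (p * q))"
    if "?A (?B p) = ?B (?A p)" "?A (?B q) = ?B (?A q)" for p q
    using that by (simp add: fock_deriv_mult fock_deriv_add algebra_simps)
  have mon: "?A (?B (Poly_Mapping.single m 1)) = ?B (?A (Poly_Mapping.single m 1))"
    for m :: "(nat \<times> nat) \<Rightarrow>\<^sub>0 nat"
  proof (induction m rule: poly_mapping_add_induct)
    case (add m m')
    have "Poly_Mapping.single (m + m') (1::qfield) = Poly_Mapping.single m 1 * Poly_Mapping.single m' 1"
      by (simp add: mult_single)
    then show ?case using mult add by metis
  next
    case (single x k)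
    show ?case
    proof (induction k)
      case 0
      then show ?case using fock_deriv_fconst[of _ 1] fock_deriv_fconst[of _ 0] by (simp add: fconst_def)
    next
      case (Suc k)
      have "Poly_Mapping.single (Poly_Mapping.single x (Suc k)) (1::qfield) =
        fvar x * Poly_Mapping.single (Poly_Mapping.single x k) 1"
        by (simp add: fvar_def mult_single flip: single_add)
      moreover have "?A (?B (fvar x)) = ?B (?A (fvar x))"
        by (simp add: fock_deriv_fvar fock_deriv_fconst)
      ultimately show ?case using mult Suc by metis
    qed
  qed
  have "Poly_Mapping.single m c = fconst c * Poly_Mapping.single m 1"
    by (simp add: fconst_def mult_single)
  moreover have "?A (?B (fconst c)) = ?B (?A (fconst c))"
    by (simp add: fock_deriv_fconst) (simp add: fock_deriv_def)
  ultimately show ?case using mult mon by metis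
qed

lemma heis_commutator:
  assumes "r \<noteq> 0" "s \<noteq> 0"
  shows "heis i r (heis j s p) - heis j s (heis i r p) =
    fscale (if r + s = 0 then qint (cartan i j * r) * qint r / of_int r else 0) p"
proof -
  have fconst_if: "(\<lambda>(j, s). if int s = r then fconst (qint (cartan i j * r) * qint r / of_int r) else 0)
    = (\<lambda>x. fconst (if int (snd x) = r then qint (cartan i (fst x) * r) * qint r / of_int r else 0))" for i r
    by (auto simp: fconst_def fun_eq_iff)
  have fconst_minus: "fconst (- c) = - fconst c" for c
    by (simp add: fconst_def single_uminus)
  have sym: "qint (cartan j i * s) * qint s / of_int s = - (qint (cartan i j * r) * qint r / of_int r)"
    if "r + s = 0" for i j r s
  proof -
    have qint_minus: "qint (- m) = - qint m" for m
      by (simp only: qint_def of_int_minus minus_minus minus_divide_left minus_diff_eq)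
    have "cartan j i = cartan i j" by (auto simp: cartan_def)
    moreover have "s = - r" using that by simp
    ultimately show ?thesis
      by (simp only: qint_minus mult_minus_right mult_minus_left minus_minus of_int_minus minus_divide_right)
  qed
  consider "r < 0" "s < 0" | "r < 0" "s > 0" | "r > 0" "s < 0" | "r > 0" "s > 0"
    using assms by linarith
  then show ?thesis
  proof cases
    case 1
    then show ?thesis by (simp add: heis_def fscale_def fconst_def mult_ac)
  next
    case 2
    have "heis i r (heis j s p) - heis j s (heis i r p) =
      - ((if int (nat (- r)) = s then fconst (qint (cartan j i * s) * qint s / of_int s) else 0) * p)"
      using 2 by (simp add: heis_def fock_deriv_mult fock_deriv_fvar algebra_simps)
    moreover have "int (nat (- r)) = s \<longleftrightarrow> r + s = 0" using 2 by auto
    ultimately show ?thesis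
      by (simp add: sym fscale_def fconst_minus fconst_def[of 0])
  next
    case 3
    then show ?thesis
      by (auto simp: heis_def fock_deriv_mult fock_deriv_fvar fscale_def fconst_def[of 0])
  next
    case 4
    then show ?thesis
      using fock_deriv_commute by (simp add: heis_def fconst_if fscale_def fconst_def[of 0])
  qed
qed

definition dual_coeff :: "nat \<Rightarrow> nat \<Rightarrow> nat \<Rightarrow> int \<Rightarrow> qfield" where
  "dual_coeff n i j l =
     (if j \<le> i then qint (int j * l) * qint ((int n - int i + 1) * l)
                  / (qint ((int n + 1) * l) * qint l)
      else qint (int i * l) * qint ((int n - int j + 1) * l)
                  / (qint ((int n + 1) * l) * qint l))"

definition heis_dual :: "nat \<Rightarrow> nat \<Rightarrow> int \<Rightarrow> fock \<Rightarrow> fock" where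
  "heis_dual n i l p = (\<Sum>j = 1..n. fscale (dual_coeff n i j l) (heis j l p))"


section \<open>Formal series\<close>

text \<open>A series in \<open>z\<close> is its family of coefficients \<open>f r\<close> of \<open>z\<^sup>r\<close>, with rational exponents \<open>r\<close>, and
  an operator-valued series is \<open>a r v\<close>, the coefficient of \<open>z\<^sup>r\<close> in \<open>a(z) v\<close>.
  \<open>laurent N M\<close> is \<open>M((z\<^sup>1\<^sup>/\<^sup>N))\<close> and \<open>laurent2 N M\<close> is \<open>M((z\<^sub>1, z\<^sub>2\<^sup>1\<^sup>/\<^sup>N))\<close>.\<close>

type_synonym op_series = "rat \<Rightarrow> vspace \<Rightarrow> vspace"

definition laurent :: "nat \<Rightarrow> 'a::zero set \<Rightarrow> (rat \<Rightarrow> 'a) set" where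
  "laurent N M = {f. (\<forall>r. f r \<in> M) \<and> (\<forall>r. f r \<noteq> 0 \<longrightarrow> of_nat N * r \<in> \<int>) \<and>
     (\<exists>B. \<forall>r < B. f r = 0)}"

definition laurent2 :: "nat \<Rightarrow> 'a::zero set \<Rightarrow> (rat \<Rightarrow> rat \<Rightarrow> 'a) set" where
  "laurent2 N M = {f. (\<forall>r s. f r s \<in> M) \<and> (\<forall>r s. f r s \<noteq> 0 \<longrightarrow> r \<in> \<int> \<and> of_nat N * s \<in> \<int>) \<and>
     (\<exists>B. \<forall>r s. r < B \<or> s < B \<longrightarrow> f r s = 0)}"

definition linear_on_space ::
  "('k \<Rightarrow> 'a::ab_group_add \<Rightarrow> 'a) \<Rightarrow> ('k \<Rightarrow> 'b::ab_group_add \<Rightarrow> 'b) \<Rightarrow> 'a set \<Rightarrow> ('a \<Rightarrow> 'b) \<Rightarrow> bool" where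
  "linear_on_space sa sb M f \<longleftrightarrow>
     (\<forall>x \<in> M. \<forall>y \<in> M. f (x + y) = f x + f y) \<and> (\<forall>c. \<forall>x \<in> M. f (sa c x) = sb c (f x))"

definition hom_laurent :: "nat \<Rightarrow> nat \<Rightarrow> op_series set" where
  "hom_laurent n N = {a. (\<forall>r. linear_on_space vscale vscale (V n) (a r)) \<and>
     (\<forall>v \<in> V n. (\<lambda>r. a r v) \<in> laurent N (V n))}"

text \<open>Being nonzero as a map on \<open>V\<close>: values outside the carrier are irrelevant.\<close>

definition nonzero_series :: "nat \<Rightarrow> op_series \<Rightarrow> bool" where
  "nonzero_series n a \<longleftrightarrow> (\<exists>v \<in> V n. \<exists>r. a r v \<noteq> 0)"


section \<open>Vertex operators\<close>

text \<open>\<open>op_pow A k m\<close> and \<open>op_exp A m\<close> are the coefficients of \<open>w\<^sup>m\<close> in \<open>S\<^sup>k\<close> and in \<open>exp S\<close>,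
  where \<open>S = \<Sum>\<^bsub>r\<ge>1\<^esub> A r w\<^sup>r\<close>.\<close>

fun op_pow :: "(nat \<Rightarrow> fock \<Rightarrow> fock) \<Rightarrow> nat \<Rightarrow> nat \<Rightarrow> fock \<Rightarrow> fock" where
  "op_pow A 0 m p = (if m = 0 then p else 0)"
| "op_pow A (Suc k) m p = (\<Sum>r = 1..m. A r (op_pow A k (m - r) p))"

definition op_exp :: "(nat \<Rightarrow> fock \<Rightarrow> fock) \<Rightarrow> nat \<Rightarrow> fock \<Rightarrow> fock" where
  "op_exp A m p = (\<Sum>k\<le>m. fscale (1 / of_nat (fact k)) (op_pow A k m p))"

text \<open>The series \<open>exp(\<Sum> C r z\<^sup>r) exp(\<Sum> A r z\<^sup>-\<^sup>r) \<otimes> e\<^sup>\<gamma> \<chi> z\<^bsup>\<partial>\<^sub>\<gamma>\<^esup>\<close>, where \<open>\<chi>\<close> multiplies \<open>e\<^sup>\<beta>\<close> by \<open>\<chi> \<beta>\<close>.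
  Only finitely many terms of each coefficient are nonzero.\<close>

definition vertex_op ::
  "nat \<Rightarrow> (nat \<Rightarrow> fock \<Rightarrow> fock) \<Rightarrow> (nat \<Rightarrow> fock \<Rightarrow> fock) \<Rightarrow> weight \<Rightarrow> (weight \<Rightarrow> qfield) \<Rightarrow> op_series" where
  "vertex_op n C A \<gamma> \<chi> r v = (\<Sum>\<beta> \<in> Poly_Mapping.keys v. Poly_Mapping.single (\<gamma> + \<beta>)
     (fscale (\<chi> \<beta> * cocycle n \<gamma> \<beta>)
        (Sum_any (\<lambda>(m, m'). op_exp C m (op_exp A m' (Poly_Mapping.lookup v \<beta>))
                     when of_nat m - of_nat m' + form n \<gamma> \<beta> = r))))"

definition x_plus :: "nat \<Rightarrow> nat \<Rightarrow> op_series" where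
  "x_plus n j = vertex_op n
     (\<lambda>r. fscale (qpow (- of_nat r / 2) / qint (int r)) \<circ> heis j (- int r))
     (\<lambda>r. fscale (- (qpow (- of_nat r / 2) / qint (int r))) \<circ> heis j (int r))
     (simple_root n j) (\<lambda>_. 1)"

definition x_minus :: "nat \<Rightarrow> nat \<Rightarrow> op_series" where
  "x_minus n j = vertex_op n
     (\<lambda>r. fscale (- (qpow (of_nat r / 2) / qint (int r))) \<circ> heis j (- int r))
     (\<lambda>r. fscale (qpow (of_nat r / 2) / qint (int r)) \<circ> heis j (int r))
     (- simple_root n j) (\<lambda>_. 1)"

definition Y_op :: "nat \<Rightarrow> nat \<Rightarrow> op_series" where
  "Y_op n i = vertex_op n
     (\<lambda>r. fscale (qpow (of_nat r / 2) / qint (int r)) \<circ> heis_dual n i (- int r))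
     (\<lambda>r. fscale (- (qpow (of_nat r / 2) / qint (int r))) \<circ> heis_dual n i (int r))
     (fund_weight i)
     (\<lambda>\<beta>. qconst (exp (of_real pi * \<i> *
        (of_nat (if i = n then 0 else i) * of_rat (form n (fund_weight n) \<beta>)))))"


section \<open>Products of series\<close>

text \<open>A polynomial \<open>p(z\<^sub>1, z\<^sub>2)\<close> is a polynomial in \<open>z\<^sub>1\<close> with coefficients in \<open>F[z\<^sub>2]\<close>.
  \<open>mult_pair p a b r s\<close> is the coefficient of \<open>z\<^sub>1\<^sup>r z\<^sub>2\<^sup>s\<close> in \<open>p(z\<^sub>1, z\<^sub>2) a(z\<^sub>1) b(z\<^sub>2)\<close>.\<close>

definition mult_pair ::
  "qfield poly poly \<Rightarrow> op_series \<Rightarrow> op_series \<Rightarrow> rat \<Rightarrow> rat \<Rightarrow> vspace \<Rightarrow> vspace" where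
  "mult_pair p a b r s v = (\<Sum>i\<le>degree p. \<Sum>j\<le>degree (coeff p i).
     vscale (coeff (coeff p i) j) (a (r - of_nat i) (b (s - of_nat j) v)))"

definition compat_poly :: "nat \<Rightarrow> op_series \<Rightarrow> op_series \<Rightarrow> qfield poly poly \<Rightarrow> bool" where
  "compat_poly n a b p \<longleftrightarrow> p \<noteq> 0 \<and>
     (\<forall>v \<in> V n. (\<lambda>r s. mult_pair p a b r s v) \<in> laurent2 (n + 1) (V n))"

definition quasi_compatible :: "nat \<Rightarrow> op_series \<Rightarrow> op_series \<Rightarrow> bool" where
  "quasi_compatible n a b \<longleftrightarrow> a \<in> hom_laurent n 1 \<and> b \<in> hom_laurent n (n + 1) \<and>
     (\<exists>p. compat_poly n a b p)"

text \<open>\<open>\<iota>\<^bsub>z,z\<^sub>0\<^esub>(p(z\<^sub>0 + z, z)\<^sup>-\<^sup>1)\<close>: the inverse is taken in the field \<open>F((z))((z\<^sub>0))\<close> of iterated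
  Laurent series, whose outer variable is \<open>z\<^sub>0\<close>.\<close>

definition iota_inverse :: "qfield poly poly \<Rightarrow> qfield fls fls" where
  "iota_inverse p = inverse
     (poly (map_poly (\<lambda>c. fls_const (fps_to_fls (fps_of_poly c))) p) (fls_X + fls_const fls_X))"

text \<open>The coefficient of \<open>z\<^sub>0\<^sup>k z\<^sup>s\<close> in \<open>p(z\<^sub>1, z) a(z\<^sub>1) b(z) v\<close> at \<open>z\<^sub>1 = z + z\<^sub>0\<close>.\<close>

definition subst_shift ::
  "qfield poly poly \<Rightarrow> op_series \<Rightarrow> op_series \<Rightarrow> nat \<Rightarrow> rat \<Rightarrow> vspace \<Rightarrow> vspace" where
  "subst_shift p a b k s v = Sum_any (\<lambda>r::int. vscale (qconst (of_int r gchoose k))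
     (mult_pair p a b (of_int r) (s - of_int r + of_nat k) v))"

text \<open>The product \<open>a(z)\<^sub>r b(z)\<close>; it does not depend on the choice of \<open>p\<close>.\<close>

definition nth_product :: "nat \<Rightarrow> op_series \<Rightarrow> int \<Rightarrow> op_series \<Rightarrow> op_series" where
  "nth_product n a r b = (if quasi_compatible n a b
     then (let p = SOME p. compat_poly n a b p in
       (\<lambda>s v. Sum_any (\<lambda>(k, t). vscale (fls_nth (fls_nth (iota_inverse p) (- r - 1 - int k)) t)
                         (subst_shift p a b k (s - of_int t) v))))
     else undefined)"

definition has_wt :: "nat \<Rightarrow> op_series \<Rightarrow> weight \<Rightarrow> bool" where
  "has_wt n c \<alpha> \<longleftrightarrow> \<alpha> \<in> weight_lattice n \<and>
     (\<exists>d \<in> laurent (n + 1) (fock_carrier n). \<forall>r. c r vacuum = Poly_Mapping.single \<alpha> (d r))"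

definition wt :: "nat \<Rightarrow> op_series \<Rightarrow> weight" where
  "wt n c = (SOME \<alpha>. has_wt n c \<alpha>)"

text \<open>The series \<open>a(z q\<^sup>t)\<close>, for \<open>a\<close> with integral exponents and \<open>t\<close> in \<open>\<half>\<int>\<close>.\<close>

definition dilate :: "rat \<Rightarrow> op_series \<Rightarrow> op_series" where
  "dilate t a r v = vscale (qpow (t * r)) (a r v)"

definition bullet :: "nat \<Rightarrow> op_series \<Rightarrow> op_series \<Rightarrow> op_series" where
  "bullet n a b s v = (let E = form n (wt n a) (wt n b) + 1 in
     Sum_any (\<lambda>t. vscale (qpow (- t * E) * qpow t) (nth_product n (dilate t a) 0 b (s + E) v)
                   when 2 * t \<in> \<int>))"


section \<open>Modules over the quantum group\<close>

text \<open>A module over the algebra given by generators and relations is a vector space \<open>L\<close> over \<open>F\<close> with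
  linear operators \<open>E i\<close>, \<open>F i\<close>, \<open>K i\<close>, \<open>K' i\<close> (the actions of \<open>e\<^sub>i\<close>, \<open>f\<^sub>i\<close>, \<open>K\<^sub>i\<close>, \<open>K\<^sub>i\<^sup>-\<^sup>1\<close>)
  satisfying the defining relations. Here \<open>L\<close> is a subspace of an arbitrary ambient space.\<close>

definition serre ::
  "(qfield \<Rightarrow> 'v::ab_group_add \<Rightarrow> 'v) \<Rightarrow> (nat \<Rightarrow> 'v \<Rightarrow> 'v) \<Rightarrow> nat \<Rightarrow> nat \<Rightarrow> 'v \<Rightarrow> 'v" where
  "serre scale y i j x = (let m = nat (1 - cartan i j) in
     \<Sum>s = 0..m. scale ((-1) ^ s * (qfact m / (qfact s * qfact (m - s))))
       ((y i ^^ (m - s)) (y j ((y i ^^ s) x))))"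

locale Uq_module = vector_space scale
  for scale :: "qfield \<Rightarrow> 'v::ab_group_add \<Rightarrow> 'v" +
  fixes n :: nat and L :: "'v set" and E F K K' :: "nat \<Rightarrow> 'v \<Rightarrow> 'v"
  assumes subspace_L: "subspace L"
    and closed: "i \<in> {1..n} \<Longrightarrow> op \<in> {E i, F i, K i, K' i} \<Longrightarrow> x \<in> L \<Longrightarrow> op x \<in> L"
    and linear: "i \<in> {1..n} \<Longrightarrow> op \<in> {E i, F i, K i, K' i} \<Longrightarrow> linear_on_space scale scale L op"
    and K_comm: "i \<in> {1..n} \<Longrightarrow> j \<in> {1..n} \<Longrightarrow> x \<in> L \<Longrightarrow> K i (K j x) = K j (K i x)"
    and K_inv: "i \<in> {1..n} \<Longrightarrow> x \<in> L \<Longrightarrow> K i (K' i x) = x"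
               "i \<in> {1..n} \<Longrightarrow> x \<in> L \<Longrightarrow> K' i (K i x) = x"
    and K_E: "i \<in> {1..n} \<Longrightarrow> j \<in> {1..n} \<Longrightarrow> x \<in> L \<Longrightarrow>
                K i (E j (K' i x)) = scale (qpow (of_int (cartan i j))) (E j x)"
    and K_F: "i \<in> {1..n} \<Longrightarrow> j \<in> {1..n} \<Longrightarrow> x \<in> L \<Longrightarrow>
                K i (F j (K' i x)) = scale (qpow (- of_int (cartan i j))) (F j x)"
    and E_F: "i \<in> {1..n} \<Longrightarrow> j \<in> {1..n} \<Longrightarrow> x \<in> L \<Longrightarrow>
                E i (F j x) - F j (E i x) =
                  (if i = j then scale (1 / (qpow 1 - qpow (-1))) (K i x - K' i x) else 0)"
    and serre_E: "i \<in> {1..n} \<Longrightarrow> j \<in> {1..n} \<Longrightarrow> i \<noteq> j \<Longrightarrow> x \<in> L \<Longrightarrow> serre scale E i j x = 0"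
    and serre_F: "i \<in> {1..n} \<Longrightarrow> j \<in> {1..n} \<Longrightarrow> i \<noteq> j \<Longrightarrow> x \<in> L \<Longrightarrow> serre scale F i j x = 0"
begin

definition submodule :: "'v set \<Rightarrow> bool" where
  "submodule W \<longleftrightarrow> subspace W \<and> W \<subseteq> L \<and>
     (\<forall>i \<in> {1..n}. \<forall>x \<in> W. E i x \<in> W \<and> F i x \<in> W \<and> K i x \<in> W \<and> K' i x \<in> W)"

definition irreducible_module :: bool where
  "irreducible_module \<longleftrightarrow> L \<noteq> {0} \<and> (\<forall>W. submodule W \<longrightarrow> W = {0} \<or> W = L)"

definition highest_weight_vector :: "weight \<Rightarrow> 'v \<Rightarrow> bool" where
  "highest_weight_vector \<mu> v \<longleftrightarrow> v \<in> L \<and> v \<noteq> 0 \<and>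
     (\<forall>j \<in> {1..n}. E j v = 0 \<and> K j v = scale (qpow (form n \<mu> (simple_root n j))) v)"

end

text \<open>\<open>L\<close> is a model of the irreducible highest weight module \<open>L(\<mu>)\<close>, which is unique up to
  isomorphism, and \<open>v\<close> is a highest weight vector in it.\<close>

locale Uq_irreducible_hw_module = Uq_module scale n L E F K K'
  for scale :: "qfield \<Rightarrow> 'v::ab_group_add \<Rightarrow> 'v" and n L E F K K' +
  fixes \<mu> :: weight and v :: 'v
  assumes irreducible: "irreducible_module"
    and highest_weight: "highest_weight_vector \<mu> v"

end

theory Submission
  imports Defs
begin

text \<open>
  A vertex operator \<open>x\<^sub>j\<^sup>\<plusminus>(z\<^sub>1)\<close> times a normally ordered vertex operator in \<open>z\<^sub>2\<close> is a scalar rational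
  function, their contraction, times a normally ordered product. For the operators of the theorem the
  contraction is always of the form \<open>1\<close>, \<open>z\<^sub>1 - c z\<^sub>2\<close> or \<open>(z\<^sub>1 - c z\<^sub>2)\<^sup>-\<^sup>1\<close> with \<open>c\<close> an integral power of
  \<open>q\<close>. In the first two cases the product is regular and the bullet product vanishes; in the third case
  exactly one \<open>t\<close> contributes, and the bullet product is a nonzero multiple of the normally
  ordered product, again a vertex operator.

  The module \<open>L(\<lambda>\<^sub>i)\<close> is minuscule, with basis the \<open>i\<close>-element subsets \<open>S\<close> of \<open>{1..n + 1}\<close>. The operator
  reached after a sequence of nonzero products with \<open>x\<^sub>j\<^sup>-\<close> corresponds to such a subset: its contraction
  with \<open>x\<^sub>j\<^sup>-\<close> has a pole iff \<open>j \<in> S\<close> and \<open>j + 1 \<notin> S\<close>, that is iff \<open>f\<^sub>j\<close> does not kill the basis vector of \<open>S\<close>.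
  Since the contractions with \<open>x\<^sub>j\<^sup>+\<close> are the reciprocals of those with \<open>x\<^sub>j\<^sup>-\<close>, up to rescaling \<open>z\<^sub>1\<close>, they
  have a pole iff \<open>j \<notin> S\<close> and \<open>j + 1 \<in> S\<close>, that is iff \<open>e\<^sub>j\<close> does not kill it.
\<close>

section \<open>Iterated residues and the zeroth product\<close>

text \<open>Two choices hidden in the definitions shape the argument. The zeroth product uses an
  unspecified polynomial p, so a pole cannot be read off directly from the obvious factor z1 - c z2;
  the two are compared in the field F((z))((z0)), one scalar coefficient at a time, where p(z + z0,
  z) is invertible. The module is an arbitrary irreducible one without a given basis, so it is tied
  to the subsets through a submodule of a direct sum. Irreducibility makes the fibre of that
  submodule over 0 trivial, and this is all that tests for zero require.

  The induction closes because a contraction of x_j with b pairs the annihilation modes of x_j with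
  the creation modes of b only. So b is remembered through its pairings with a_1, ..., a_n and
  through (wt b, alpha_k). Taking the product with x_j^- at the pole z1 = q^t z2 changes these
  pairings by a multiple of a column of the q-Cartan matrix, which is exactly the change from S to S
  with j replaced by j + 1. A vertex operator whose character is nonzero at 0 is nonzero on the
  vacuum, so it never vanishes by accident.\<close>

instance fract :: ("{idom,ring_char_0}") field_char_0
proof
  show "inj (of_nat :: nat \<Rightarrow> 'a fract)"
    by (rule injI) (simp add: of_nat_fract eq_fract)
qed

lemma qconst_add: "qconst (a + b) = qconst a + qconst b"
  by (simp add: qconst_def)

lemma qconst_1 [simp]: "qconst 1 = 1"
  by (simp add: qconst_def One_fract_def flip: one_pCons)

section \<open>Substitution of z1 = z + z0 into scalar double series\<close>

definition qbinom :: "int \<Rightarrow> nat \<Rightarrow> qfield" where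
  "qbinom r k = qconst (of_int r gchoose k)"

lemma qbinom_0 [simp]: "qbinom r 0 = 1"
  by (simp add: qbinom_def)

lemma qbinom_Suc: "qbinom (r + 1) (Suc k) = qbinom r k + qbinom r (Suc k)"
  unfolding qbinom_def qconst_add[symmetric]
  by (simp add: gbinomial_Suc_Suc)

definition bdd_below_family :: "int \<Rightarrow> (int \<Rightarrow> int \<Rightarrow> 'a::zero) \<Rightarrow> bool" where
  "bdd_below_family B \<mu> \<longleftrightarrow> (\<forall>r u. r < B \<or> u < B \<longrightarrow> \<mu> r u = 0)"

text \<open>The coefficient of z0^k z^t in the sum of mu r u (z + z0)^r z^u, with (z + z0)^r
  expanded in nonnegative powers of z0.\<close>

definition shift_coeff :: "(int \<Rightarrow> int \<Rightarrow> qfield) \<Rightarrow> nat \<Rightarrow> int \<Rightarrow> qfield" where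
  "shift_coeff \<mu> k t = Sum_any (\<lambda>r. qbinom r k * \<mu> r (t - r + int k))"

text \<open>Iterated Laurent series form a field, with outer variable z0, so division by p(z + z0,
  z) makes sense there.\<close>

definition shift_series :: "(int \<Rightarrow> int \<Rightarrow> qfield) \<Rightarrow> qfield fls fls" where
  "shift_series \<mu> = Abs_fls (\<lambda>k. if k < 0 then 0 else Abs_fls (shift_coeff \<mu> (nat k)))"

lemma shift_coeff_eq_sum:
  assumes "bdd_below_family B \<mu>" "B' \<le> B"
  shows "shift_coeff \<mu> k t = (\<Sum>r = B'..t + int k - B'. qbinom r k * \<mu> r (t - r + int k))"
  unfolding shift_coeff_def
proof (rule Sum_any.expand_superset)
  show "{r. qbinom r k * \<mu> r (t - r + int k) \<noteq> 0} \<subseteq> {B'..t + int k - B'}"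
  proof safe
    fix r assume "qbinom r k * \<mu> r (t - r + int k) \<noteq> 0"
    then have "\<mu> r (t - r + int k) \<noteq> 0" by auto
    then have "\<not> r < B \<and> \<not> t - r + int k < B"
      using assms(1) unfolding bdd_below_family_def by blast
    then show "r \<in> {B'..t + int k - B'}" using assms(2) by auto
  qed
qed simp

lemma shift_series_nth:
  assumes "bdd_below_family B \<mu>"
  shows "fls_nth (fls_nth (shift_series \<mu>) k) t = (if k < 0 then 0 else shift_coeff \<mu> (nat k) t)"
proof -
  have "fls_nth (Abs_fls (shift_coeff \<mu> l)) t = shift_coeff \<mu> l t" for l
  proof (rule nth_Abs_fls_ex_lower_bound, intro exI allI impI)
    \<comment> \<open>A nonzero term needs r >= B and t - r + l >= B, hence t >= 2 B - l: each power
      of z0 has a finite pole in z.\<close>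
    fix t assume "t < 2 * B - int l"
    then show "shift_coeff \<mu> l t = 0"
      by (subst shift_coeff_eq_sum[OF assms order_refl]) auto
  qed
  moreover have "fls_nth (shift_series \<mu>) k = (if k < 0 then 0 else Abs_fls (shift_coeff \<mu> (nat k)))"
    unfolding shift_series_def by (rule nth_Abs_fls_ex_lower_bound) (auto intro!: exI[of _ 0])
  ultimately show ?thesis by simp
qed

lemma bdd_below_family_add:
  fixes \<mu> \<nu> :: "int \<Rightarrow> int \<Rightarrow> 'a::comm_monoid_add"
  shows "bdd_below_family B \<mu> \<Longrightarrow> bdd_below_family B \<nu> \<Longrightarrow> bdd_below_family B (\<lambda>r u. \<mu> r u + \<nu> r u)"
  by (auto simp: bdd_below_family_def)

lemma bdd_below_family_scale:
  fixes \<mu> :: "int \<Rightarrow> int \<Rightarrow> 'a::mult_zero"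
  shows "bdd_below_family B \<mu> \<Longrightarrow> bdd_below_family B (\<lambda>r u. c * \<mu> r u)"
  by (auto simp: bdd_below_family_def)

lemma bdd_below_family_shift:
  "bdd_below_family B \<mu> \<Longrightarrow> bdd_below_family B (\<lambda>r u. \<mu> (r - int i) (u - int j))"
  by (auto simp: bdd_below_family_def)

lemma shift_series_add:
  assumes "bdd_below_family B \<mu>" "bdd_below_family B \<nu>"
  shows "shift_series (\<lambda>r u. \<mu> r u + \<nu> r u) = shift_series \<mu> + shift_series \<nu>"
  by (intro fls_eqI)
    (simp add: shift_series_nth[OF assms(1)] shift_series_nth[OF assms(2)]
      shift_series_nth[OF bdd_below_family_add[OF assms]]
      shift_coeff_eq_sum[OF assms(1) order_refl] shift_coeff_eq_sum[OF assms(2) order_refl]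
      shift_coeff_eq_sum[OF bdd_below_family_add[OF assms] order_refl] distrib_left sum.distrib)

lemma shift_series_scale:
  assumes "bdd_below_family B \<mu>"
  shows "shift_series (\<lambda>r u. c * \<mu> r u) = fls_const (fls_const c) * shift_series \<mu>"
  by (intro fls_eqI)
    (simp add: shift_series_nth[OF assms] shift_series_nth[OF bdd_below_family_scale[OF assms]]
      shift_coeff_eq_sum[OF assms order_refl] sum_distrib_left
      shift_coeff_eq_sum[OF bdd_below_family_scale[OF assms] order_refl] mult.left_commute)

lemma shift_series_zero: "shift_series (\<lambda>r u. 0) = 0"
proof -
  have "bdd_below_family 0 (\<lambda>r u. 0 :: qfield)" by (simp add: bdd_below_family_def)
  from shift_series_scale[OF this, of 0] show ?thesis by simp
qed

lemma shift_series_sum: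
  assumes "finite I" "\<And>i. i \<in> I \<Longrightarrow> bdd_below_family B (\<mu> i)"
  shows "shift_series (\<lambda>r u. \<Sum>i\<in>I. \<mu> i r u) = (\<Sum>i\<in>I. shift_series (\<mu> i))
         \<and> bdd_below_family B (\<lambda>r u. \<Sum>i\<in>I. \<mu> i r u)"
  using assms
proof (induction I rule: finite_induct)
  case empty
  then show ?case by (simp add: shift_series_zero bdd_below_family_def)
next
  case (insert x F)
  then show ?case by (simp add: shift_series_add[of B] bdd_below_family_add)
qed

lemma shift_series_shift2:
  assumes "bdd_below_family B \<mu>"
  shows "shift_series (\<lambda>r u. \<mu> r (u - 1)) = fls_const fls_X * shift_series \<mu>"
proof (intro fls_eqI)
  fix k t
  have b: "bdd_below_family B (\<lambda>r u. \<mu> r (u - 1))"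
    using assms by (auto simp: bdd_below_family_def)
  have "shift_coeff (\<lambda>r u. \<mu> r (u - 1)) l t = shift_coeff \<mu> l (t - 1)" for l
    unfolding shift_coeff_def by (intro Sum_any.cong) (simp add: algebra_simps)
  then show "fls_nth (fls_nth (shift_series (\<lambda>r u. \<mu> r (u - 1))) k) t
      = fls_nth (fls_nth (fls_const fls_X * shift_series \<mu>) k) t"
    by (simp add: shift_series_nth[OF b] shift_series_nth[OF assms] fls_X_times_conv_shift)
qed

text \<open>Multiplication by z1 becomes multiplication by z + z0: after reindexing r the shift sits
  in the binomial coefficient, and Pascal's rule \<open>qbinom_Suc\<close> splits it into the two
  summands.\<close>

lemma shift_series_shift1:
  assumes "bdd_below_family B \<mu>"
  shows "shift_series (\<lambda>r u. \<mu> (r - 1) u) = (fls_X + fls_const fls_X) * shift_series \<mu>"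
proof (intro fls_eqI)
  fix k t
  have b: "bdd_below_family B (\<lambda>r u. \<mu> (r - 1) u)"
    using assms by (auto simp: bdd_below_family_def)
  have re: "shift_coeff (\<lambda>r u. \<mu> (r - 1) u) l t
      = (\<Sum>r = B-1..t + int l - B. qbinom (r + 1) l * \<mu> r (t - 1 - r + int l))" for l
  proof -
    have "shift_coeff (\<lambda>r u. \<mu> (r - 1) u) l t
        = (\<Sum>r = B..t + int l - B + 1. qbinom r l * \<mu> (r - 1) (t - r + int l))"
      unfolding shift_coeff_eq_sum[OF b order_refl] using assms
      by (intro sum.mono_neutral_left) (auto simp: bdd_below_family_def)
    also have "\<dots> = (\<Sum>r = B-1..t + int l - B. qbinom (r + 1) l * \<mu> r (t - 1 - r + int l))"
      by (rule sum.reindex_bij_witness[of _ "\<lambda>r. r + 1" "\<lambda>r. r - 1"]) (auto simp: algebra_simps)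
    finally show ?thesis .
  qed
  have ex: "shift_coeff \<mu> l t = (\<Sum>r = B-1..B' . qbinom r l * \<mu> r (t - r + int l))"
    if "B' \<ge> t + int l - B" for l t B'
    unfolding shift_coeff_eq_sum[OF assms order_refl] using assms that
    by (intro sum.mono_neutral_left) (auto simp: bdd_below_family_def)
  have 0: "shift_coeff (\<lambda>r u. \<mu> (r - 1) u) 0 t = shift_coeff \<mu> 0 (t - 1)"
    unfolding re by (subst ex[of _ _ "t + int 0 - B"]) auto
  have S: "shift_coeff (\<lambda>r u. \<mu> (r - 1) u) (Suc l) t = shift_coeff \<mu> (Suc l) (t - 1) + shift_coeff \<mu> l t" for l
    unfolding re qbinom_Suc
    by (subst (1 2) ex[of _ _ "t + int (Suc l) - B"]) (auto simp: algebra_simps sum.distrib)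
  show "fls_nth (fls_nth (shift_series (\<lambda>r u. \<mu> (r - 1) u)) k) t
      = fls_nth (fls_nth ((fls_X + fls_const fls_X) * shift_series \<mu>) k) t"
  proof (cases "k > 0")
    case True
    then obtain l where l: "nat k = Suc l" "nat (k - 1) = l"
      by (metis Suc_pred nat_diff_distrib' nat_1 One_nat_def diff_Suc_1 less_imp_le zero_less_nat_eq zero_le_one)
    then show ?thesis using True
      by (simp add: distrib_right shift_series_nth[OF b] shift_series_nth[OF assms] fls_X_times_conv_shift S)
  next
    case False
    then show ?thesis using 0
      by (auto simp add: distrib_right shift_series_nth[OF b] shift_series_nth[OF assms] fls_X_times_conv_shift)
  qed
qed

lemma shift_series_shift:
  assumes "bdd_below_family B \<mu>"
  shows "shift_series (\<lambda>r u. \<mu> (r - int i) (u - int j))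
       = (fls_X + fls_const fls_X) ^ i * fls_const fls_X ^ j * shift_series \<mu>"
proof (induction i)
  case 0
  show ?case
  proof (induction j)
    case (Suc j)
    have "shift_series (\<lambda>r u. \<mu> (r - int 0) (u - int (Suc j)))
        = shift_series (\<lambda>r u. (\<lambda>r u. \<mu> (r - int 0) (u - int j)) r (u - 1))"
      by (simp add: algebra_simps)
    also have "\<dots> = fls_const fls_X * shift_series (\<lambda>r u. \<mu> (r - int 0) (u - int j))"
      by (rule shift_series_shift2, rule bdd_below_family_shift, rule assms)
    finally show ?case unfolding Suc by (simp add: mult_ac)
  qed simp
next
  case (Suc i)
  have "shift_series (\<lambda>r u. \<mu> (r - int (Suc i)) (u - int j))
      = shift_series (\<lambda>r u. (\<lambda>r u. \<mu> (r - int i) (u - int j)) (r - 1) u)"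
    by (simp add: algebra_simps)
  also have "\<dots> = (fls_X + fls_const fls_X) * shift_series (\<lambda>r u. \<mu> (r - int i) (u - int j))"
    by (rule shift_series_shift1, rule bdd_below_family_shift, rule assms)
  finally show ?case unfolding Suc by (simp add: mult_ac)
qed

text \<open>This is p(z + z0, z), the series inverted in \<open>iota_inverse\<close>.\<close>

definition shifted_poly :: "qfield poly poly \<Rightarrow> qfield fls fls" where
  "shifted_poly p =
     poly (map_poly (\<lambda>c. fls_const (fps_to_fls (fps_of_poly c))) p) (fls_X + fls_const fls_X)"

lemma fls_const_sum: "fls_const (sum f A) = (\<Sum>x\<in>A. fls_const (f x))"
  by (induction A rule: infinite_finite_induct) (auto simp flip: fls_plus_const)

lemma fps_to_fls_sum: "fps_to_fls (sum f A) = (\<Sum>x\<in>A. fps_to_fls (f x))"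
  by (induction A rule: infinite_finite_induct) auto

lemma fls_const_power: "fls_const c ^ k = fls_const (c ^ k)" for c :: "'a::comm_semiring_1"
  by (induction k) auto

lemma fps_to_fls_of_poly: "fps_to_fls (fps_of_poly c) = (\<Sum>j\<le>degree c. fls_const (coeff c j) * fls_X ^ j)"
  for c :: "'a::comm_ring_1 poly"
proof -
  have "c = (\<Sum>j\<le>degree c. monom (coeff c j) j)"
    by (simp add: poly_as_sum_of_monoms)
  then have "fps_to_fls (fps_of_poly c) = fps_to_fls (fps_of_poly (\<Sum>j\<le>degree c. monom (coeff c j) j))"
    by simp
  also have "\<dots> = (\<Sum>j\<le>degree c. fls_const (coeff c j) * fls_X ^ j)"
    by (simp add: fps_of_poly_sum fps_of_poly_monom fps_to_fls_sum fls_times_fps_to_fls fps_to_fls_power)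
  finally show ?thesis .
qed

lemma shifted_poly_eq_sum:
  "shifted_poly p = (\<Sum>i\<le>degree p. \<Sum>j\<le>degree (coeff p i).
     fls_const (fls_const (coeff (coeff p i) j)) * ((fls_X + fls_const fls_X) ^ i * fls_const fls_X ^ j))"
proof -
  let ?\<iota> = "\<lambda>c::qfield poly. fls_const (fps_to_fls (fps_of_poly c))"
  have "?\<iota> c = 0 \<longleftrightarrow> c = 0" for c
    by (simp add: fls_const_nonzero)
  then have "degree (map_poly ?\<iota> p) = degree p"
    by (intro degree_map_poly) auto
  then have "shifted_poly p = (\<Sum>i\<le>degree p. ?\<iota> (coeff p i) * (fls_X + fls_const fls_X) ^ i)"
    unfolding shifted_poly_def poly_altdef by (simp add: coeff_map_poly)
  also have "\<dots> = (\<Sum>i\<le>degree p. \<Sum>j\<le>degree (coeff p i).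
     fls_const (fls_const (coeff (coeff p i) j)) * ((fls_X + fls_const fls_X) ^ i * fls_const fls_X ^ j))"
    by (simp only: fps_to_fls_of_poly fls_const_sum sum_distrib_right sum_distrib_left
       fls_const_mult_const[symmetric] fls_const_power[symmetric] mult_ac)
  finally show ?thesis .
qed

lemma shift_series_poly:
  assumes "bdd_below_family B \<mu>"
  shows "shift_series (\<lambda>r u. \<Sum>i\<le>degree p. \<Sum>j\<le>degree (coeff p i).
            coeff (coeff p i) j * \<mu> (r - int i) (u - int j)) = shifted_poly p * shift_series \<mu>"
proof -
  let ?f = "\<lambda>i j r u. coeff (coeff p i) j * \<mu> (r - int i) (u - int j)"
  have b: "bdd_below_family B (?f i j)" for i j
    by (intro bdd_below_family_scale bdd_below_family_shift assms)
  have 1: "shift_series (?f i j) = fls_const (fls_const (coeff (coeff p i) j))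
      * ((fls_X + fls_const fls_X) ^ i * fls_const fls_X ^ j * shift_series \<mu>)" for i j
    by (subst shift_series_scale[OF bdd_below_family_shift[OF assms]]) (simp only: shift_series_shift[OF assms])
  have 2: "shift_series (\<lambda>r u. \<Sum>j\<le>degree (coeff p i). ?f i j r u) = (\<Sum>j\<le>degree (coeff p i). shift_series (?f i j))
     \<and> bdd_below_family B (\<lambda>r u. \<Sum>j\<le>degree (coeff p i). ?f i j r u)" for i
    by (rule shift_series_sum) (auto intro: b)
  have "shift_series (\<lambda>r u. \<Sum>i\<le>degree p. \<Sum>j\<le>degree (coeff p i). ?f i j r u)
      = (\<Sum>i\<le>degree p. shift_series (\<lambda>r u. \<Sum>j\<le>degree (coeff p i). ?f i j r u))"
    by (rule conjunct1[OF shift_series_sum]) (use 2 in auto)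
  then show ?thesis
    using 2 by (simp only: 1 shifted_poly_eq_sum sum_distrib_right sum_distrib_left mult_ac)
qed

lemma poly_map_fls_const_X:
  "poly (map_poly fls_const q) fls_X = fps_to_fls (fps_of_poly q)" for q :: "'a::comm_ring_1 poly"
  by (induction q) (simp_all add: map_poly_pCons fps_of_poly_pCons fls_times_fps_to_fls mult.commute)

text \<open>Over F((z)), the polynomial p in z1 is composed with z0 + z, which has degree 1 in z0,
  so the result is a nonzero polynomial in z0; polynomials embed into Laurent series.\<close>

lemma shifted_poly_nonzero:
  assumes "p \<noteq> 0"
  shows "shifted_poly p \<noteq> 0"
proof -
  let ?\<iota> = "\<lambda>c::qfield poly. fps_to_fls (fps_of_poly c)"
  define q where "q = map_poly ?\<iota> p"
  have "q \<noteq> 0"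
    using assms unfolding q_def by (subst map_poly_eq_0_iff) auto
  then have q': "pcompose q [:fls_X, 1:] \<noteq> 0"
    using pcompose_eq_0[of q "[:fls_X, 1:]"] by auto
  have "poly (map_poly fls_const q) (x + fls_const y) = poly (map_poly fls_const (pcompose q [:y, 1:])) x"
    for q :: "qfield fls poly" and x y
  proof (induction q)
    case (pCons a q)
    have add: "map_poly fls_const (f + g) = map_poly fls_const f + map_poly fls_const g" for f g :: "qfield fls poly"
      by (intro poly_eqI) (simp add: coeff_map_poly fls_plus_const)
    have sm: "map_poly fls_const (smult c f) = smult (fls_const c) (map_poly fls_const f)" for c and f :: "qfield fls poly"
      by (intro poly_eqI) (simp add: coeff_map_poly)
    have "pcompose (pCons a q) [:y, 1:] = [:a:] + smult y (pcompose q [:y, 1:]) + pCons 0 (pcompose q [:y, 1:])"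
      by (simp add: pcompose_pCons)
    then show ?case using pCons by (simp add: add sm map_poly_pCons algebra_simps)
  qed simp
  from this[of q fls_X fls_X] have "shifted_poly p = fps_to_fls (fps_of_poly (pcompose q [:fls_X, 1:]))"
    unfolding shifted_poly_def poly_map_fls_const_X[symmetric] q_def
    by (subst (asm) map_poly_map_poly) (auto simp: o_def)
  then show ?thesis using q' fps_of_poly_eq_iff[of _ 0] by simp
qed

section \<open>Scalar coefficients of vectors of V\<close>

lemma lookup_fconst_mult: "Poly_Mapping.lookup (fconst c * p) m = c * Poly_Mapping.lookup p m"
proof (induction p rule: poly_mapping_add_induct)
  case (single k d)
  then show ?case by (simp add: fconst_def mult_single lookup_single when_def)
qed (simp add: distrib_left lookup_add)

lemma lookup_fscale: "Poly_Mapping.lookup (fscale c p) m = c * Poly_Mapping.lookup p m"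
  by (simp add: fscale_def lookup_fconst_mult)

lemma lookup_vscale: "Poly_Mapping.lookup (vscale c v) \<beta> = fscale c (Poly_Mapping.lookup v \<beta>)"
  unfolding vscale_def by transfer (simp add: when_def fscale_def)

text \<open>Passing to one scalar coefficient at a time makes the field of iterated Laurent series
  available for series with values in V.\<close>

definition vcoeff :: "weight \<Rightarrow> (nat \<times> nat \<Rightarrow>\<^sub>0 nat) \<Rightarrow> vspace \<Rightarrow> qfield" where
  "vcoeff \<beta> m v = Poly_Mapping.lookup (Poly_Mapping.lookup v \<beta>) m"

lemma vcoeff_eqI: "(\<And>\<beta> m. vcoeff \<beta> m v = vcoeff \<beta> m w) \<Longrightarrow> v = w"
  by (intro poly_mapping_eqI) (simp add: vcoeff_def)

lemma vcoeff_simps [simp]: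
  "vcoeff \<beta> m 0 = 0" "vcoeff \<beta> m (v + w) = vcoeff \<beta> m v + vcoeff \<beta> m w"
  "vcoeff \<beta> m (v - w) = vcoeff \<beta> m v - vcoeff \<beta> m w"
  "vcoeff \<beta> m (vscale c v) = c * vcoeff \<beta> m v"
  by (simp_all add: vcoeff_def lookup_add lookup_minus lookup_vscale lookup_fscale)

lemma vcoeff_sum [simp]: "vcoeff \<beta> m (sum f A) = (\<Sum>x\<in>A. vcoeff \<beta> m (f x))"
  by (induction A rule: infinite_finite_induct) auto

lemma vcoeff_Sum_any:
  assumes "finite A" "\<And>x. x \<notin> A \<Longrightarrow> f x = 0"
  shows "vcoeff \<beta> m (Sum_any f) = (\<Sum>x\<in>A. vcoeff \<beta> m (f x))"
  using assms by (subst Sum_any.expand_superset[of A]) auto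

lemma vscale_simps [simp]: "vscale 0 v = 0" "vscale 1 v = v" "vscale c 0 = 0"
  "vscale (- c) v = - vscale c v"
  using vcoeff_simps(3)[of _ _ 0]
  by (auto intro!: vcoeff_eqI)

lemma vscale_vscale: "vscale c (vscale d v) = vscale (c * d) v"
  by (auto intro!: vcoeff_eqI)

lemma fls_times_nth_superset:
  fixes f g :: "'a::semiring_0 fls"
  assumes "finite I" "\<And>i. i \<notin> I \<Longrightarrow> fls_nth f i * fls_nth g (k - i) = 0"
  shows "fls_nth (f * g) k = (\<Sum>i\<in>I. fls_nth f i * fls_nth g (k - i))"
proof -
  let ?J = "{fls_subdegree f..k - fls_subdegree g}"
  have "fls_nth f i * fls_nth g (k - i) = 0" if "i \<notin> ?J" for i
    using that by (cases "i < fls_subdegree f") auto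
  then have "(\<Sum>i\<in>?J. fls_nth f i * fls_nth g (k - i)) = (\<Sum>i\<in>?J \<union> I. fls_nth f i * fls_nth g (k - i))"
    using assms(1) by (intro sum.mono_neutral_left) auto
  also have "\<dots> = (\<Sum>i\<in>I. fls_nth f i * fls_nth g (k - i))"
    using assms by (intro sum.mono_neutral_right) auto
  finally show ?thesis by (simp add: fls_times_nth(2))
qed

lemma laurent2E:
  assumes "f \<in> laurent2 N M"
  obtains B where "\<And>r s. r < B \<or> s < B \<Longrightarrow> f r s = 0"
  using assms unfolding laurent2_def by blast

text \<open>Exponents of z2 may be fractional, but the coefficient at a fixed s only involves the
  coset of s modulo the integers, so families indexed by integers suffice.\<close>

lemma bdd_below_family_vcoeff:
  fixes M :: "rat \<Rightarrow> rat \<Rightarrow> vspace"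
  assumes "\<And>r s. r < B \<or> s < B \<Longrightarrow> M r s = 0" "B' \<le> \<lfloor>B\<rfloor>" "B' \<le> \<lfloor>B - s\<rfloor>"
  shows "bdd_below_family B' (\<lambda>r u. vcoeff \<beta> m (M (of_int r) (s + of_int u)))"
  unfolding bdd_below_family_def
proof (intro allI impI)
  fix r u assume "r < B' \<or> u < B'"
  then have "of_int r < B \<or> s + of_int u < B"
    using assms(2,3) by linarith
  then show "vcoeff \<beta> m (M (of_int r) (s + of_int u)) = 0"
    by (simp add: assms(1))
qed

lemma vcoeff_subst_shift:
  assumes B: "\<And>r s. r < B \<or> s < B \<Longrightarrow> mult_pair p a b r s v = 0"
    and B': "B' \<le> \<lfloor>B\<rfloor>" "B' \<le> \<lfloor>B - s\<rfloor>"
  shows "vcoeff \<beta> m (subst_shift p a b k (s + of_int t) v) =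
           shift_coeff (\<lambda>r u. vcoeff \<beta> m (mult_pair p a b (of_int r) (s + of_int u) v)) k t"
    and "t < 2 * B' - int k \<Longrightarrow> subst_shift p a b k (s + of_int t) v = 0"
proof -
  have 0: "vscale (qconst (of_int r gchoose k)) (mult_pair p a b (of_int r) (s + of_int t - of_int r + of_nat k) v) = 0"
    if "r \<notin> {B'..t + int k - B'}" for r :: int
  proof -
    have "of_int r < B \<or> s + of_int t - of_int r + of_nat k < B"
      using that B' by (auto; linarith)
    then show ?thesis by (simp add: B)
  qed
  have "vcoeff \<beta> m (subst_shift p a b k (s + of_int t) v) =
      (\<Sum>r = B'..t + int k - B'. vcoeff \<beta> m (vscale (qconst (of_int r gchoose k))
        (mult_pair p a b (of_int r) (s + of_int t - of_int r + of_nat k) v)))"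
    unfolding subst_shift_def using 0 by (intro vcoeff_Sum_any) auto
  also have "\<dots> = shift_coeff (\<lambda>r u. vcoeff \<beta> m (mult_pair p a b (of_int r) (s + of_int u) v)) k t"
    by (subst shift_coeff_eq_sum[OF bdd_below_family_vcoeff[where M = "\<lambda>r s. mult_pair p a b r s v", OF B B'] order_refl])
      (auto simp: qbinom_def algebra_simps)
  finally show "vcoeff \<beta> m (subst_shift p a b k (s + of_int t) v) =
           shift_coeff (\<lambda>r u. vcoeff \<beta> m (mult_pair p a b (of_int r) (s + of_int u) v)) k t" .
  assume "t < 2 * B' - int k"
  then have "{B'..t + int k - B'} = {}" by simp
  with 0 show "subst_shift p a b k (s + of_int t) v = 0"
    unfolding subst_shift_def by simp
qed

lemma Sum_any_eq_sum: "finite A \<Longrightarrow> (\<And>x. x \<notin> A \<Longrightarrow> f x = 0) \<Longrightarrow> Sum_any f = sum f A"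
  by (rule Sum_any.expand_superset) auto

text \<open>The residue at \<open>z\<^sub>0 = 0\<close> of \<open>\<iota>(p(z\<^sub>0 + z, z)\<^sup>-\<^sup>1) M(z + z\<^sub>0, z)\<close>, for \<open>M = p(z\<^sub>1, z) a(z\<^sub>1) b(z)\<close>.\<close>

lemma vcoeff_nth_product:
  assumes B: "\<And>r s. r < B \<or> s < B \<Longrightarrow> mult_pair p a b r s v = 0"
    and qc: "quasi_compatible n a b"
    and p: "p = (SOME p. compat_poly n a b p)"
  shows "vcoeff \<beta> m (nth_product n a 0 b s v) = fls_nth (fls_nth
     (inverse (shifted_poly p) *
      shift_series (\<lambda>r u. vcoeff \<beta> m (mult_pair p a b (of_int r) (s + of_int u) v))) (-1)) 0"
proof -
  define \<mu> where "\<mu> = (\<lambda>r u. vcoeff \<beta> m (mult_pair p a b (of_int r) (s + of_int u) v))"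
  define g where "g = inverse (shifted_poly p)"
  define B' where "B' = min \<lfloor>B\<rfloor> \<lfloor>B - s\<rfloor>"
  have B'_le: "B' \<le> \<lfloor>B\<rfloor>" "B' \<le> \<lfloor>B - s\<rfloor>" by (auto simp: B'_def)
  \<comment> \<open>For k > \<open>K\<close> the coefficient of g at -1 - k lies below its pole
    order. For the remaining k, \<open>t0\<close> bounds from below the powers of z in these
    coefficients, and beyond the upper end of \<open>T\<close> the shifted series vanishes.\<close>
  define K where "K = nat (-1 - fls_subdegree g)"
  define I where "I = {..K}"
  define t0 where "t0 = Min ((\<lambda>k. fls_subdegree (fls_nth g (-1 - int k))) ` I)"
  define T where "T = {t0..int K - 2 * B'}"
  note sub = vcoeff_subst_shift[OF B B'_le]
  have sub0: "subst_shift p a b k (s - of_int t) v = 0" if "- t < 2 * B' - int k" for k t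
    using sub(2)[OF _ that] by simp
  have subc: "vcoeff \<beta> m (subst_shift p a b k (s - of_int t) v) = shift_coeff \<mu> k (- t)" for k t
    using sub(1)[where \<beta> = \<beta> and m = m and k = k and t = "- t"] by (simp add: \<mu>_def)
  have fin: "finite I" by (simp add: I_def)
  have gI: "fls_nth g (-1 - int k) = 0" if "k \<notin> I" for k
    using that by (intro fls_eq0_below_subdegree) (auto simp: I_def K_def)
  have gT: "fls_nth (fls_nth g (-1 - int k)) t = 0" if "t < t0" "k \<in> I" for k t
  proof -
    have "t0 \<le> fls_subdegree (fls_nth g (-1 - int k))"
      unfolding t0_def using that fin by (intro Min_le) auto
    then show ?thesis using that by simp
  qed
  have out: "vscale (fls_nth (fls_nth g (-1 - int k)) t) (subst_shift p a b k (s - of_int t) v) = 0"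
    if "(k, t) \<notin> I \<times> T" for k t
  proof (cases "k \<in> I")
    case True
    then have "t < t0 \<or> - t < 2 * B' - int k"
      using that by (auto simp: T_def I_def)
    then show ?thesis using gT[OF _ True] sub0 by auto
  qed (simp add: gI)
  have "vcoeff \<beta> m (nth_product n a 0 b s v) = vcoeff \<beta> m (Sum_any (\<lambda>(k, t).
      vscale (fls_nth (fls_nth g (-1 - int k)) t) (subst_shift p a b k (s - of_int t) v)))"
    unfolding nth_product_def Let_def g_def shifted_poly_def p using qc by (simp add: iota_inverse_def)
  also have "\<dots> = (\<Sum>(k, t)\<in>I \<times> T. fls_nth (fls_nth g (-1 - int k)) t * shift_coeff \<mu> k (- t))"
  proof (subst vcoeff_Sum_any[of "I \<times> T"])
    show "(case x of (k, t) \<Rightarrow> vscale (fls_nth (fls_nth g (-1 - int k)) t)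
        (subst_shift p a b k (s - of_int t) v)) = 0" if "x \<notin> I \<times> T" for x
    proof -
      obtain k t where "x = (k, t)" by (cases x)
      then show ?thesis using out[of k t] that by simp
    qed
  qed (use fin in \<open>auto simp: T_def subc intro!: sum.cong\<close>)
  also have "\<dots> = (\<Sum>k\<in>I. \<Sum>t\<in>T. fls_nth (fls_nth g (-1 - int k)) t * shift_coeff \<mu> k (- t))"
    by (rule sum.cartesian_product[symmetric])
  finally have L: "vcoeff \<beta> m (nth_product n a 0 b s v) =
      (\<Sum>k\<in>I. \<Sum>t\<in>T. fls_nth (fls_nth g (-1 - int k)) t * shift_coeff \<mu> k (- t))" .
  have bdd: "bdd_below_family B' \<mu>"
    unfolding \<mu>_def by (rule bdd_below_family_vcoeff[OF B B'_le])
  note nth = shift_series_nth[OF bdd]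
  have "fls_nth (shift_series \<mu> * g) (-1) = (\<Sum>i\<in>int ` I. fls_nth (shift_series \<mu>) i * fls_nth g (-1 - i))"
  proof (rule fls_times_nth_superset)
    fix i assume i: "i \<notin> int ` I"
    show "fls_nth (shift_series \<mu>) i * fls_nth g (-1 - i) = 0"
    proof (cases "i < 0")
      case True
      then have "fls_nth (shift_series \<mu>) i = 0" by (intro fls_zero_eqI) (simp add: nth)
      then show ?thesis by simp
    next
      case False
      then have "nat i \<notin> I" using i by (metis image_eqI int_nat_eq not_less)
      from gI[OF this] False show ?thesis by simp
    qed
  qed (simp add: fin)
  also have "\<dots> = (\<Sum>k\<in>I. fls_nth g (-1 - int k) * fls_nth (shift_series \<mu>) (int k))"
    by (simp add: sum.reindex mult.commute)
  finally have "fls_nth (fls_nth (g * shift_series \<mu>) (-1)) 0 =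
     (\<Sum>k\<in>I. fls_nth (fls_nth g (-1 - int k) * fls_nth (shift_series \<mu>) (int k)) 0)"
    by (simp add: mult.commute fls_nth_sum)
  also have "\<dots> = (\<Sum>k\<in>I. \<Sum>t\<in>T. fls_nth (fls_nth g (-1 - int k)) t * shift_coeff \<mu> k (- t))"
  proof (rule sum.cong[OF refl])
    fix k assume k: "k \<in> I"
    have "fls_nth (fls_nth g (-1 - int k) * fls_nth (shift_series \<mu>) (int k)) 0
       = (\<Sum>t\<in>T. fls_nth (fls_nth g (-1 - int k)) t * fls_nth (fls_nth (shift_series \<mu>) (int k)) (0 - t))"
    proof (rule fls_times_nth_superset)
      fix t assume "t \<notin> T"
      then have "t < t0 \<or> - t < 2 * B' - int k"
        using k by (auto simp: T_def I_def)
      moreover have "shift_coeff \<mu> k (- t) = 0" if "- t < 2 * B' - int k"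
        using sub0[OF that] subc[of k t] by simp
      ultimately show "fls_nth (fls_nth g (-1 - int k)) t * fls_nth (fls_nth (shift_series \<mu>) (int k)) (0 - t) = 0"
        using gT[OF _ k] by (auto simp: nth)
    qed (simp add: T_def)
    then show "fls_nth (fls_nth g (-1 - int k) * fls_nth (shift_series \<mu>) (int k)) 0 =
      (\<Sum>t\<in>T. fls_nth (fls_nth g (-1 - int k)) t * shift_coeff \<mu> k (- t))"
      by (simp add: nth)
  qed
  finally show ?thesis unfolding L \<mu>_def g_def by simp
qed

section \<open>Zeroth products with at most a simple pole\<close>

lemma mult_pair_linear:
  "mult_pair [:[:0, - c:], 1:] a b r s v = a (r - 1) (b s v) - vscale c (a r (b (s - 1) v))"
  by (cases "c = 0") (simp_all add: mult_pair_def)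

lemma vcoeff_mult_pair: "vcoeff \<beta> m (mult_pair p a b r s v) = (\<Sum>i\<le>degree p. \<Sum>j\<le>degree (coeff p i).
   coeff (coeff p i) j * vcoeff \<beta> m (a (r - of_nat i) (b (s - of_nat j) v)))"
  by (simp add: mult_pair_def)

text \<open>If \<open>(z\<^sub>1 - c z\<^sub>2) a(z\<^sub>1) b(z\<^sub>2) = N(z\<^sub>1, z\<^sub>2)\<close> is regular then the zeroth product is the residue of
  \<open>N(z + z\<^sub>0, z) / (z\<^sub>0 + (1 - c) z)\<close>. The case \<open>c = 0\<close> covers regular products.\<close>

lemma nth_product_0:
  assumes a: "a \<in> hom_laurent n 1" and b: "b \<in> hom_laurent n (n + 1)"
    and N: "\<And>v. v \<in> V n \<Longrightarrow> (\<lambda>r s. N r s v) \<in> laurent2 (n + 1) (V n)"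
    and rel: "\<And>v r s. v \<in> V n \<Longrightarrow> a (r - 1) (b s v) - vscale c (a r (b (s - 1) v)) = N r s v"
    and v: "v \<in> V n"
  shows "nth_product n a 0 b s v = (if c = 1 then Sum_any (\<lambda>r::int. N (of_int r) (s - of_int r) v) else 0)"
proof -
  have compat: "compat_poly n a b [:[:0, - c:], 1:]"
    unfolding compat_poly_def mult_pair_linear using N rel by auto
  then have qc: "quasi_compatible n a b"
    unfolding quasi_compatible_def using a b by blast
  \<comment> \<open>The definition of the product picks an unknown p; z1 - c z2 only witnesses that
    a choice exists.\<close>
  define p where "p = (SOME p. compat_poly n a b p)"
  have "compat_poly n a b p"
    unfolding p_def using compat by (rule someI)
  then have p0: "p \<noteq> 0" and pl: "(\<lambda>r s. mult_pair p a b r s v) \<in> laurent2 (n + 1) (V n)"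
    using v by (auto simp: compat_poly_def)
  obtain B1 where B1: "\<And>r s. r < B1 \<or> s < B1 \<Longrightarrow> mult_pair p a b r s v = 0"
    using laurent2E[OF pl] by blast
  obtain B2 where B2: "\<And>r s. r < B2 \<or> s < B2 \<Longrightarrow> N r s v = 0"
    using laurent2E[OF N[OF v]] by blast
  define B where "B = min (min \<lfloor>B1\<rfloor> \<lfloor>B1 - s\<rfloor>) (min \<lfloor>B2\<rfloor> \<lfloor>B2 - s\<rfloor>)"
  have res: "vcoeff \<beta> m (nth_product n a 0 b s v) =
    (if c = 1 then Sum_any (\<lambda>r::int. vcoeff \<beta> m (N (of_int r) (s - of_int r) v)) else 0)" for \<beta> m
  proof -
    define \<mu> where "\<mu> = (\<lambda>r u. vcoeff \<beta> m (mult_pair p a b (of_int r) (s + of_int u) v))"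
    define \<nu> where "\<nu> = (\<lambda>r u. vcoeff \<beta> m (N (of_int r) (s + of_int u) v))"
    define Q where "Q = inverse (shifted_poly p) * shift_series \<mu>"
    have \<mu>: "bdd_below_family B \<mu>" and \<nu>: "bdd_below_family B \<nu>"
      unfolding \<mu>_def \<nu>_def
      by (rule bdd_below_family_vcoeff[OF B1], simp, simp add: B_def, simp add: B_def)
         (rule bdd_below_family_vcoeff[OF B2], simp, simp add: B_def, simp add: B_def)
    let ?w = "\<lambda>r s. vcoeff \<beta> m (a r (b s v))"
    have \<nu>w: "\<nu> r u = ?w (of_int r - 1) (s + of_int u) - c * ?w (of_int r) (s + of_int u - 1)" for r u
      unfolding \<nu>_def rel[OF v, symmetric] by simp
    \<comment> \<open>Both sides are coefficients of (z1 - c z2) p(z1, z2) a(z1) b(z2).\<close>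
    have "(\<lambda>r u. \<mu> (r - int 1) (u - int 0) + (- c) * \<mu> (r - int 0) (u - int 1)) =
      (\<lambda>r u. \<Sum>i\<le>degree p. \<Sum>j\<le>degree (coeff p i). coeff (coeff p i) j * \<nu> (r - int i) (u - int j))"
      unfolding \<nu>w unfolding \<mu>_def vcoeff_mult_pair
      by (intro ext) (simp add: algebra_simps sum_distrib_left flip: sum.distrib)
    then have "shift_series (\<lambda>r u. \<mu> (r - int 1) (u - int 0) + (- c) * \<mu> (r - int 0) (u - int 1)) =
       shifted_poly p * shift_series \<nu>"
      using shift_series_poly[OF \<nu>] by simp
    also have "shift_series (\<lambda>r u. \<mu> (r - int 1) (u - int 0) + (- c) * \<mu> (r - int 0) (u - int 1)) =
      (fls_X + fls_const fls_X) ^ 1 * fls_const fls_X ^ 0 * shift_series \<mu> +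
      fls_const (fls_const (- c)) * ((fls_X + fls_const fls_X) ^ 0 * fls_const fls_X ^ 1 * shift_series \<mu>)"
      by (simp only: shift_series_add[OF bdd_below_family_shift[OF \<mu>] bdd_below_family_scale[OF bdd_below_family_shift[OF \<mu>]]]
        shift_series_scale[OF bdd_below_family_shift[OF \<mu>]] shift_series_shift[OF \<mu>])
    also have "\<dots> = (fls_X + fls_const (fls_const (1 - c) * fls_X)) * shift_series \<mu>"
    proof -
      have 1: "fls_const (fls_const (- c)) = - fls_const (fls_const c)"
        by (intro fls_eqI) simp
      have 2: "fls_const (fls_const (1 - c) * fls_X) = fls_const fls_X - fls_const (fls_const c) * fls_const fls_X"
        by (intro fls_eqI) (auto simp: left_diff_distrib simp flip: fls_minus_const)
      show ?thesis unfolding 1 2 by (simp only: power_one_right power_0 mult_1_left mult_1_right) (simp only: ring_distribs mult_minus_left mult.assoc add_diff_eq diff_conv_add_uminus add.assoc)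
    qed
    \<comment> \<open>The unknown p cancels, leaving (z0 + (1 - c) z) Q = N(z + z0, z).\<close>
    finally have YQ: "(fls_X + fls_const (fls_const (1 - c) * fls_X)) * Q = shift_series \<nu>"
      using shifted_poly_nonzero[OF p0] by (simp add: Q_def field_simps)
    have L: "vcoeff \<beta> m (nth_product n a 0 b s v) = fls_nth (fls_nth Q (-1)) 0"
      using vcoeff_nth_product[OF B1 qc p_def] by (simp add: Q_def \<mu>_def)
    show ?thesis
    proof (cases "c = 1")
      case True
      \<comment> \<open>Here z0 Q = N(z + z0, z), so the residue of Q is the term of degree 0 in z0,
        namely N(z, z).\<close>
      then have "fls_nth Q (-1) = fls_nth (shift_series \<nu>) 0"
        by (simp add: fls_X_times_conv_shift flip: YQ)
      then have "fls_nth (fls_nth Q (-1)) 0 = shift_coeff \<nu> 0 0"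
        by (simp add: shift_series_nth[OF \<nu>])
      then show ?thesis using True
        by (simp add: L shift_coeff_def) (simp add: \<nu>_def)
    next
      case False
      \<comment> \<open>The term (1 - c) z of degree 0 in z0 is invertible in F((z)), so dividing by
        z0 + (1 - c) z creates no negative power of z0.\<close>
      have "fls_nth Q (-1) = 0"
      proof (cases "Q = 0")
        case Q: False
        define u where "u = fls_const (1 - c) * (fls_X :: qfield fls)"
        have "u \<noteq> 0" using False by (simp add: u_def fls_const_nonzero)
        define Y where "Y = fls_X + fls_const u"
        have Y0: "fls_nth Y 0 = u" by (simp add: Y_def)
        then have Yn: "Y \<noteq> 0" using \<open>u \<noteq> 0\<close> by auto
        have "fls_subdegree Y \<le> 0"
          using Y0 \<open>u \<noteq> 0\<close> by (intro fls_subdegree_leI) simp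
        moreover have "fls_subdegree Y + fls_subdegree Q = fls_subdegree (shift_series \<nu>)"
          using YQ Yn Q by (metis Y_def u_def fls_subdegree_mult)
        moreover have "fls_subdegree (shift_series \<nu>) \<ge> 0"
          by (intro fls_subdegree_ge0I fls_zero_eqI) (simp add: shift_series_nth[OF \<nu>])
        ultimately show ?thesis by (intro fls_eq0_below_subdegree) linarith
      qed simp
      then show ?thesis using False by (simp add: L)
    qed
  qed
  have fin: "N (of_int r) (s - of_int r) v = 0" if "r \<notin> {\<lfloor>B2\<rfloor>..\<lceil>s - B2\<rceil>}" for r :: int
  proof -
    have "of_int r < B2 \<or> s - of_int r < B2" using that by (auto; linarith)
    then show ?thesis by (rule B2)
  qed
  show ?thesis
  proof (rule vcoeff_eqI)
    fix \<beta> m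
    have "vcoeff \<beta> m (Sum_any (\<lambda>r::int. N (of_int r) (s - of_int r) v)) =
       Sum_any (\<lambda>r::int. vcoeff \<beta> m (N (of_int r) (s - of_int r) v))"
      using fin by (subst vcoeff_Sum_any[of "{\<lfloor>B2\<rfloor>..\<lceil>s - B2\<rceil>}"], simp, simp)
         (rule Sum_any_eq_sum[symmetric], simp_all)
    then show "vcoeff \<beta> m (nth_product n a 0 b s v) =
       vcoeff \<beta> m (if c = 1 then Sum_any (\<lambda>r::int. N (of_int r) (s - of_int r) v) else 0)"
      by (simp add: res)
  qed
qed

section \<open>Exponentials of commuting operators\<close>

lemma fconst_simps: "fconst 0 = 0" "fconst 1 = 1" "fconst (a + b) = fconst a + fconst b"
  "fconst (a * b) = fconst a * fconst b" "fconst (- a) = - fconst a"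
  by (simp_all add: fconst_def single_add mult_single single_uminus)

lemma fconst_of_nat: "fconst (of_nat k) = of_nat k"
  by (induction k) (simp_all add: fconst_simps)

lemma fconst_sum: "fconst (sum f A) = (\<Sum>x\<in>A. fconst (f x))"
  by (induction A rule: infinite_finite_induct) (auto simp: fconst_simps)

text \<open>Although \<open>fock\<close> is only a polynomial ring, k can be cancelled by
  multiplying with the constant 1/k, since F has characteristic 0.\<close>

lemma fock_of_nat_cancel:
  assumes "of_nat k * p = of_nat k * (q :: fock)" "k > 0"
  shows "p = q"
proof -
  have 1: "fconst (1 / of_nat k) * (of_nat k * x) = x" for x
  proof -
    have "fconst (1 / of_nat k) * (of_nat k * x) = fconst (1 / of_nat k * of_nat k) * x"
      by (simp only: fconst_simps(4) fconst_of_nat mult.assoc)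
    also have "1 / of_nat k * of_nat k = (1 :: qfield)" using assms(2) by simp
    finally show ?thesis by (simp only: fconst_simps mult_1_left)
  qed
  have "fconst (1 / of_nat k) * (of_nat k * p) = fconst (1 / of_nat k) * (of_nat k * q)"
    by (simp only: assms(1))
  then show ?thesis by (simp only: 1)
qed

definition linop :: "(fock \<Rightarrow> fock) \<Rightarrow> bool" where
  "linop B \<longleftrightarrow> (\<forall>p q. B (p + q) = B p + B q) \<and> (\<forall>c p. B (fconst c * p) = fconst c * B p)"

lemma linopD:
  assumes "linop B"
  shows "B (p + q) = B p + B q" "B (fconst c * p) = fconst c * B p" "B 0 = 0"
    "B (sum f I) = (\<Sum>i\<in>I. B (f i))" "B (of_nat k * p) = of_nat k * B p"
    "B (p - q) = B p - B q"
proof -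
  show 1: "B (p + q) = B p + B q" and 2: "B (fconst c * p) = fconst c * B p" for p q c
    using assms by (auto simp: linop_def)
  show 3: "B 0 = 0" using 2[of 0 0] by (simp add: fconst_simps)
  show "B (sum f I) = (\<Sum>i\<in>I. B (f i))"
    by (induction I rule: infinite_finite_induct) (auto simp: 1 3)
  show "B (of_nat k * p) = of_nat k * B p"
    using 2[of "of_nat k" p] by (simp add: fconst_of_nat)
  show "B (p - q) = B p - B q"
    using 1[of "p - q" q] by simp
qed

lemma linop_mult: "linop ((*) p)"
  by (simp add: linop_def algebra_simps)

definition commuting :: "(nat \<Rightarrow> fock \<Rightarrow> fock) \<Rightarrow> bool" where
  "commuting A \<longleftrightarrow> (\<forall>r. linop (A r)) \<and> (\<forall>r s p. A r (A s p) = A s (A r p))"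

lemma commutingD: "commuting A \<Longrightarrow> linop (A r)" "commuting A \<Longrightarrow> A r (A s p) = A s (A r p)"
  by (auto simp: commuting_def)

lemma sum_triangle_swap:
  fixes f :: "nat \<Rightarrow> nat \<Rightarrow> 'a::comm_monoid_add"
  shows "(\<Sum>r=1..m. \<Sum>s=1..m-r. f r s) = (\<Sum>s=1..m. \<Sum>r=1..m-s. f r s)"
  unfolding sum.Sigma[OF finite_atLeastAtMost ballI[OF finite_atLeastAtMost]]
  by (rule sum.reindex_bij_witness[of _ "\<lambda>(a, b). (b, a)" "\<lambda>(a, b). (b, a)"]) auto

lemma sum_triangle_left:
  fixes f :: "nat \<Rightarrow> nat \<Rightarrow> nat \<Rightarrow> 'a::comm_monoid_add"
  shows "(\<Sum>k\<le>m. \<Sum>r=1..k. f r (k - r) (m - k)) = (\<Sum>r=1..m. \<Sum>k\<le>m-r. f r k (m - r - k))"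
  unfolding sum.Sigma[OF finite_atLeastAtMost ballI[OF finite_atMost]]
    sum.Sigma[OF finite_atMost ballI[OF finite_atLeastAtMost]]
  by (rule sum.reindex_bij_witness[of _ "\<lambda>(r, k). (k + r, r)" "\<lambda>(k, r). (r, k - r)"]) auto

lemma sum_triangle_right:
  fixes f :: "nat \<Rightarrow> nat \<Rightarrow> nat \<Rightarrow> 'a::comm_monoid_add"
  shows "(\<Sum>k\<le>m. \<Sum>r=1..m-k. f r k (m - k - r)) = (\<Sum>r=1..m. \<Sum>k\<le>m-r. f r k (m - r - k))"
  unfolding sum.Sigma[OF finite_atLeastAtMost ballI[OF finite_atMost]]
    sum.Sigma[OF finite_atMost ballI[OF finite_atLeastAtMost]]
  by (rule sum.reindex_bij_witness[of _ "\<lambda>(r, k). (k, r)" "\<lambda>(k, r). (r, k)"])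
    (auto simp: add.commute)

lemma op_pow_cong: "(\<And>r p. r \<ge> 1 \<Longrightarrow> A r p = A' r p) \<Longrightarrow> op_pow A k m p = op_pow A' k m p"
  by (induction k arbitrary: m) auto

lemma op_exp_cong: "(\<And>r p. r \<ge> 1 \<Longrightarrow> A r p = A' r p) \<Longrightarrow> op_exp A m p = op_exp A' m p"
  unfolding op_exp_def by (simp cong: op_pow_cong)

lemma op_pow_eq_0: "commuting A \<Longrightarrow> m < k \<Longrightarrow> op_pow A k m p = 0"
proof (induction k arbitrary: m)
  case (Suc k)
  then show ?case by (auto intro!: sum.neutral simp: linopD[OF commutingD(1)])
qed simp

text \<open>The power rule \<theta>(S^(k+1)) = (k + 1) \<theta>(S) S^k with \<theta> = w d/dw, valid
  because the modes commute. The induction writes m = r + (m - r), which is the Leibniz rule for S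
  times S^k.\<close>

lemma op_pow_Suc_euler:
  assumes A: "commuting A"
  shows "of_nat m * op_pow A (Suc k) m p = of_nat (Suc k) * (\<Sum>r=1..m. of_nat r * A r (op_pow A k (m - r) p))"
proof (induction k arbitrary: m)
  case 0
  show ?case
    by (auto simp: sum_distrib_left linopD[OF commutingD(1)[OF A]] intro!: sum.cong)
next
  case (Suc k)
  have "of_nat m * op_pow A (Suc (Suc k)) m p = (\<Sum>r=1..m. of_nat m * A r (op_pow A (Suc k) (m - r) p))"
    by (simp add: sum_distrib_left)
  also have "\<dots> = (\<Sum>r=1..m. of_nat r * A r (op_pow A (Suc k) (m - r) p) +
      A r (of_nat (m - r) * op_pow A (Suc k) (m - r) p))"
  proof (intro sum.cong refl)
    fix r assume "r \<in> {1..m}"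
    then have "of_nat m * x = of_nat r * x + of_nat (m - r) * x" for x :: fock
      by (simp flip: distrib_right of_nat_add)
    then show "of_nat m * A r (op_pow A (Suc k) (m - r) p) = of_nat r * A r (op_pow A (Suc k) (m - r) p)
        + A r (of_nat (m - r) * op_pow A (Suc k) (m - r) p)"
      by (simp only: linopD(5)[OF commutingD(1)[OF A]])
  qed
  also have "\<dots> = (\<Sum>r=1..m. of_nat r * A r (op_pow A (Suc k) (m - r) p)) +
     (\<Sum>r=1..m. of_nat (Suc k) * (\<Sum>s=1..m-r. of_nat s * A s (A r (op_pow A k (m - r - s) p))))"
  proof -
    have "A r (of_nat (m - r) * op_pow A (Suc k) (m - r) p) =
        of_nat (Suc k) * (\<Sum>s=1..m-r. of_nat s * A s (A r (op_pow A k (m - r - s) p)))" for r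
      unfolding Suc by (simp only: linopD(4,5)[OF commutingD(1)[OF A]] commutingD(2)[OF A, of r])
    then show ?thesis by (simp only: sum.distrib)
  qed
  also have "(\<Sum>r=1..m. of_nat (Suc k) * (\<Sum>s=1..m-r. of_nat s * A s (A r (op_pow A k (m - r - s) p))))
    = of_nat (Suc k) * (\<Sum>s=1..m. \<Sum>r=1..m-s. of_nat s * A s (A r (op_pow A k (m - r - s) p)))"
    by (subst sum_triangle_swap[symmetric]) (simp add: sum_distrib_left)
  also have "(\<Sum>s=1..m. \<Sum>r=1..m-s. of_nat s * A s (A r (op_pow A k (m - r - s) p)))
    = (\<Sum>s=1..m. of_nat s * A s (op_pow A (Suc k) (m - s) p))"
    by (simp add: linopD(4)[OF commutingD(1)[OF A]] sum_distrib_left diff_diff_add add.commute)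
  finally show ?case by (simp add: algebra_simps del: op_pow.simps)
qed

lemma op_exp_0 [simp]: "op_exp A 0 p = p"
  by (simp add: op_exp_def fscale_def fconst_simps)

text \<open>With \<open>\<theta> = w d/dw\<close> this is \<open>\<theta> exp(S) = \<theta>(S) exp(S)\<close>, which determines \<open>exp(S)\<close>: all
  identities between exponentials below are proved by verifying it.\<close>

lemma op_exp_euler:
  assumes A: "commuting A"
  shows "of_nat m * op_exp A m p = (\<Sum>r=1..m. of_nat r * A r (op_exp A (m - r) p))"
proof (cases m)
  case 0
  then show ?thesis by simp
next
  case (Suc m')
  let ?c = "\<lambda>k. fconst (1 / of_nat (fact k))"
  have c: "?c (Suc k) * of_nat (Suc k) = ?c k" for k
  proof -
    have "1 / (a * b) * a = 1 / b" if "a \<noteq> 0" for a b :: qfield using that by simp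
    from this[of "of_nat (Suc k)" "of_nat (fact k)"]
    have "1 / of_nat (fact (Suc k)) * of_nat (Suc k) = (1 / of_nat (fact k) :: qfield)"
      by (simp only: fact_Suc of_nat_mult of_nat_id of_nat_eq_0_iff nat.distinct not_False_eq_True)
    then show ?thesis
      unfolding fconst_of_nat[symmetric] fconst_simps(4)[symmetric] by (simp only:)
  qed
  have "of_nat m * op_exp A m p = (\<Sum>k\<le>Suc m'. ?c k * (of_nat m * op_pow A k m p))"
    unfolding op_exp_def fscale_def Suc by (simp add: sum_distrib_left algebra_simps del: sum.atMost_Suc)
  also have "\<dots> = (\<Sum>k\<le>m'. ?c (Suc k) * (of_nat m * op_pow A (Suc k) m p))"
    unfolding sum.atMost_Suc_shift by (simp add: Suc)
  also have "\<dots> = (\<Sum>k\<le>m'. ?c k * (\<Sum>r=1..m. of_nat r * A r (op_pow A k (m - r) p)))"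
    unfolding op_pow_Suc_euler[OF A] mult.assoc[symmetric] c ..
  also have "\<dots> = (\<Sum>r=1..m. of_nat r * A r (\<Sum>k\<le>m'. ?c k * op_pow A k (m - r) p))"
    by (simp add: linopD[OF commutingD(1)[OF A]] sum_distrib_left mult.left_commute)
       (rule sum.swap)
  also have "\<dots> = (\<Sum>r=1..m. of_nat r * A r (op_exp A (m - r) p))"
  proof (intro sum.cong refl)
    fix r assume "r \<in> {1..m}"
    then have "(\<Sum>k\<le>m'. ?c k * op_pow A k (m - r) p) = op_exp A (m - r) p"
      unfolding op_exp_def fscale_def using op_pow_eq_0[OF A]
      by (intro sum.mono_neutral_right) (auto simp: Suc)
    then show "of_nat r * A r (\<Sum>k\<le>m'. ?c k * op_pow A k (m - r) p) = of_nat r * A r (op_exp A (m - r) p)"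
      by simp
  qed
  finally show ?thesis .
qed

text \<open>The recursion expresses m f(m) through earlier coefficients, and m > 0 can be
  cancelled.\<close>

lemma op_exp_unique:
  assumes A: "commuting A" and f0: "f 0 = p"
    and rec: "\<And>m. m > 0 \<Longrightarrow> of_nat m * f m = (\<Sum>r=1..m. of_nat r * A r (f (m - r)))"
  shows "f m = op_exp A m p"
proof (induction m rule: less_induct)
  case (less m)
  show ?case
  proof (cases "m = 0")
    case False
    then have "of_nat m * f m = of_nat m * op_exp A m p"
      unfolding rec[OF False[unfolded neq0_conv]] op_exp_euler[OF A] using less
      by (intro sum.cong) auto
    then show ?thesis using fock_of_nat_cancel False by blast
  qed (simp add: f0)
qed

text \<open>Applying B to the coefficients of the exponential gives a solution of the same recursion
  with initial value B p.\<close>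

lemma op_exp_commute:
  assumes A: "commuting A" and B: "linop B" "\<And>r p. r \<ge> 1 \<Longrightarrow> B (A r p) = A r (B p)"
  shows "B (op_exp A m p) = op_exp A m (B p)"
proof (rule op_exp_unique[OF A])
  fix m :: nat
  have "of_nat m * B (op_exp A m p) = B (of_nat m * op_exp A m p)"
    by (simp only: linopD(5)[OF B(1)])
  also have "\<dots> = (\<Sum>r=1..m. of_nat r * B (A r (op_exp A (m - r) p)))"
    by (simp only: op_exp_euler[OF A] linopD(4,5)[OF B(1)])
  also have "\<dots> = (\<Sum>r=1..m. of_nat r * A r (B (op_exp A (m - r) p)))"
    by (intro sum.cong refl) (simp add: B(2))
  finally show "of_nat m * B (op_exp A m p) = (\<Sum>r=1..m. of_nat r * A r (B (op_exp A (m - r) p)))" .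
qed simp

lemma linop_op_exp:
  assumes A: "commuting A"
  shows "linop (op_exp A m)"
proof -
  note L = linopD[OF commutingD(1)[OF A]]
  have "op_exp A m (p + q) = op_exp A m p + op_exp A m q" for p q
  proof (rule op_exp_unique[OF A, symmetric])
    fix m :: nat
    show "of_nat m * (op_exp A m p + op_exp A m q) =
      (\<Sum>r=1..m. of_nat r * A r (op_exp A (m - r) p + op_exp A (m - r) q))"
      by (simp only: distrib_left op_exp_euler[OF A] L(1) sum.distrib)
  qed simp
  moreover have "op_exp A m (fconst c * p) = fconst c * op_exp A m p" for c p
    by (rule op_exp_commute[OF A linop_mult, symmetric]) (simp only: L(2))
  ultimately show ?thesis unfolding linop_def by blast
qed

text \<open>The Cauchy product obeys the Leibniz rule for w d/dw; \<open>AB\<close> is used to pull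
  the modes of B in front of exp(A).\<close>

lemma op_exp_add:
  assumes A: "commuting A" and B: "commuting B"
    and AB: "\<And>r s p. A r (B s p) = B s (A r p)"
  shows "op_exp (\<lambda>r p. A r p + B r p) m p = (\<Sum>k\<le>m. op_exp A k (op_exp B (m - k) p))"
proof (rule op_exp_unique[symmetric, where f = "\<lambda>m. \<Sum>k\<le>m. op_exp A k (op_exp B (m - k) p)"])
  note LA = linopD[OF commutingD(1)[OF A]] and LB = linopD[OF commutingD(1)[OF B]]
  show "commuting (\<lambda>r p. A r p + B r p)"
    unfolding commuting_def linop_def using commutingD(2)[OF A] commutingD(2)[OF B] AB
    by (auto simp: LA LB distrib_left add_ac)
  fix m :: nat
  let ?e = "\<lambda>k l. op_exp A k (op_exp B l p)"
  have BA: "op_exp A k (B r q) = B r (op_exp A k q)" for k r q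
    using op_exp_commute[OF A commutingD(1)[OF B, of r], of k q] AB by simp
  have "of_nat m * (\<Sum>k\<le>m. ?e k (m - k)) = (\<Sum>k\<le>m. of_nat k * ?e k (m - k) + op_exp A k (of_nat (m - k) * op_exp B (m - k) p))"
    unfolding sum_distrib_left linopD(5)[OF linop_op_exp[OF A]]
    by (intro sum.cong refl) (simp add: of_nat_diff algebra_simps)
  also have "\<dots> = (\<Sum>k\<le>m. \<Sum>r=1..k. of_nat r * A r (?e (k - r) (m - k)))
      + (\<Sum>k\<le>m. \<Sum>r=1..m-k. of_nat r * B r (?e k (m - k - r)))"
    unfolding sum.distrib op_exp_euler[OF A] op_exp_euler[OF B]
    by (simp add: linopD[OF linop_op_exp[OF A]] BA)
  also have "\<dots> = (\<Sum>r=1..m. \<Sum>k\<le>m-r. of_nat r * A r (?e k (m - r - k)))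
      + (\<Sum>r=1..m. \<Sum>k\<le>m-r. of_nat r * B r (?e k (m - r - k)))"
    unfolding sum_triangle_left[where f = "\<lambda>r k l. of_nat r * A r (?e k l)"]
      sum_triangle_right[where f = "\<lambda>r k l. of_nat r * B r (?e k l)"] ..
  also have "\<dots> = (\<Sum>r=1..m. of_nat r * (A r (\<Sum>k\<le>m-r. ?e k (m - r - k)) + B r (\<Sum>k\<le>m-r. ?e k (m - r - k))))"
    by (simp add: LA LB distrib_left sum.distrib sum_distrib_left)
  finally show "of_nat m * (\<Sum>k\<le>m. ?e k (m - k)) = \<dots>" .
qed simp

lemma op_exp_dilate:
  assumes A: "commuting A"
  shows "op_exp (\<lambda>r p. fconst (c ^ r) * A r p) m p = fconst (c ^ m) * op_exp A m p"
proof (rule op_exp_unique[symmetric])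
  note LA = linopD[OF commutingD(1)[OF A]]
  show "commuting (\<lambda>r p. fconst (c ^ r) * A r p)"
    unfolding commuting_def linop_def using commutingD(2)[OF A]
    by (auto simp: LA distrib_left mult.left_commute)
  fix m :: nat
  have c: "fconst (c ^ m) = fconst (c ^ r) * fconst (c ^ (m - r))" if "r \<in> {1..m}" for r
    using that by (simp flip: fconst_simps(4) power_add)
  have "of_nat m * (fconst (c ^ m) * op_exp A m p) = fconst (c ^ m) * (of_nat m * op_exp A m p)"
    by (simp only: mult.left_commute)
  also have "\<dots> = (\<Sum>r = 1..m. fconst (c ^ m) * (of_nat r * A r (op_exp A (m - r) p)))"
    by (simp only: op_exp_euler[OF A] sum_distrib_left)
  also have "\<dots> = (\<Sum>r = 1..m. of_nat r * (fconst (c ^ r) * A r (fconst (c ^ (m - r)) * op_exp A (m - r) p)))"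
    by (intro sum.cong refl) (simp only: c LA mult_ac)
  finally show "of_nat m * (fconst (c ^ m) * op_exp A m p) = \<dots>" .
qed (simp add: fconst_simps)

text \<open>Multiplication by p commutes with the multiplication operators, hence with their
  exponential, so it can be pulled out of the argument.\<close>

lemma op_exp_mult:
  "op_exp (\<lambda>r p. c r * p) m p = op_exp (\<lambda>r p. c r * p) m 1 * p"
proof -
  have C: "commuting (\<lambda>r p. c r * p)"
    by (auto simp: commuting_def linop_def algebra_simps)
  show ?thesis
    using op_exp_commute[OF C linop_mult[of p], of m 1] by (simp add: algebra_simps)
qed

text \<open>\<open>G\<close> is the family of coefficients of \<open>exp(\<Sum> g\<^sub>r w\<^sup>r)\<close>.\<close>

definition exp_coeffs :: "(nat \<Rightarrow> qfield) \<Rightarrow> (nat \<Rightarrow> qfield) \<Rightarrow> bool" where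
  "exp_coeffs g G \<longleftrightarrow> G 0 = 1 \<and> (\<forall>m. of_nat m * G m = (\<Sum>r=1..m. of_nat r * g r * G (m - r)))"

text \<open>The scalar factor which arises in moving an annihilation exponential past a creation
  exponential is the exponential of the brackets \<open>g\<^sub>r\<close> of their modes.\<close>

lemma op_exp_contraction:
  assumes D: "commuting D"
    and der: "\<And>r p q. D r (p * q) = D r p * q + p * D r q"
    and Dc: "\<And>r s. r \<ge> 1 \<Longrightarrow> s \<ge> 1 \<Longrightarrow> D r (c s) = (if s = r then fconst (g r) else 0)"
    and G: "exp_coeffs g G"
  defines "E \<equiv> \<lambda>l. op_exp (\<lambda>r p. c r * p) l 1"
  shows "op_exp D m (E l * p) =
    (\<Sum>k\<le>m. if k \<le> l then fconst (G k) * (E (l - k) * op_exp D (m - k) p) else 0)"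
proof -
  note LD = linopD[OF commutingD(1)[OF D]]
  have C: "commuting (\<lambda>r p. c r * p)"
    by (auto simp: commuting_def linop_def algebra_simps)
  \<comment> \<open>Since D r is a derivation, it acts on the exponential of the c s as
    multiplication by the scalar g r w^r.\<close>
  have DE: "D r (E j) = (if r \<le> j then fconst (g r) * E (j - r) else 0)" if r: "r \<ge> 1" for r j
  proof (induction j rule: less_induct)
    case (less j)
    show ?case
    proof (cases "j = 0")
      case True
      have "D r 1 = 0" using der[of r 1 1] by simp
      then show ?thesis using True r by (simp add: E_def)
    next
      case False
      have "of_nat j * D r (E j) = D r (of_nat j * E j)" by (simp add: LD)
      also have "\<dots> = (\<Sum>s=1..j. of_nat s * D r (c s * E (j - s)))"
        unfolding E_def op_exp_euler[OF C] by (simp add: LD)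
      also have "\<dots> = (\<Sum>s=1..j. (if s = r then of_nat s * (fconst (g r) * E (j - s)) else 0)
          + (if r \<le> j - s then of_nat s * (fconst (g r) * (c s * E (j - s - r))) else 0))"
        using r less by (intro sum.cong refl) (auto simp: der Dc algebra_simps)
      also have "\<dots> = (if r \<le> j then of_nat r * (fconst (g r) * E (j - r)) else 0)
          + (\<Sum>s=1..j. if r \<le> j - s then of_nat s * (fconst (g r) * (c s * E (j - s - r))) else 0)"
        using r by (simp add: sum.distrib sum.delta)
      also have "(\<Sum>s=1..j. if r \<le> j - s then of_nat s * (fconst (g r) * (c s * E (j - s - r))) else 0)
          = (if r \<le> j then fconst (g r) * (of_nat (j - r) * E (j - r)) else 0)"
      proof (cases "r \<le> j")
        case True
        have "fconst (g r) * (of_nat (j - r) * E (j - r)) =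
            (\<Sum>s=1..j - r. of_nat s * (fconst (g r) * (c s * E (j - r - s))))"
          unfolding E_def op_exp_euler[OF C] by (simp add: sum_distrib_left mult_ac)
        also have "\<dots> = (\<Sum>s=1..j. if r \<le> j - s then of_nat s * (fconst (g r) * (c s * E (j - s - r))) else 0)"
          using True r by (intro sum.mono_neutral_cong_left) (auto simp: add.commute)
        finally show ?thesis using True by simp
      qed (auto intro!: sum.neutral)
      finally have "of_nat j * D r (E j) = of_nat j * (if r \<le> j then fconst (g r) * E (j - r) else 0)"
        by (auto simp: of_nat_diff algebra_simps)
      then show ?thesis using False fock_of_nat_cancel by blast
    qed
  qed
  \<comment> \<open>Extension by 0 to k > l replaces truncated subtraction and frees
    \<open>DE'\<close> of case distinctions.\<close>
  define E' where "E' k = (if k \<le> l then E (l - k) else 0)" for k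
  have DE': "D r (E' k) = fconst (g r) * E' (k + r)" if "r \<ge> 1" for r k
    using that by (auto simp: E'_def DE LD intro!: arg_cong[of _ _ E])
  define f where "f m = (\<Sum>k\<le>m. fconst (G k) * (E' k * op_exp D (m - k) p))" for m
  have "f m = op_exp D m (E l * p)"
  proof (rule op_exp_unique[OF D])
    show "f 0 = E l * p" using G by (simp add: f_def E'_def exp_coeffs_def fconst_simps)
    fix m :: nat
    let ?X = "\<lambda>k. op_exp D k p"
    have GG: "fconst (G k) * of_nat k = (\<Sum>r=1..k. of_nat r * (fconst (g r) * fconst (G (k - r))))" for k
    proof -
      have "fconst (G k) * of_nat k = fconst (of_nat k * G k)"
        by (simp add: fconst_simps fconst_of_nat)
      also have "of_nat k * G k = (\<Sum>r=1..k. of_nat r * g r * G (k - r))"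
        using G by (simp add: exp_coeffs_def)
      finally show ?thesis by (simp add: fconst_sum fconst_simps fconst_of_nat mult.assoc)
    qed
    have "of_nat m * f m = (\<Sum>k\<le>m. fconst (G k) * of_nat k * (E' k * ?X (m - k))
          + fconst (G k) * (E' k * (of_nat (m - k) * ?X (m - k))))"
      unfolding f_def sum_distrib_left
      by (intro sum.cong refl) (simp add: of_nat_diff algebra_simps)
    \<comment> \<open>The first sum comes from differentiating the scalar factor G, the second from
      differentiating exp(D). They match the two terms of the Leibniz rule for D r on a
      product.\<close>
    also have "\<dots> = (\<Sum>k\<le>m. \<Sum>r=1..k. of_nat r * (fconst (g r) * (fconst (G (k - r)) * (E' (k - r + r) * ?X (m - k)))))
        + (\<Sum>k\<le>m. \<Sum>r=1..m-k. of_nat r * (fconst (G k) * (E' k * D r (?X (m - k - r)))))"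
      unfolding sum.distrib op_exp_euler[OF D] GG
      by (simp add: sum_distrib_right sum_distrib_left mult_ac cong: sum.cong)
        (intro sum.cong refl, simp add: mult_ac)
    also have "\<dots> = (\<Sum>r=1..m. \<Sum>k\<le>m-r. of_nat r * (fconst (g r) * (fconst (G k) * (E' (k + r) * ?X (m - r - k)))))
        + (\<Sum>r=1..m. \<Sum>k\<le>m-r. of_nat r * (fconst (G k) * (E' k * D r (?X (m - r - k)))))"
      unfolding sum_triangle_left[where f = "\<lambda>r k j. of_nat r * (fconst (g r) * (fconst (G k) * (E' (k + r) * ?X j)))"]
       sum_triangle_right[where f = "\<lambda>r k j. of_nat r * (fconst (G k) * (E' k * D r (?X j)))"] ..
    also have "\<dots> = (\<Sum>r=1..m. of_nat r * D r (f (m - r)))"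
      unfolding f_def sum.distrib[symmetric]
    proof (intro sum.cong refl)
      fix r assume "r \<in> {1..m}"
      then have derE: "D r (E' k * q) = fconst (g r) * (E' (k + r) * q) + E' k * D r q" for k q
        by (simp add: der DE' mult.assoc)
      show "(\<Sum>k\<le>m-r. of_nat r * (fconst (g r) * (fconst (G k) * (E' (k + r) * ?X (m - r - k)))) +
          of_nat r * (fconst (G k) * (E' k * D r (?X (m - r - k))))) =
        of_nat r * D r (\<Sum>k\<le>m-r. fconst (G k) * (E' k * ?X (m - r - k)))"
        by (simp only: LD(2,4) derE) (simp only: sum_distrib_left distrib_left mult_ac)
    qed
    finally show "of_nat m * f m = (\<Sum>r=1..m. of_nat r * D r (f (m - r)))" .
  qed
  then show ?thesis
    by (simp add: f_def E'_def if_distrib[of "\<lambda>x. x * _"] if_distrib[of "\<lambda>x. _ * x"] cong: if_cong)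
qed

lemma exp_coeffs_zero: "exp_coeffs (\<lambda>r. 0) (\<lambda>m. if m = 0 then 1 else 0)"
  by (auto simp: exp_coeffs_def)

text \<open>The sum of (c w)^r / r is -log(1 - c w), whose exponential is (1 - c w)^-1.\<close>

lemma exp_coeffs_geometric: "exp_coeffs (\<lambda>r. c ^ r / of_nat r) (\<lambda>m. c ^ m)"
proof -
  have "(\<Sum>r=1..m. of_nat r * (c ^ r / of_nat r) * c ^ (m - r)) = (\<Sum>r=1..m. c ^ m)" for m
  proof (intro sum.cong refl)
    fix r assume "r \<in> {1..m}"
    then have "c ^ m = c ^ r * c ^ (m - r)" "r \<noteq> 0"
      by (auto simp flip: power_add)
    then show "of_nat r * (c ^ r / of_nat r) * c ^ (m - r) = c ^ m" by simp
  qed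
  then show ?thesis by (simp add: exp_coeffs_def)
qed

text \<open>The exponential of log(1 - c w). For m >= 2 only r = m - 1 and r = m contribute to the
  recursion, and they cancel.\<close>

lemma exp_coeffs_linear:
  "exp_coeffs (\<lambda>r. - (c ^ r / of_nat r)) (\<lambda>m. if m = 0 then 1 else if m = 1 then - c else 0)"
proof -
  define g where "g r = - (c ^ r / of_nat r)" for r :: nat
  define G where "G m = (if m = 0 then 1 else if m = 1 then - c else 0)" for m :: nat
  have "of_nat m * G m = (\<Sum>r=1..m. of_nat r * g r * G (m - r))" for m
  proof -
    consider "m = 0" | "m = 1" | m' where "m = Suc (Suc m')"
      by (metis One_nat_def not0_implies_Suc)
    then show ?thesis
    proof cases
      case 3
      have "(\<Sum>r=1..m. of_nat r * g r * G (m - r)) = (\<Sum>r\<in>{Suc m', m}. of_nat r * g r * G (m - r))"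
        by (rule sum.mono_neutral_right) (auto simp: 3 G_def)
      also have "\<dots> = 0" by (simp add: 3 G_def g_def del: of_nat_Suc)
      finally show ?thesis by (simp add: 3 G_def)
    qed (auto simp: g_def G_def)
  qed
  moreover have "G 0 = 1" by (simp add: G_def)
  ultimately have "exp_coeffs g G" by (simp add: exp_coeffs_def)
  moreover have "g = (\<lambda>r. - (c ^ r / of_nat r))" "G = (\<lambda>m. if m = 0 then 1 else if m = 1 then - c else 0)"
    by (auto simp: g_def G_def)
  ultimately show ?thesis by simp
qed

section \<open>Creation and annihilation exponentials\<close>

type_synonym modes = "nat \<Rightarrow> nat \<Rightarrow> qfield"

text \<open>In \<open>modes\<close> the arguments are the index l of a_l and the absolute value r of
  the mode. Creation modes record the coefficients of the a_l(-r) multiplied in, annihilation modes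
  the values of the derivation on the a_l(-r).\<close>

definition creation :: "nat \<Rightarrow> modes \<Rightarrow> nat \<Rightarrow> fock \<Rightarrow> fock" where
  "creation n c r p = (\<Sum>l=1..n. fconst (c l r) * fvar (l, r)) * p"

definition annih :: "modes \<Rightarrow> nat \<Rightarrow> fock \<Rightarrow> fock" where
  "annih d r = fock_deriv (\<lambda>(l, s). if s = r then fconst (d l r) else 0)"

abbreviation "annih_exp d \<equiv> op_exp (annih d)"

abbreviation "creation_exp n c \<equiv> op_exp (creation n c)"

lemma annih_alt: "annih d r = fock_deriv (\<lambda>x. fconst (if snd x = r then d (fst x) r else 0))"
  unfolding annih_def by (rule arg_cong[of _ _ fock_deriv]) (auto simp: fun_eq_iff fconst_simps)

lemma fock_deriv_fconst_mult: "fock_deriv d (fconst c * p) = fconst c * fock_deriv d p"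
  by (simp add: fock_deriv_mult fock_deriv_fconst)

lemma linop_annih: "linop (annih d r)"
  by (simp add: linop_def annih_def fock_deriv_add fock_deriv_fconst_mult)

lemma annih_comm: "annih d r (annih d' s p) = annih d' s (annih d r p)"
  unfolding annih_alt by (rule fock_deriv_commute)

lemma commuting_annih: "commuting (annih d)"
  unfolding commuting_def using linop_annih annih_comm by blast

lemma commuting_creation: "commuting (creation n c)"
  by (auto simp: commuting_def linop_def creation_def algebra_simps)

lemma annih_mult: "annih d r (p * q) = annih d r p * q + p * annih d r q"
  by (simp add: annih_def fock_deriv_mult)

text \<open>These scalars are the g r of \<open>op_exp_contraction\<close>: a contraction involves
  the annihilation modes of the left factor and the creation modes of the right factor only.\<close>

lemma annih_creation:
  "annih d r (\<Sum>l=1..n. fconst (c l s) * fvar (l, s)) =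
     (if s = r then fconst (\<Sum>l=1..n. d l r * c l r) else 0)"
proof -
  have "annih d r (\<Sum>l=1..n. fconst (c l s) * fvar (l, s)) = (\<Sum>l=1..n. fconst (c l s) * annih d r (fvar (l, s)))"
    by (simp only: linopD[OF linop_annih])
  then show ?thesis
    by (auto simp: annih_def fock_deriv_fvar fconst_sum fconst_simps mult.commute)
qed


text \<open>P depends on a degree which mode r lowers by r; a family constant in the degree covers
  plain closure. One induction thus serves both the carrier and the degree bounds.\<close>

lemma op_exp_closed:
  fixes P :: "int \<Rightarrow> fock \<Rightarrow> bool"
  assumes "\<And>d. P d 0" "\<And>d p q. P d p \<Longrightarrow> P d q \<Longrightarrow> P d (p + q)" "\<And>d c p. P d p \<Longrightarrow> P d (fconst c * p)"
    and A: "\<And>r d p. r \<ge> 1 \<Longrightarrow> P d p \<Longrightarrow> P (d - int r) (A r p)"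
    and p: "P d p"
  shows "P (d - int m) (op_exp A m p)"
proof -
  have sum: "P d (sum f I)" if "\<And>i. i \<in> I \<Longrightarrow> P d (f i)" for d f and I :: "nat set"
    using that by (induction I rule: infinite_finite_induct) (auto intro: assms)
  have "P (d - int m) (op_pow A k m p)" for k
  proof (induction k arbitrary: m)
    case 0
    then show ?case using p assms(1) by simp
  next
    case (Suc k)
    have "P (d - int m) (A r (op_pow A k (m - r) p))" if "r \<in> {1..m}" for r
      using A[OF _ Suc, of r "m - r"] that by (auto simp: of_nat_diff)
    then show ?case by (simp only: op_pow.simps) (rule sum)
  qed
  then show ?thesis unfolding op_exp_def fscale_def by (intro sum assms(3)) auto
qed

lemma keys_annih:
  "Poly_Mapping.keys (annih d r p) \<subseteq> {m - Poly_Mapping.single x 1 |m x. m \<in> Poly_Mapping.keys p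
     \<and> x \<in> Poly_Mapping.keys m \<and> snd x = r}"
proof -
  have *: "Poly_Mapping.keys (Poly_Mapping.single a b * (case x of (l, s) \<Rightarrow> if s = r then fconst (d l r) else 0))
      \<subseteq> {y. y = a \<and> snd x = r}" for a :: "nat \<times> nat \<Rightarrow>\<^sub>0 nat" and b x
    by (cases x) (auto simp: fconst_def mult_single split: if_splits)
  show ?thesis
    unfolding annih_def fock_deriv_def
  proof (rule order_trans[OF keys_sum], rule UN_least, rule order_trans[OF keys_sum], rule UN_least)
    fix m x assume "m \<in> Poly_Mapping.keys p" "x \<in> Poly_Mapping.keys m"
    then show "Poly_Mapping.keys (Poly_Mapping.single (m - Poly_Mapping.single x 1)
       (Poly_Mapping.lookup p m * of_nat (Poly_Mapping.lookup m x)) *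
       (case x of (l, s) \<Rightarrow> if s = r then fconst (d l r) else 0))
      \<subseteq> {m - Poly_Mapping.single x 1 |m x. m \<in> Poly_Mapping.keys p \<and> x \<in> Poly_Mapping.keys m \<and> snd x = r}"
      by (intro order_trans[OF *]) blast
  qed
qed

lemma keys_fconst_mult: "Poly_Mapping.keys (fconst c * p) \<subseteq> Poly_Mapping.keys p"
  by (auto simp: in_keys_iff lookup_fconst_mult)

lemma fock_carrier_zero: "0 \<in> fock_carrier n"
  and fock_carrier_one: "1 \<in> fock_carrier n"
  by (auto simp: fock_carrier_def)

lemma fock_carrier_add: "p \<in> fock_carrier n \<Longrightarrow> q \<in> fock_carrier n \<Longrightarrow> p + q \<in> fock_carrier n"
  unfolding fock_carrier_def using keys_add[of p q] by blast

lemma fock_carrier_sum: "(\<And>i. i \<in> I \<Longrightarrow> f i \<in> fock_carrier n) \<Longrightarrow> sum f I \<in> fock_carrier n"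
  by (induction I rule: infinite_finite_induct) (auto intro: fock_carrier_add fock_carrier_zero)

lemma fock_carrier_mult:
  assumes "p \<in> fock_carrier n" "q \<in> fock_carrier n"
  shows "p * q \<in> fock_carrier n"
  unfolding fock_carrier_def
proof (intro CollectI ballI subsetI)
  fix m z assume "m \<in> Poly_Mapping.keys (p * q)" and z: "z \<in> Poly_Mapping.keys m"
  then obtain x y where "x \<in> Poly_Mapping.keys p" "y \<in> Poly_Mapping.keys q" "m = x + y"
    using keys_mult[of p q] by auto
  then show "z \<in> {1..n} \<times> {0<..}"
    using assms z keys_add[of x y] unfolding fock_carrier_def by blast
qed

lemma fock_carrier_fconst: "fconst c \<in> fock_carrier n"
  by (auto simp: fock_carrier_def fconst_def split: if_splits)

lemma fock_carrier_fvar: "l \<in> {1..n} \<Longrightarrow> r \<ge> 1 \<Longrightarrow> fvar (l, r) \<in> fock_carrier n"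
  by (auto simp: fock_carrier_def fvar_def)

lemma fock_carrier_annih: "p \<in> fock_carrier n \<Longrightarrow> annih d r p \<in> fock_carrier n"
proof -
  assume p: "p \<in> fock_carrier n"
  have "Poly_Mapping.keys (m - Poly_Mapping.single x 1) \<subseteq> Poly_Mapping.keys m"
    for m :: "nat \<times> nat \<Rightarrow>\<^sub>0 nat" and x
    by (auto simp: in_keys_iff lookup_minus)
  then show ?thesis
    using p keys_annih[of d r p] unfolding fock_carrier_def by blast
qed

lemma fock_carrier_op_exp_annih:
  assumes "p \<in> fock_carrier n" shows "annih_exp d m p \<in> fock_carrier n"
  by (rule op_exp_closed[where P = "\<lambda>_ p. p \<in> fock_carrier n" and d = 0])
    (auto intro: assms fock_carrier_add fock_carrier_zero fock_carrier_annih fock_carrier_mult fock_carrier_fconst)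

lemma fock_carrier_op_exp_creation:
  assumes "p \<in> fock_carrier n" shows "creation_exp n c m p \<in> fock_carrier n"
  by (rule op_exp_closed[where P = "\<lambda>_ p. p \<in> fock_carrier n" and d = 0])
    (auto simp: creation_def intro!: assms fock_carrier_add fock_carrier_zero fock_carrier_mult
      fock_carrier_sum fock_carrier_fconst fock_carrier_fvar)

text \<open>The grading in which a_l(-r) has degree r.\<close>

definition wdeg :: "(nat \<times> nat \<Rightarrow>\<^sub>0 nat) \<Rightarrow> nat" where
  "wdeg m = (\<Sum>x\<in>Poly_Mapping.keys m. snd x * Poly_Mapping.lookup m x)"

lemma wdeg_superset: "finite A \<Longrightarrow> Poly_Mapping.keys m \<subseteq> A \<Longrightarrow>
    wdeg m = (\<Sum>x\<in>A. snd x * Poly_Mapping.lookup m x)"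
  unfolding wdeg_def by (rule sum.mono_neutral_left) (auto simp: in_keys_iff)

lemma wdeg_remove:
  assumes "x \<in> Poly_Mapping.keys m"
  shows "wdeg (m - Poly_Mapping.single x 1) + snd x = wdeg m"
proof -
  let ?A = "Poly_Mapping.keys m"
  have "Poly_Mapping.keys (m - Poly_Mapping.single x 1) \<subseteq> ?A"
    by (auto simp: in_keys_iff lookup_minus)
  then have 1: "wdeg (m - Poly_Mapping.single x 1) =
      (\<Sum>y\<in>?A. snd y * (Poly_Mapping.lookup m y - (if y = x then 1 else 0)))"
    by (subst wdeg_superset[of ?A]) (auto simp: lookup_minus lookup_single when_def intro!: sum.cong)
  have 2: "snd x = (\<Sum>y\<in>?A. if y = x then snd y else 0)"
    using assms by (simp add: sum.delta)
  have "wdeg (m - Poly_Mapping.single x 1) + snd x = (\<Sum>y\<in>?A. snd y * Poly_Mapping.lookup m y)"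
    unfolding 1 2
    unfolding sum.distrib[symmetric]
  proof (intro sum.cong refl)
    fix y assume "y \<in> ?A"
    then obtain k where "Poly_Mapping.lookup m y = Suc k"
      using not0_implies_Suc by (metis in_keys_iff)
    then show "snd y * (Poly_Mapping.lookup m y - (if y = x then 1 else 0)) + (if y = x then snd y else 0)
       = snd y * Poly_Mapping.lookup m y" by auto
  qed
  then show ?thesis by (simp add: wdeg_def)
qed

text \<open>The bound is an integer so that it can become negative, which forces p = 0. This is how
  annihilation exponentials are shown to be locally finite.\<close>

definition deg_le :: "int \<Rightarrow> fock \<Rightarrow> bool" where
  "deg_le d p \<longleftrightarrow> (\<forall>m\<in>Poly_Mapping.keys p. int (wdeg m) \<le> d)"

lemma deg_le_simps: "deg_le d 0" "deg_le d p \<Longrightarrow> deg_le d q \<Longrightarrow> deg_le d (p + q)"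
  "deg_le d p \<Longrightarrow> deg_le d (fconst c * p)"
  using keys_add[of p q] keys_fconst_mult[of c p] unfolding deg_le_def by (simp_all, blast+)

lemma deg_le_neg: "deg_le d p \<Longrightarrow> d < 0 \<Longrightarrow> p = 0"
  unfolding deg_le_def by (metis keys_eq_empty of_nat_0_le_iff ex_in_conv not_le order_trans)

lemma deg_le_annih: "deg_le d p \<Longrightarrow> deg_le (d - int r) (annih e r p)"
  unfolding deg_le_def
proof
  fix m' assume p: "\<forall>m\<in>Poly_Mapping.keys p. int (wdeg m) \<le> d" and "m' \<in> Poly_Mapping.keys (annih e r p)"
  then obtain m x where m: "m' = m - Poly_Mapping.single x 1" "m \<in> Poly_Mapping.keys p"
      "x \<in> Poly_Mapping.keys m" "snd x = r"
    using keys_annih[of e r p] by auto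
  have "wdeg m' + r = wdeg m" using wdeg_remove[OF m(3)] m(1,4) by simp
  moreover have "int (wdeg m) \<le> d" using p m(2) by blast
  ultimately show "int (wdeg m') \<le> d - int r" by linarith
qed

lemma deg_le_op_exp_annih: "deg_le d p \<Longrightarrow> deg_le (d - int m) (annih_exp e m p)"
  by (rule op_exp_closed[where P = deg_le]) (auto intro: deg_le_simps deg_le_annih)

lemma deg_le_exists: "\<exists>d. deg_le (int d) p"
proof -
  have "wdeg m \<le> Max (wdeg ` Poly_Mapping.keys p)" if "m \<in> Poly_Mapping.keys p" for m
    using that by (intro Max_ge) auto
  then show ?thesis unfolding deg_le_def by (metis of_nat_le_iff)
qed

lemma op_exp_annih_eq_0: "deg_le (int d) p \<Longrightarrow> d < m \<Longrightarrow> annih_exp e m p = 0"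
  by (rule deg_le_neg[OF deg_le_op_exp_annih]) auto

lemma op_exp_annih2_eq_0:
  assumes "deg_le (int d) p" "d < m + l"
  shows "annih_exp e m (annih_exp e' l p) = 0"
  by (rule deg_le_neg[OF deg_le_op_exp_annih[OF deg_le_op_exp_annih[OF assms(1)]]]) (use assms(2) in auto)

text \<open>The exponent \<open>x\<close> is rational, with value \<open>0\<close> outside \<open>\<nat>\<close>, so that it can absorb the
  exponents \<open>form n \<gamma> \<beta>\<close> without case distinctions.\<close>

definition fcre :: "nat \<Rightarrow> modes \<Rightarrow> rat \<Rightarrow> fock" where
  "fcre n c x = (if x \<in> \<nat> then creation_exp n c (nat \<lfloor>x\<rfloor>) 1 else 0)"

lemma fcre_of_nat: "fcre n c (of_nat m) = creation_exp n c m 1"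
  by (simp add: fcre_def)

lemma fcre_neg: "x < 0 \<Longrightarrow> fcre n c x = 0"
  by (auto simp: fcre_def Nats_def)

lemma fcre_nonint: "x \<notin> \<int> \<Longrightarrow> fcre n c x = 0"
  using Nats_subset_Ints by (auto simp: fcre_def)

lemma op_exp_creation: "creation_exp n c m p = fcre n c (of_nat m) * p"
  unfolding fcre_of_nat creation_def by (rule op_exp_mult)

definition vertex_coeff :: "nat \<Rightarrow> modes \<Rightarrow> modes \<Rightarrow> rat \<Rightarrow> fock \<Rightarrow> fock" where
  "vertex_coeff n c d x p = Sum_any (\<lambda>(m, m'). creation_exp n c m (annih_exp d m' p)
     when of_nat m - of_nat m' = x)"

text \<open>A pair of degrees with difference x is determined by the annihilation degree m, so a
  single sum remains; \<open>fcre\<close> supplies 0 when x + m is not a natural number.\<close>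

lemma vertex_coeff_eq_sum:
  assumes "\<And>m. M < m \<Longrightarrow> annih_exp d m p = 0"
  shows "vertex_coeff n c d x p = (\<Sum>m\<le>M. fcre n c (x + of_nat m) * annih_exp d m p)"
proof -
  let ?h = "\<lambda>m. nat \<lfloor>x + of_nat m\<rfloor>"
  let ?S = "{m \<in> {..M}. x + of_nat m \<in> \<nat>}"
  have nz: "creation_exp n c k 0 = 0" for k
    by (simp add: linopD[OF linop_op_exp[OF commuting_creation]])
  have inj: "inj_on (\<lambda>m. (?h m, m)) ?S" by (rule inj_onI) auto
  have nat: "of_nat (?h m) = x + of_nat m" if "x + of_nat m \<in> \<nat>" for m
  proof -
    obtain k where k: "x + of_nat m = of_nat k" using \<open>x + of_nat m \<in> \<nat>\<close> unfolding Nats_def by auto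
    show ?thesis by (simp only: k floor_of_nat nat_int)
  qed
  have "vertex_coeff n c d x p = (\<Sum>(k, m)\<in>(\<lambda>m. (?h m, m)) ` ?S. creation_exp n c k (annih_exp d m p)
     when of_nat k - of_nat m = x)"
    unfolding vertex_coeff_def
  proof (rule Sum_any_eq_sum)
    fix km assume "km \<notin> (\<lambda>m. (?h m, m)) ` ?S"
    moreover obtain k m where km: "km = (k, m)" by (cases km)
    ultimately have *: "\<not> (m \<le> M \<and> x + of_nat m \<in> \<nat> \<and> k = ?h m)" by auto
    have "creation_exp n c k (annih_exp d m p) = 0" if e: "of_nat k - of_nat m = x"
    proof -
      have k: "of_nat k = x + of_nat m" using e by simp
      then have "x + of_nat m \<in> \<nat>" "k = ?h m" by (metis of_nat_in_Nats, metis floor_of_nat nat_int)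
      then have "M < m" using * by auto
      then show ?thesis using assms nz by simp
    qed
    then show "(case km of (k, m) \<Rightarrow> creation_exp n c k (annih_exp d m p)
        when of_nat k - of_nat m = x) = 0" by (simp add: km when_def)
  qed simp
  also have "\<dots> = (\<Sum>m\<in>?S. creation_exp n c (?h m) (annih_exp d m p))"
    unfolding sum.reindex[OF inj]
  proof (intro sum.cong refl)
    fix m assume "m \<in> ?S"
    then have "of_nat (?h m) - of_nat m = x" using nat[of m] by simp
    then show "((\<lambda>(k, m). creation_exp n c k (annih_exp d m p) when of_nat k - of_nat m = x)
        \<circ> (\<lambda>m. (?h m, m))) m = creation_exp n c (?h m) (annih_exp d m p)"
      by (simp only: o_def prod.case simp_thms when_simps)
  qed
  also have "\<dots> = (\<Sum>m\<in>?S. fcre n c (x + of_nat m) * annih_exp d m p)"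
    by (intro sum.cong refl) (auto simp only: op_exp_creation nat)
  also have "\<dots> = (\<Sum>m\<le>M. fcre n c (x + of_nat m) * annih_exp d m p)"
    by (rule sum.mono_neutral_left) (auto simp: fcre_def)
  finally show ?thesis .
qed

lemma vertex_coeff_deg:
  assumes "deg_le (int M) p"
  shows "vertex_coeff n c d x p = (\<Sum>m\<le>M. fcre n c (x + of_nat m) * annih_exp d m p)"
  by (rule vertex_coeff_eq_sum) (rule op_exp_annih_eq_0[OF assms])

lemma deg_le_mono: "deg_le d p \<Longrightarrow> d \<le> d' \<Longrightarrow> deg_le d' p"
  by (auto simp: deg_le_def intro: order_trans)

lemma linop_vertex_coeff: "linop (vertex_coeff n c d x)"
  unfolding linop_def
proof safe
  note L = linopD[OF linop_op_exp[OF commuting_annih]]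
  fix p q k
  obtain M1 M2 where "deg_le (int M1) p" "deg_le (int M2) q" using deg_le_exists by metis
  then have M: "deg_le (int (max M1 M2)) p" "deg_le (int (max M1 M2)) q"
    by (auto elim: deg_le_mono)
  show "vertex_coeff n c d x (p + q) = vertex_coeff n c d x p + vertex_coeff n c d x q"
    unfolding vertex_coeff_deg[OF M(1)] vertex_coeff_deg[OF M(2)] vertex_coeff_deg[OF deg_le_simps(2)[OF M]]
    by (simp add: L distrib_left sum.distrib)
  show "vertex_coeff n c d x (fconst k * p) = fconst k * vertex_coeff n c d x p"
    unfolding vertex_coeff_deg[OF M(1)] vertex_coeff_deg[OF deg_le_simps(3)[OF M(1)]]
    by (simp only: L) (simp only: sum_distrib_left mult_ac)
qed

lemma fcre_carrier: "fcre n c x \<in> fock_carrier n"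
  by (simp add: fcre_def fock_carrier_zero fock_carrier_one fock_carrier_op_exp_creation)

lemma vertex_coeff_carrier: "p \<in> fock_carrier n \<Longrightarrow> vertex_coeff n c d x p \<in> fock_carrier n"
proof -
  assume p: "p \<in> fock_carrier n"
  obtain M where "deg_le (int M) p" using deg_le_exists by metis
  from vertex_coeff_deg[OF this] show ?thesis
    using p by (auto intro!: fock_carrier_sum fock_carrier_mult fcre_carrier fock_carrier_op_exp_annih)
qed

lemma vertex_coeff_eq_0:
  assumes "deg_le (int M) p" "x < - of_nat M"
  shows "vertex_coeff n c d x p = 0"
  unfolding vertex_coeff_deg[OF assms(1)]
proof (rule sum.neutral, safe)
  fix m assume "m \<le> M"
  then have "of_nat m \<le> (of_nat M :: rat)" by simp
  then have "x + of_nat m < 0" using assms(2) by linarith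
  then show "fcre n c (x + of_nat m) * annih_exp d m p = 0" by (simp add: fcre_neg)
qed

lemma vertex_coeff_nonint:
  assumes "x \<notin> \<int>" shows "vertex_coeff n c d x p = 0"
proof -
  obtain M where "deg_le (int M) p" using deg_le_exists by metis
  moreover have "x + of_nat m \<notin> \<int>" for m
    using assms by (metis Ints_diff Ints_of_nat add_diff_cancel_right')
  ultimately show ?thesis by (simp add: vertex_coeff_deg fcre_nonint)
qed

lemma vertex_coeff_one: "vertex_coeff n c d 0 1 = 1"
proof -
  have "deg_le (int 0) 1" by (auto simp: deg_le_def wdeg_def)
  from vertex_coeff_deg[OF this] show ?thesis using fcre_of_nat[of n c 0] by simp
qed

text \<open>The coefficient of \<open>z\<^sub>1\<^sup>x z\<^sub>2\<^sup>y\<close> in the normally ordered product of two vertex operators.\<close>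

abbreviation "normal_term n ca da cb db x y m l p \<equiv>
  fcre n ca (x + of_nat m) * (fcre n cb (y + of_nat l) * annih_exp da m (annih_exp db l p))"

definition normal_coeff ::
  "nat \<Rightarrow> modes \<Rightarrow> modes \<Rightarrow> modes \<Rightarrow>
    modes \<Rightarrow> rat \<Rightarrow> rat \<Rightarrow> fock \<Rightarrow> fock" where
  "normal_coeff n ca da cb db x y p = Sum_any (\<lambda>(m, l).
     normal_term n ca da cb db x y m l p)"

lemma normal_coeff_deg:
  assumes "deg_le (int M) p"
  shows "normal_coeff n ca da cb db x y p = (\<Sum>m\<le>M. \<Sum>l\<le>M.
     normal_term n ca da cb db x y m l p)"
proof -
  have "normal_coeff n ca da cb db x y p = (\<Sum>(m, l)\<in>{..M} \<times> {..M}.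
     normal_term n ca da cb db x y m l p)"
    unfolding normal_coeff_def
  proof (rule Sum_any_eq_sum)
    fix ml assume "ml \<notin> {..M} \<times> {..M}"
    moreover obtain m l where ml: "ml = (m, l)" by (cases ml)
    ultimately have "M < m + l" by auto
    from op_exp_annih2_eq_0[OF assms this] show "(case ml of (m, l) \<Rightarrow> normal_term n ca da cb db x y m l p) = 0" by (simp add: ml)
  qed simp
  then show ?thesis by (simp only: sum.cartesian_product)
qed

lemma linop_normal_coeff: "linop (normal_coeff n ca da cb db x y)"
  unfolding linop_def
proof safe
  note L = linopD[OF linop_op_exp[OF commuting_annih]]
  fix p q k
  obtain M1 M2 where "deg_le (int M1) p" "deg_le (int M2) q" using deg_le_exists by metis
  then have M: "deg_le (int (max M1 M2)) p" "deg_le (int (max M1 M2)) q"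
    by (auto elim: deg_le_mono)
  show "normal_coeff n ca da cb db x y (p + q) = normal_coeff n ca da cb db x y p + normal_coeff n ca da cb db x y q"
    unfolding normal_coeff_deg[OF M(1)] normal_coeff_deg[OF M(2)] normal_coeff_deg[OF deg_le_simps(2)[OF M]]
    by (simp add: L distrib_left sum.distrib)
  show "normal_coeff n ca da cb db x y (fconst k * p) = fconst k * normal_coeff n ca da cb db x y p"
    unfolding normal_coeff_deg[OF M(1)] normal_coeff_deg[OF deg_le_simps(3)[OF M(1)]]
    by (simp only: L) (simp only: sum_distrib_left mult_ac)
qed

lemma normal_coeff_carrier: "p \<in> fock_carrier n \<Longrightarrow> normal_coeff n ca da cb db x y p \<in> fock_carrier n"
proof -
  assume p: "p \<in> fock_carrier n"
  obtain M where "deg_le (int M) p" using deg_le_exists by metis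
  from normal_coeff_deg[OF this] show ?thesis
    using p by (auto intro!: fock_carrier_sum fock_carrier_mult fcre_carrier fock_carrier_op_exp_annih)
qed

lemma normal_coeff_eq_0:
  assumes "deg_le (int M) p" "x < - of_nat M \<or> y < - of_nat M"
  shows "normal_coeff n ca da cb db x y p = 0"
  unfolding normal_coeff_deg[OF assms(1)]
proof (intro sum.neutral ballI)
  fix m l assume "m \<in> {..M}" "l \<in> {..M}"
  then have "of_nat m \<le> (of_nat M :: rat)" "of_nat l \<le> (of_nat M :: rat)" by simp_all
  then have "x + of_nat m < 0 \<or> y + of_nat l < 0" using assms(2) by linarith
  then show "normal_term n ca da cb db x y m l p = 0"
    by (auto simp: fcre_neg)
qed

lemma normal_coeff_nonint:
  assumes "x \<notin> \<int> \<or> y \<notin> \<int>" shows "normal_coeff n ca da cb db x y p = 0"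
proof -
  obtain M where M: "deg_le (int M) p" using deg_le_exists by metis
  have "x + of_nat m \<notin> \<int> \<or> y + of_nat l \<notin> \<int>" for m l
    using assms by (metis Ints_diff Ints_of_nat add_diff_cancel_right')
  then have "fcre n ca (x + of_nat m) * (fcre n cb (y + of_nat l) * q) = 0" for m l q
    using fcre_nonint by (metis mult_zero_left mult_zero_right)
  then show ?thesis by (simp add: normal_coeff_deg[OF M])
qed

text \<open>Moves the annihilation exponential past the creation exponential by
  \<open>op_exp_contraction\<close>; the value 0 of \<open>fcre\<close> at negative arguments
  absorbs its condition k \<le> l.\<close>

lemma op_exp_annih_fcre:
  assumes G: "exp_coeffs (\<lambda>r. \<Sum>l=1..n. d l r * c l r) G"
  shows "annih_exp d m (fcre n c y * p) =
     (\<Sum>k\<le>m. fconst (G k) * (fcre n c (y - of_nat k) * annih_exp d (m - k) p))"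
proof (cases "y \<in> \<nat>")
  case True
  then obtain l where l: "y = of_nat l" by (auto simp: Nats_def)
  have *: "fcre n c (of_nat l - of_nat k) = (if k \<le> l then creation_exp n c (l - k) 1 else 0)" for k
    by (auto simp: fcre_neg fcre_of_nat simp flip: of_nat_diff)
  have "annih_exp d m (creation_exp n c l 1 * p) =
    (\<Sum>k\<le>m. if k \<le> l then fconst (G k) * (creation_exp n c (l - k) 1 * annih_exp d (m - k) p) else 0)"
    unfolding creation_def
    by (rule op_exp_contraction[OF commuting_annih annih_mult _ G]) (simp only: annih_creation)
  then show ?thesis
    unfolding l * by (simp add: fcre_of_nat if_distrib[of "\<lambda>x. x * _"] if_distrib[of "\<lambda>x. _ * x"] cong: if_cong)
next
  case False
  have "y - of_nat k \<notin> \<nat>" for k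
    using False by (metis Nats_add of_nat_in_Nats diff_add_cancel)
  then show ?thesis
    using False by (simp add: fcre_def linopD[OF linop_op_exp[OF commuting_annih]])
qed

text \<open>The product equals G(z2/z1) times the normally ordered product, and (z2/z1)^k moves the
  exponents (x, y) to (x + k, y - k). The bound on K makes every creation exponent y - k + l with k
  > K and l \<le> M negative, so the omitted terms vanish.\<close>

lemma vertex_coeff_product:
  assumes G: "exp_coeffs (\<lambda>r. \<Sum>l=1..n. da l r * cb l r) G"
    and M: "deg_le (int M) p" and K: "y + of_nat M < of_nat K + 1"
  shows "vertex_coeff n ca da x (vertex_coeff n cb db y p) =
     (\<Sum>k\<le>K. fconst (G k) * normal_coeff n ca da cb db (x + of_nat k) (y - of_nat k) p)"
proof -
  define H where "H k m = (\<Sum>l\<le>M. fconst (G k) * (fcre n ca (x + of_nat k + of_nat m) *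
     (fcre n cb (y - of_nat k + of_nat l) * annih_exp da m (annih_exp db l p))))" for k m
  obtain M1 where M1: "deg_le (int M1) (vertex_coeff n cb db y p)" using deg_le_exists by metis
  \<comment> \<open>Large enough for the degree of the inner value, and for the triangle k + m \<le>
    \<open>M'\<close> to contain the box in which H can be nonzero.\<close>
  define M' where "M' = M1 + K + M"
  note L = linopD[OF linop_op_exp[OF commuting_annih]]
  have H0: "H k m = 0" if "k > K \<or> m > M" for k m
    unfolding H_def
  proof (intro sum.neutral ballI)
    fix l assume "l \<in> {..M}"
    then have l: "of_nat l \<le> (of_nat M :: rat)" by simp
    show "fconst (G k) * (fcre n ca (x + of_nat k + of_nat m) *
     (fcre n cb (y - of_nat k + of_nat l) * annih_exp da m (annih_exp db l p))) = 0"
    proof (cases "k > K")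
      case True
      then have "of_nat K + 1 \<le> (of_nat k :: rat)" by (metis Suc_leI of_nat_Suc of_nat_le_iff add.commute)
      then have "y - of_nat k + of_nat l < 0" using K l by linarith
      then show ?thesis by (simp add: fcre_neg)
    next
      case False
      then have "M < m + l" using that by auto
      then show ?thesis using op_exp_annih2_eq_0[OF M] by simp
    qed
  qed
  have "deg_le (int M') (vertex_coeff n cb db y p)"
    using M1 by (rule deg_le_mono) (simp add: M'_def)
  then have "vertex_coeff n ca da x (vertex_coeff n cb db y p) =
      (\<Sum>m\<le>M'. fcre n ca (x + of_nat m) * annih_exp da m (vertex_coeff n cb db y p))"
    by (rule vertex_coeff_deg)
  also have "\<dots> = (\<Sum>m\<le>M'. \<Sum>k\<le>m. H k (m - k))"
  proof (intro sum.cong refl)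
    fix m
    have "fcre n ca (x + of_nat m) * annih_exp da m (vertex_coeff n cb db y p) =
      (\<Sum>l\<le>M. \<Sum>k\<le>m. fconst (G k) * (fcre n ca (x + of_nat m) * (fcre n cb (y + of_nat l - of_nat k) *
         annih_exp da (m - k) (annih_exp db l p))))"
      unfolding vertex_coeff_deg[OF M] L op_exp_annih_fcre[OF G]
      by (simp add: sum_distrib_left mult_ac)
    also have "\<dots> = (\<Sum>k\<le>m. \<Sum>l\<le>M. fconst (G k) * (fcre n ca (x + of_nat m) * (fcre n cb (y + of_nat l - of_nat k) *
         annih_exp da (m - k) (annih_exp db l p))))"
      by (rule sum.swap)
    also have "\<dots> = (\<Sum>k\<le>m. H k (m - k))"
      unfolding H_def
    proof (intro sum.cong refl)
      fix k l assume "k \<in> {..m}"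
      then have "x + of_nat m = x + of_nat k + of_nat (m - k)" "y + of_nat l - of_nat k = y - of_nat k + of_nat l"
        by (auto simp: of_nat_diff)
      then show "fconst (G k) * (fcre n ca (x + of_nat m) * (fcre n cb (y + of_nat l - of_nat k) *
         annih_exp da (m - k) (annih_exp db l p))) =
        fconst (G k) * (fcre n ca (x + of_nat k + of_nat (m - k)) * (fcre n cb (y - of_nat k + of_nat l) *
         annih_exp da (m - k) (annih_exp db l p)))" by (simp only:)
    qed
    finally show "fcre n ca (x + of_nat m) * annih_exp da m (vertex_coeff n cb db y p) = (\<Sum>k\<le>m. H k (m - k))" .
  qed
  also have "\<dots> = (\<Sum>(k, m)\<in>{(k, m). k + m \<le> M'}. H k m)"
    by (rule sum.triangle_reindex_eq[symmetric])
  also have "\<dots> = (\<Sum>(k, m)\<in>{..K} \<times> {..M}. H k m)"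
  proof (rule sum.mono_neutral_right)
    show "finite {(k, m). k + m \<le> M'}"
      by (rule finite_subset[of _ "{..M'} \<times> {..M'}"]) auto
    show "{..K} \<times> {..M} \<subseteq> {(k, m). k + m \<le> M'}" by (auto simp: M'_def)
    show "\<forall>i\<in>{(k, m). k + m \<le> M'} - {..K} \<times> {..M}. (case i of (k, m) \<Rightarrow> H k m) = 0"
    proof
      fix i assume i: "i \<in> {(k, m). k + m \<le> M'} - {..K} \<times> {..M}"
      obtain k m where km: "i = (k, m)" by (cases i)
      with i have "k > K \<or> m > M" by auto
      from H0[OF this] show "(case i of (k, m) \<Rightarrow> H k m) = 0" by (simp add: km)
    qed
  qed
  also have "\<dots> = (\<Sum>k\<le>K. \<Sum>m\<le>M. H k m)"
    by (rule sum.cartesian_product[symmetric])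
  also have "\<dots> = (\<Sum>k\<le>K. fconst (G k) * normal_coeff n ca da cb db (x + of_nat k) (y - of_nat k) p)"
    unfolding normal_coeff_deg[OF M] H_def sum_distrib_left ..
  finally show ?thesis .
qed

section \<open>Normally ordered products at z1 = rho z2\<close>

lemma creation_add: "creation n (\<lambda>l r. ca l r + cb l r) r p = creation n ca r p + creation n cb r p"
  by (simp add: creation_def fconst_simps distrib_right sum.distrib)

lemma creation_dilate: "creation n (\<lambda>l r. \<rho> ^ r * c l r) r p = fconst (\<rho> ^ r) * creation n c r p"
  by (simp add: creation_def fconst_simps mult.assoc flip: sum_distrib_left)

lemma fock_deriv_add_fun: "fock_deriv (\<lambda>x. d x + d' x) p = fock_deriv d p + fock_deriv d' p"
  by (simp add: fock_deriv_def distrib_left sum.distrib)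

lemma fock_deriv_mult_fun: "fock_deriv (\<lambda>x. c * d x) p = c * fock_deriv d p"
  by (simp add: fock_deriv_def sum_distrib_left mult.left_commute)

lemma annih_add: "annih (\<lambda>l r. d l r + d' l r) r p = annih d r p + annih d' r p"
  unfolding annih_alt fock_deriv_add_fun[symmetric]
  by (rule arg_cong[of _ _ "\<lambda>f. fock_deriv f p"]) (auto simp: fun_eq_iff fconst_simps)

lemma annih_scale: "annih (\<lambda>l r. k r * d l r) r p = fconst (k r) * annih d r p"
  unfolding annih_alt fock_deriv_mult_fun[symmetric]
  by (rule arg_cong[of _ _ "\<lambda>f. fock_deriv f p"]) (auto simp: fun_eq_iff fconst_simps)

lemma op_exp_annih_dilate:
  "op_exp (annih (\<lambda>l r. \<rho> ^ r * d l r)) m p = fconst (\<rho> ^ m) * annih_exp d m p"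
  unfolding op_exp_dilate[OF commuting_annih, symmetric]
  by (rule op_exp_cong) (rule annih_scale)

lemma op_exp_annih_add:
  "op_exp (annih (\<lambda>l r. d l r + d' l r)) m p = (\<Sum>k\<le>m. annih_exp d k (annih_exp d' (m - k) p))"
  unfolding op_exp_add[OF commuting_annih commuting_annih annih_comm, symmetric]
  by (rule op_exp_cong) (rule annih_add)

lemma fcre_dilate:
  assumes "\<rho> \<noteq> 0"
  shows "fcre n (\<lambda>l r. \<rho> ^ r * c l r) (of_int e) = fconst (\<rho> powi e) * fcre n c (of_int e)"
proof (cases "e \<ge> 0")
  case True
  then obtain m where e: "e = int m" by (metis nonneg_int_cases)
  have "op_exp (creation n (\<lambda>l r. \<rho> ^ r * c l r)) m 1 = fconst (\<rho> ^ m) * creation_exp n c m 1"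
    unfolding op_exp_dilate[OF commuting_creation, symmetric]
    by (rule op_exp_cong) (rule creation_dilate)
  then show ?thesis by (simp add: e fcre_of_nat)
qed (simp add: fcre_neg)

text \<open>Creation exponentials multiply to the exponential of the summed modes; E may be any
  finite range containing the exponents that contribute.\<close>

lemma fcre_convolution:
  assumes "finite E" "\<And>e. 0 \<le> e \<Longrightarrow> of_int e \<le> u \<Longrightarrow> e \<in> E"
  shows "(\<Sum>e\<in>E. fcre n ca (of_int e) * fcre n cb (u - of_int e)) = fcre n (\<lambda>l r. ca l r + cb l r) u"
proof (cases "u \<in> \<nat>")
  case True
  then obtain k where u: "u = of_nat k" by (auto simp: Nats_def)
  have sub: "int ` {..k} \<subseteq> E" using assms(2) by (auto simp: u)
  have "fcre n (\<lambda>l r. ca l r + cb l r) u = op_exp (\<lambda>r p. creation n ca r p + creation n cb r p) k 1"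
    unfolding u fcre_of_nat by (rule op_exp_cong) (rule creation_add)
  also have "\<dots> = (\<Sum>i\<le>k. creation_exp n ca i (creation_exp n cb (k - i) 1))"
    by (rule op_exp_add[OF commuting_creation commuting_creation]) (simp add: creation_def mult.left_commute)
  also have "\<dots> = (\<Sum>i\<le>k. fcre n ca (of_nat i) * fcre n cb (of_nat k - of_nat i))"
    by (intro sum.cong refl) (simp add: op_exp_creation flip: of_nat_diff)
  also have "\<dots> = (\<Sum>e\<in>int ` {..k}. fcre n ca (of_int e) * fcre n cb (u - of_int e))"
    by (subst sum.reindex) (auto simp: u)
  also have "\<dots> = (\<Sum>e\<in>E. fcre n ca (of_int e) * fcre n cb (u - of_int e))"
  proof (rule sum.mono_neutral_left[OF assms(1) sub], safe)
    fix e assume e: "e \<notin> int ` {..k}"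
    have "e < 0 \<or> e > int k" using e by (metis atMost_iff imageI int_nat_eq linorder_not_less nat_le_iff)
    then have "of_int e < (0::rat) \<or> u - of_int e < 0" by (auto simp: u)
    then show "fcre n ca (of_int e) * fcre n cb (u - of_int e) = 0" by (auto simp: fcre_neg)
  qed
  finally show ?thesis by simp
next
  case False
  have "fcre n ca (of_int e) * fcre n cb (u - of_int e) = 0" for e
  proof (cases "e < 0")
    case True
    then show ?thesis by (simp add: fcre_neg)
  next
    case e: False
    have "u - of_int e \<notin> \<nat>"
    proof
      assume "u - of_int e \<in> \<nat>"
      moreover have "of_int e \<in> (\<nat> :: rat set)" using e by (metis nonneg_int_cases not_less of_int_of_nat_eq of_nat_in_Nats)
      ultimately have "u - of_int e + of_int e \<in> \<nat>" by (rule Nats_add)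
      then show False using False by simp
    qed
    then show ?thesis by (simp add: fcre_def)
  qed
  then show ?thesis using False by (simp add: fcre_def)
qed

text \<open>Substituting z1 = rho z2 rescales creation modes by rho^r and annihilation modes by
  rho^-r; then the two exponentials of each kind merge into one.\<close>

lemma normal_coeff_diagonal:
  assumes \<rho>: "\<rho> \<noteq> 0"
  shows "Sum_any (\<lambda>e::int. fconst (\<rho> powi e) * normal_coeff n ca da cb db (of_int e) (u - of_int e) p) =
    vertex_coeff n (\<lambda>l r. \<rho> ^ r * ca l r + cb l r) (\<lambda>l r. inverse \<rho> ^ r * da l r + db l r) u p"
proof -
  obtain M where M: "deg_le (int M) p" using deg_le_exists by metis
  define E where "E = {- int M..\<lfloor>u\<rfloor> + int M}"
  define ca' where "ca' = (\<lambda>l r. \<rho> ^ r * ca l r)"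
  define da' where "da' = (\<lambda>l r. inverse \<rho> ^ r * da l r)"
  define c where "c = (\<lambda>l r. ca' l r + cb l r)"
  let ?D = "\<lambda>m l. annih_exp da' m (annih_exp db l p)"
  have conv: "(\<Sum>e\<in>E. fcre n ca' (of_int (e + int m)) * fcre n cb (u + of_nat m + of_nat l - of_int (e + int m)))
      = fcre n c (u + of_nat m + of_nat l)" if "m \<le> M" "l \<le> M" for m l
  proof -
    have "(\<Sum>e\<in>E. fcre n ca' (of_int (e + int m)) * fcre n cb (u + of_nat m + of_nat l - of_int (e + int m)))
      = (\<Sum>e\<in>(\<lambda>e. e + int m) ` E. fcre n ca' (of_int e) * fcre n cb (u + of_nat m + of_nat l - of_int e))"
      by (subst sum.reindex) (auto simp: inj_on_def)
    also have "\<dots> = fcre n c (u + of_nat m + of_nat l)"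
      unfolding c_def
    proof (rule fcre_convolution)
      fix e :: int assume e: "0 \<le> e" "of_int e \<le> u + of_nat m + of_nat l"
      have "of_int (e - int m - int l) \<le> u" using e(2) by simp
      then have "e - int m - int l \<le> \<lfloor>u\<rfloor>" by (simp only: le_floor_iff)
      then have "e - int m \<in> E" using e(1) that by (auto simp: E_def)
      then show "e \<in> (\<lambda>e. e + int m) ` E" by (rule rev_image_eqI) simp
    qed (simp add: E_def)
    finally show ?thesis .
  qed
  have "Sum_any (\<lambda>e::int. fconst (\<rho> powi e) * normal_coeff n ca da cb db (of_int e) (u - of_int e) p) =
     (\<Sum>e\<in>E. fconst (\<rho> powi e) * normal_coeff n ca da cb db (of_int e) (u - of_int e) p)"
  proof (rule Sum_any_eq_sum)
    fix e assume "e \<notin> E"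
    then have "of_int e < - (of_nat M :: rat) \<or> u - of_int e < - of_nat M"
      by (auto simp: E_def; linarith)
    then show "fconst (\<rho> powi e) * normal_coeff n ca da cb db (of_int e) (u - of_int e) p = 0"
      using normal_coeff_eq_0[OF M] by simp
  qed (simp add: E_def)
  also have "\<dots> = (\<Sum>e\<in>E. \<Sum>m\<le>M. \<Sum>l\<le>M. fcre n ca' (of_int (e + int m)) *
      fcre n cb (u + of_nat m + of_nat l - of_int (e + int m)) * ?D m l)"
    unfolding normal_coeff_deg[OF M] sum_distrib_left
  proof (intro sum.cong refl)
    fix e m l
    \<comment> \<open>The factor rho^(e + m) goes to the creation exponential of degree e + m, and
      rho^-m to the annihilation exponential of degree m.\<close>
    have "\<rho> powi (e + int m) * inverse \<rho> ^ m = \<rho> powi e"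
      using \<rho> by (simp add: power_int_add power_inverse)
    then have \<rho>e: "fconst (\<rho> powi e) = fconst (\<rho> powi (e + int m)) * fconst (inverse \<rho> ^ m)"
      by (simp only: fconst_simps(4)[symmetric])
    have "u - of_int e + of_nat l = u + of_nat m + of_nat l - of_int (e + int m)"
         "of_int e + of_nat m = (of_int (e + int m) :: rat)" by simp_all
    then show "fconst (\<rho> powi e) * (fcre n ca (of_int e + of_nat m) *
      (fcre n cb (u - of_int e + of_nat l) * annih_exp da m (annih_exp db l p))) =
      fcre n ca' (of_int (e + int m)) * fcre n cb (u + of_nat m + of_nat l - of_int (e + int m)) * ?D m l"
      unfolding ca'_def da'_def op_exp_annih_dilate fcre_dilate[OF \<rho>] \<rho>e by (simp only: mult_ac)
  qed
  also have "\<dots> = (\<Sum>m\<le>M. \<Sum>l\<le>M. \<Sum>e\<in>E. fcre n ca' (of_int (e + int m)) *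
      fcre n cb (u + of_nat m + of_nat l - of_int (e + int m)) * ?D m l)"
    by (subst sum.swap, intro sum.cong refl, rule sum.swap)
  also have "\<dots> = (\<Sum>m\<le>M. \<Sum>l\<le>M. fcre n c (u + of_nat m + of_nat l) * ?D m l)"
    by (intro sum.cong refl) (auto simp only: conv sum_distrib_right[symmetric] atMost_iff)
  also have "\<dots> = (\<Sum>(m, l)\<in>{..M} \<times> {..M}. fcre n c (u + of_nat m + of_nat l) * ?D m l)"
    by (rule sum.cartesian_product)
  also have "\<dots> = (\<Sum>(m, l)\<in>{(m, l). m + l \<le> M}. fcre n c (u + of_nat m + of_nat l) * ?D m l)"
  proof (rule sum.mono_neutral_right)
    show "\<forall>i\<in>{..M} \<times> {..M} - {(m, l). m + l \<le> M}.
      (case i of (m, l) \<Rightarrow> fcre n c (u + of_nat m + of_nat l) * ?D m l) = 0"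
    proof
      fix i assume i: "i \<in> {..M} \<times> {..M} - {(m, l). m + l \<le> M}"
      obtain m l where ml: "i = (m, l)" by (cases i)
      with i have "M < m + l" by auto
      from op_exp_annih2_eq_0[OF M this]
      show "(case i of (m, l) \<Rightarrow> fcre n c (u + of_nat m + of_nat l) * ?D m l) = 0" by (simp add: ml)
    qed
  qed auto
  also have "\<dots> = (\<Sum>k\<le>M. \<Sum>i\<le>k. fcre n c (u + of_nat i + of_nat (k - i)) * ?D i (k - i))"
    by (rule sum.triangle_reindex_eq)
  also have "\<dots> = (\<Sum>k\<le>M. fcre n c (u + of_nat k) * op_exp (annih (\<lambda>l r. da' l r + db l r)) k p)"
    unfolding op_exp_annih_add sum_distrib_left
    by (intro sum.cong refl) (simp add: of_nat_diff)
  also have "\<dots> = vertex_coeff n c (\<lambda>l r. da' l r + db l r) u p"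
    by (rule vertex_coeff_deg[OF M, symmetric])
  finally show ?thesis unfolding c_def ca'_def da'_def .
qed

section \<open>Vertex operators on \<open>V\<close>\<close>

definition vop :: "nat \<Rightarrow> modes \<Rightarrow> modes \<Rightarrow> weight \<Rightarrow>
    (weight \<Rightarrow> qfield) \<Rightarrow> op_series" where
  "vop n c d \<gamma> \<chi> = vertex_op n (creation n c) (annih d) \<gamma> \<chi>"

text \<open>The common shape of vertex operators and of normally ordered products: a shift of
  weights by gamma together with an action on \<open>fock\<close> that depends on the
  weight.\<close>

definition weight_map :: "weight \<Rightarrow> (weight \<Rightarrow> fock \<Rightarrow> fock) \<Rightarrow> vspace \<Rightarrow> vspace" where
  "weight_map \<gamma> f v = (\<Sum>\<beta>\<in>Poly_Mapping.keys v. Poly_Mapping.single (\<gamma> + \<beta>) (f \<beta> (Poly_Mapping.lookup v \<beta>)))"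

lemma lookup_weight_map:
  assumes "\<And>\<beta>. f \<beta> 0 = 0"
  shows "Poly_Mapping.lookup (weight_map \<gamma> f v) \<delta> = f (\<delta> - \<gamma>) (Poly_Mapping.lookup v (\<delta> - \<gamma>))"
proof -
  have "Poly_Mapping.lookup (weight_map \<gamma> f v) \<delta> = (\<Sum>\<beta>\<in>Poly_Mapping.keys v. if \<beta> = \<delta> - \<gamma> then f \<beta> (Poly_Mapping.lookup v \<beta>) else 0)"
    unfolding weight_map_def lookup_sum
    by (intro sum.cong refl) (auto simp: lookup_single when_def)
  also have "\<dots> = f (\<delta> - \<gamma>) (Poly_Mapping.lookup v (\<delta> - \<gamma>))"
    using assms by (auto simp: sum.delta in_keys_iff)
  finally show ?thesis .
qed

lemma vop_eq_weight_map:
  "vop n c d \<gamma> \<chi> r = weight_map \<gamma> (\<lambda>\<beta> p. fconst (\<chi> \<beta> * cocycle n \<gamma> \<beta>) * vertex_coeff n c d (r - form n \<gamma> \<beta>) p)"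
  unfolding vop_def vertex_op_def weight_map_def vertex_coeff_def fscale_def
  by (simp add: eq_diff_eq)

lemma lookup_vop:
  "Poly_Mapping.lookup (vop n c d \<gamma> \<chi> r v) \<delta> = fconst (\<chi> (\<delta> - \<gamma>) * cocycle n \<gamma> (\<delta> - \<gamma>)) *
     vertex_coeff n c d (r - form n \<gamma> (\<delta> - \<gamma>)) (Poly_Mapping.lookup v (\<delta> - \<gamma>))"
  unfolding vop_eq_weight_map
  by (rule lookup_weight_map) (simp add: linopD[OF linop_vertex_coeff])

lemma V_iff: "v \<in> V n \<longleftrightarrow> (\<forall>\<beta>. Poly_Mapping.lookup v \<beta> \<in> fock_carrier n) \<and>
    (\<forall>\<beta>. Poly_Mapping.lookup v \<beta> \<noteq> 0 \<longrightarrow> \<beta> \<in> weight_lattice n)"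
  by (auto simp: V_def in_keys_iff)

lemma weight_lattice_add: "\<alpha> \<in> weight_lattice n \<Longrightarrow> \<beta> \<in> weight_lattice n \<Longrightarrow> \<alpha> + \<beta> \<in> weight_lattice n"
  unfolding weight_lattice_def using keys_add[of \<alpha> \<beta>] by blast

lemma weight_lattice_uminus: "\<alpha> \<in> weight_lattice n \<Longrightarrow> - \<alpha> \<in> weight_lattice n"
  by (auto simp: weight_lattice_def in_keys_iff)

lemma V_zero: "0 \<in> V n" by (simp add: V_iff fock_carrier_zero)

lemma V_add: "v \<in> V n \<Longrightarrow> w \<in> V n \<Longrightarrow> v + w \<in> V n"
  unfolding V_iff by (auto simp: lookup_add fock_carrier_add) (metis add_0)

lemma V_vscale: "v \<in> V n \<Longrightarrow> vscale c v \<in> V n"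
  unfolding V_iff by (auto simp: lookup_vscale fscale_def fock_carrier_mult fock_carrier_fconst)
    (metis mult_zero_right)

lemma V_diff:
  assumes "v \<in> V n" "w \<in> V n" shows "v - w \<in> V n"
  using V_add[OF assms(1) V_vscale[OF assms(2), of "-1"]] by simp

lemma vacuum_V: "vacuum \<in> V n"
  by (auto simp: V_iff vacuum_def lookup_single when_def fock_carrier_zero fock_carrier_one weight_lattice_def
      simp del: single_one)

lemma V_weight_map:
  assumes "\<And>\<beta>. f \<beta> 0 = 0" "\<And>\<beta> p. p \<in> fock_carrier n \<Longrightarrow> f \<beta> p \<in> fock_carrier n"
    and "\<gamma> \<in> weight_lattice n" "v \<in> V n"
  shows "weight_map \<gamma> f v \<in> V n"
  unfolding V_iff lookup_weight_map[of f, OF assms(1)]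
proof (intro conjI allI impI)
  fix \<beta> show "f (\<beta> - \<gamma>) (Poly_Mapping.lookup v (\<beta> - \<gamma>)) \<in> fock_carrier n"
    using assms(2,4) by (auto simp: V_iff)
  assume "f (\<beta> - \<gamma>) (Poly_Mapping.lookup v (\<beta> - \<gamma>)) \<noteq> 0"
  then have "Poly_Mapping.lookup v (\<beta> - \<gamma>) \<noteq> 0" using assms(1) by metis
  then have "\<beta> - \<gamma> \<in> weight_lattice n" using assms(4) by (auto simp: V_iff)
  from weight_lattice_add[OF this assms(3)] show "\<beta> \<in> weight_lattice n" by simp
qed

lemma vop_in_V: "\<gamma> \<in> weight_lattice n \<Longrightarrow> v \<in> V n \<Longrightarrow> vop n c d \<gamma> \<chi> r v \<in> V n"
  unfolding vop_eq_weight_map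
  by (rule V_weight_map) (auto simp: linopD[OF linop_vertex_coeff] fock_carrier_mult fock_carrier_fconst vertex_coeff_carrier)

lemma vop_linear: "linear_on_space vscale vscale M (vop n c d \<gamma> \<chi> r)"
  unfolding linear_on_space_def
  by (auto intro!: poly_mapping_eqI
      simp: lookup_vop lookup_add lookup_vscale fscale_def linopD[OF linop_vertex_coeff] distrib_left mult.left_commute)

text \<open>A single B works since v has finite support. Two weights are treated together to bound
  both exponents of a normally ordered product.\<close>

lemma form_bound_exists:
  "\<exists>B::rat. \<forall>\<beta>. Poly_Mapping.lookup v \<beta> \<noteq> 0 \<longrightarrow> (\<exists>M. deg_le (int M) (Poly_Mapping.lookup v \<beta>)
      \<and> B \<le> form n \<gamma> \<beta> - of_nat M \<and> B \<le> form n \<gamma>' \<beta> - of_nat M)" for v :: vspace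
proof -
  obtain M where M: "\<And>\<beta>. deg_le (int (M \<beta>)) (Poly_Mapping.lookup v \<beta>)"
    using choice[of "\<lambda>\<beta> d. deg_le (int d) (Poly_Mapping.lookup v \<beta>)"] deg_le_exists by blast
  let ?g = "\<lambda>\<beta>. min (form n \<gamma> \<beta> - of_nat (M \<beta>)) (form n \<gamma>' \<beta> - of_nat (M \<beta>))"
  define B where "B = Min (?g ` Poly_Mapping.keys v)"
  have "B \<le> ?g \<beta>" if "Poly_Mapping.lookup v \<beta> \<noteq> 0" for \<beta>
    unfolding B_def using that by (intro Min_le) (auto simp: in_keys_iff)
  then show ?thesis using M by (intro exI[of _ B]) (metis min.bounded_iff)
qed

lemma vop_laurent:
  assumes \<gamma>: "\<gamma> \<in> weight_lattice n" and v: "v \<in> V n"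
    and int: "\<And>\<beta>. \<beta> \<in> weight_lattice n \<Longrightarrow> of_nat N * form n \<gamma> \<beta> \<in> \<int>"
  shows "(\<lambda>r. vop n c d \<gamma> \<chi> r v) \<in> laurent N (V n)"
proof -
  obtain B where B: "\<And>\<beta>. Poly_Mapping.lookup v \<beta> \<noteq> 0 \<Longrightarrow> \<exists>M. deg_le (int M) (Poly_Mapping.lookup v \<beta>)
      \<and> B \<le> form n \<gamma> \<beta> - of_nat M \<and> B \<le> form n \<gamma> \<beta> - of_nat M"
    using form_bound_exists[of v n \<gamma> \<gamma>] by blast
  have nz: "\<exists>\<beta>. Poly_Mapping.lookup v \<beta> \<noteq> 0 \<and> vertex_coeff n c d (r - form n \<gamma> \<beta>) (Poly_Mapping.lookup v \<beta>) \<noteq> 0"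
    if nz: "vop n c d \<gamma> \<chi> r v \<noteq> 0" for r
  proof -
    obtain \<delta> where "Poly_Mapping.lookup (vop n c d \<gamma> \<chi> r v) \<delta> \<noteq> 0"
      using nz poly_mapping_eqI[of "vop n c d \<gamma> \<chi> r v" 0] by auto
    then show ?thesis unfolding lookup_vop
      by (intro exI[of _ "\<delta> - \<gamma>"]) (auto simp: linopD[OF linop_vertex_coeff])
  qed
  show ?thesis
    unfolding laurent_def
  proof (intro CollectI conjI allI impI exI)
    fix r show "vop n c d \<gamma> \<chi> r v \<in> V n" by (rule vop_in_V[OF \<gamma> v])
  next
    fix r assume "vop n c d \<gamma> \<chi> r v \<noteq> 0"
    from nz[OF this] obtain \<beta> where \<beta>: "Poly_Mapping.lookup v \<beta> \<noteq> 0"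
      "vertex_coeff n c d (r - form n \<gamma> \<beta>) (Poly_Mapping.lookup v \<beta>) \<noteq> 0" by blast
    then have "r - form n \<gamma> \<beta> \<in> \<int>" using vertex_coeff_nonint by blast
    moreover have "of_nat N * form n \<gamma> \<beta> \<in> \<int>" using \<beta>(1) v by (intro int) (auto simp: V_iff)
    ultimately have "of_nat N * (r - form n \<gamma> \<beta>) + of_nat N * form n \<gamma> \<beta> \<in> \<int>"
      by (intro Ints_add[OF Ints_mult[OF Ints_of_nat]])
    then show "of_nat N * r \<in> \<int>" by (simp add: algebra_simps)
  next
    fix r assume r: "r < B"
    show "vop n c d \<gamma> \<chi> r v = 0"
    proof (rule ccontr)
      assume "vop n c d \<gamma> \<chi> r v \<noteq> 0"
      from nz[OF this] obtain \<beta> where \<beta>: "Poly_Mapping.lookup v \<beta> \<noteq> 0"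
        "vertex_coeff n c d (r - form n \<gamma> \<beta>) (Poly_Mapping.lookup v \<beta>) \<noteq> 0" by blast
      from B[OF \<beta>(1)] obtain M where "deg_le (int M) (Poly_Mapping.lookup v \<beta>)" "B \<le> form n \<gamma> \<beta> - of_nat M" by blast
      then show False using vertex_coeff_eq_0[of M _ "r - form n \<gamma> \<beta>" n c d] \<beta>(2) r by auto
    qed
  qed
qed

lemma hom_laurent_cong:
  assumes "a \<in> hom_laurent n N" "\<And>r v. v \<in> V n \<Longrightarrow> b r v = a r v"
  shows "b \<in> hom_laurent n N"
  using assms unfolding hom_laurent_def linear_on_space_def by (simp add: V_add V_vscale)

lemma vop_hom_laurent:
  assumes "\<gamma> \<in> weight_lattice n" "\<And>\<beta>. \<beta> \<in> weight_lattice n \<Longrightarrow> of_nat N * form n \<gamma> \<beta> \<in> \<int>"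
  shows "vop n c d \<gamma> \<chi> \<in> hom_laurent n N"
  unfolding hom_laurent_def using vop_linear vop_laurent[OF assms(1) _ assms(2)] by blast

text \<open>Both exponentials start with 1, so at weight gamma and exponent 0 the value is the
  constant chi 0 times a sign. Every nonvanishing of an operator below comes from here.\<close>

lemma vop_vacuum_nonzero:
  assumes "\<chi> 0 \<noteq> 0"
  shows "vop n c d \<gamma> \<chi> 0 vacuum \<noteq> 0"
proof
  assume "vop n c d \<gamma> \<chi> 0 vacuum = 0"
  then have "Poly_Mapping.lookup (vop n c d \<gamma> \<chi> 0 vacuum) \<gamma> = 0" by simp
  then have "fconst (\<chi> 0 * cocycle n \<gamma> 0) = 0"
    by (simp add: lookup_vop vacuum_def form_commute[of n \<gamma> 0] form_zero_left vertex_coeff_one)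
  then have "Poly_Mapping.lookup (fconst (\<chi> 0 * cocycle n \<gamma> 0)) 0 = 0" by simp
  then show False using assms by (simp add: fconst_def cocycle_def)
qed

text \<open>As \<open>wt\<close> is a choice, uniqueness has to be shown: the value at exponent 0 is
  nonzero and sits at a single weight.\<close>

lemma wt_vop:
  assumes b: "\<And>r. b r vacuum = vop n c d \<gamma> \<chi> r vacuum"
    and \<gamma>: "\<gamma> \<in> weight_lattice n" and \<chi>: "\<chi> 0 \<noteq> 0"
    and int: "\<And>\<beta>. \<beta> \<in> weight_lattice n \<Longrightarrow> of_nat (n + 1) * form n \<gamma> \<beta> \<in> \<int>"
  shows "wt n b = \<gamma>"
proof -
  define D where "D r = Poly_Mapping.lookup (vop n c d \<gamma> \<chi> r vacuum) \<gamma>" for r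
  have single: "vop n c d \<gamma> \<chi> r vacuum = Poly_Mapping.single \<gamma> (D r)" for r
    unfolding D_def
    by (rule poly_mapping_eqI)
      (auto simp: lookup_vop vacuum_def lookup_single when_def linopD[OF linop_vertex_coeff] simp del: single_one)
  have L: "(\<lambda>r. vop n c d \<gamma> \<chi> r vacuum) \<in> laurent (n + 1) (V n)"
    by (rule vop_laurent[OF \<gamma> vacuum_V int])
  have "D \<in> laurent (n + 1) (fock_carrier n)"
  proof -
    obtain B where B: "\<And>r. r < B \<Longrightarrow> vop n c d \<gamma> \<chi> r vacuum = 0"
      and i: "\<And>r. vop n c d \<gamma> \<chi> r vacuum \<noteq> 0 \<Longrightarrow> of_nat (n + 1) * r \<in> \<int>"
      and V: "\<And>r. vop n c d \<gamma> \<chi> r vacuum \<in> V n"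
      using L unfolding laurent_def by blast
    show ?thesis
      unfolding laurent_def
    proof (intro CollectI conjI allI impI exI)
      show "D r \<in> fock_carrier n" for r using V by (simp add: D_def V_iff)
      show "of_nat (n + 1) * r \<in> \<int>" if "D r \<noteq> 0" for r using that i[of r] unfolding D_def by (metis lookup_zero)
      show "D r = 0" if "r < B" for r using B[OF that] by (simp add: D_def)
    qed
  qed
  then have has: "has_wt n b \<gamma>"
    unfolding has_wt_def b single using \<gamma> by blast
  have "\<alpha> = \<gamma>" if w: "has_wt n b \<alpha>" for \<alpha>
  proof -
    obtain y where "b 0 vacuum = Poly_Mapping.single \<alpha> y" using w unfolding has_wt_def by blast
    then have "Poly_Mapping.single \<alpha> y = Poly_Mapping.single \<gamma> (D 0)" "D 0 \<noteq> 0"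
      using vop_vacuum_nonzero[of \<chi> n c d \<gamma>, OF \<chi>] by (auto simp: b single)
    then show ?thesis
      by (metis lookup_single_eq lookup_single_not_eq)
  qed
  then show ?thesis using has unfolding wt_def by (metis someI)
qed

text \<open>The factor z1^(gamma_a, gamma_b), produced by moving the power of z1 past e^gamma_b, is
  left to the contraction; it reappears as a shift of r in \<open>vop_product\<close>.\<close>

definition normal_product ::
  "nat \<Rightarrow> modes \<Rightarrow> modes \<Rightarrow> weight \<Rightarrow> modes \<Rightarrow>
    modes \<Rightarrow> weight \<Rightarrow> (weight \<Rightarrow> qfield) \<Rightarrow> rat \<Rightarrow> rat \<Rightarrow> vspace \<Rightarrow> vspace" where
  "normal_product n ca da \<gamma>a cb db \<gamma>b \<chi> r s = weight_map (\<gamma>a + \<gamma>b) (\<lambda>\<beta> p.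
     fconst (\<chi> \<beta> * cocycle n \<gamma>b \<beta> * cocycle n \<gamma>a (\<gamma>b + \<beta>)) *
       normal_coeff n ca da cb db (r - form n \<gamma>a \<beta>) (s - form n \<gamma>b \<beta>) p)"

lemma lookup_normal_product:
  "Poly_Mapping.lookup (normal_product n ca da \<gamma>a cb db \<gamma>b \<chi> r s v) \<delta> =
     fconst (\<chi> (\<delta> - (\<gamma>a + \<gamma>b)) * cocycle n \<gamma>b (\<delta> - (\<gamma>a + \<gamma>b)) * cocycle n \<gamma>a (\<gamma>b + (\<delta> - (\<gamma>a + \<gamma>b)))) *
     normal_coeff n ca da cb db (r - form n \<gamma>a (\<delta> - (\<gamma>a + \<gamma>b))) (s - form n \<gamma>b (\<delta> - (\<gamma>a + \<gamma>b)))
       (Poly_Mapping.lookup v (\<delta> - (\<gamma>a + \<gamma>b)))"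
  unfolding normal_product_def
  by (rule lookup_weight_map) (simp add: linopD[OF linop_normal_coeff])

lemma normal_product_laurent2:
  assumes \<gamma>: "\<gamma>a \<in> weight_lattice n" "\<gamma>b \<in> weight_lattice n" and v: "v \<in> V n"
    and inta: "\<And>\<beta>. \<beta> \<in> weight_lattice n \<Longrightarrow> form n \<gamma>a \<beta> \<in> \<int>"
    and intb: "\<And>\<beta>. \<beta> \<in> weight_lattice n \<Longrightarrow> of_nat (n + 1) * form n \<gamma>b \<beta> \<in> \<int>"
  shows "(\<lambda>r s. normal_product n ca da \<gamma>a cb db \<gamma>b \<chi> r s v) \<in> laurent2 (n + 1) (V n)"
proof -
  let ?N = "normal_product n ca da \<gamma>a cb db \<gamma>b \<chi>"
  let ?c = "\<lambda>r s \<beta>. normal_coeff n ca da cb db (r - form n \<gamma>a \<beta>) (s - form n \<gamma>b \<beta>) (Poly_Mapping.lookup v \<beta>)"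
  obtain B where B: "\<And>\<beta>. Poly_Mapping.lookup v \<beta> \<noteq> 0 \<Longrightarrow> \<exists>M. deg_le (int M) (Poly_Mapping.lookup v \<beta>)
      \<and> B \<le> form n \<gamma>a \<beta> - of_nat M \<and> B \<le> form n \<gamma>b \<beta> - of_nat M"
    using form_bound_exists[of v n \<gamma>a \<gamma>b] by blast
  have nz: "\<exists>\<beta>. Poly_Mapping.lookup v \<beta> \<noteq> 0 \<and> ?c r s \<beta> \<noteq> 0" if nz: "?N r s v \<noteq> 0" for r s
  proof -
    obtain \<delta> where "Poly_Mapping.lookup (?N r s v) \<delta> \<noteq> 0"
      using nz poly_mapping_eqI[of "?N r s v" 0] by auto
    then show ?thesis unfolding lookup_normal_product
      by (intro exI[of _ "\<delta> - (\<gamma>a + \<gamma>b)"]) (auto simp: linopD[OF linop_normal_coeff])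
  qed
  show ?thesis
    unfolding laurent2_def
  proof (intro CollectI conjI allI impI exI)
    fix r s show "?N r s v \<in> V n"
      unfolding normal_product_def
      by (rule V_weight_map) (auto simp: linopD[OF linop_normal_coeff] fock_carrier_mult fock_carrier_fconst
        normal_coeff_carrier v \<gamma> weight_lattice_add)
  next
    fix r s assume "?N r s v \<noteq> 0"
    from nz[OF this] obtain \<beta> where \<beta>: "Poly_Mapping.lookup v \<beta> \<noteq> 0" "?c r s \<beta> \<noteq> 0" by blast
    then have i: "r - form n \<gamma>a \<beta> \<in> \<int>" "s - form n \<gamma>b \<beta> \<in> \<int>" using normal_coeff_nonint by blast+
    have \<beta>L: "\<beta> \<in> weight_lattice n" using \<beta>(1) v by (auto simp: V_iff)
    have "r - form n \<gamma>a \<beta> + form n \<gamma>a \<beta> \<in> \<int>" using i(1) inta[OF \<beta>L] by (intro Ints_add)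
    then show "r \<in> \<int>" by simp
    have "of_nat (n + 1) * (s - form n \<gamma>b \<beta>) + of_nat (n + 1) * form n \<gamma>b \<beta> \<in> \<int>"
      using i(2) intb[OF \<beta>L] by (intro Ints_add[OF Ints_mult[OF Ints_of_nat]])
    then show "of_nat (n + 1) * s \<in> \<int>" by (simp add: algebra_simps)
  next
    fix r s assume rs: "r < B \<or> s < B"
    show "?N r s v = 0"
    proof (rule ccontr)
      assume "?N r s v \<noteq> 0"
      from nz[OF this] obtain \<beta> where \<beta>: "Poly_Mapping.lookup v \<beta> \<noteq> 0" "?c r s \<beta> \<noteq> 0" by blast
      from B[OF \<beta>(1)] obtain M where "deg_le (int M) (Poly_Mapping.lookup v \<beta>)"
        "B \<le> form n \<gamma>a \<beta> - of_nat M" "B \<le> form n \<gamma>b \<beta> - of_nat M" by blast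
      then show False
        using normal_coeff_eq_0[of M "Poly_Mapping.lookup v \<beta>" "r - form n \<gamma>a \<beta>" "s - form n \<gamma>b \<beta>" n ca da cb db] \<beta>(2) rs by auto
    qed
  qed
qed

text \<open>The threshold does not depend on r, and every larger K is allowed, so expansions at
  neighbouring exponents can be compared term by term.\<close>

lemma vop_product:
  assumes G: "exp_coeffs (\<lambda>r. \<Sum>l=1..n. da l r * cb l r) G"
  shows "\<exists>K0. \<forall>K\<ge>K0. \<forall>r. vop n ca da \<gamma>a (\<lambda>_. 1) r (vop n cb db \<gamma>b \<chi> s v) =
     (\<Sum>k\<le>K. vscale (G k) (normal_product n ca da \<gamma>a cb db \<gamma>b \<chi> (r - form n \<gamma>a \<gamma>b + of_nat k) (s - of_nat k) v))"
proof -
  obtain B where B: "\<And>\<beta>. Poly_Mapping.lookup v \<beta> \<noteq> 0 \<Longrightarrow> \<exists>M. deg_le (int M) (Poly_Mapping.lookup v \<beta>)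
      \<and> B \<le> form n \<gamma>b \<beta> - of_nat M \<and> B \<le> form n \<gamma>b \<beta> - of_nat M"
    using form_bound_exists[of v n \<gamma>b \<gamma>b] by blast
  \<comment> \<open>On the support of v, s - (gamma_b, beta) + M \<le> s - B, so this bound meets
    the requirement of \<open>vertex_coeff_product\<close> for every weight at once.\<close>
  define K0 where "K0 = nat \<lceil>s - B\<rceil>"
  have K0: "s - B \<le> of_nat K0" by (simp add: K0_def) linarith
  show ?thesis
  proof (intro exI allI impI)
    fix K r assume K: "K0 \<le> K"
    show "vop n ca da \<gamma>a (\<lambda>_. 1) r (vop n cb db \<gamma>b \<chi> s v) =
     (\<Sum>k\<le>K. vscale (G k) (normal_product n ca da \<gamma>a cb db \<gamma>b \<chi> (r - form n \<gamma>a \<gamma>b + of_nat k) (s - of_nat k) v))"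
    proof (rule poly_mapping_eqI)
      fix \<delta>
      define \<beta> where "\<beta> = \<delta> - (\<gamma>a + \<gamma>b)"
      have \<beta>1: "\<delta> - \<gamma>a - \<gamma>b = \<beta>" "\<delta> - \<gamma>a = \<gamma>b + \<beta>" "\<gamma>b + \<beta> - \<gamma>b = \<beta>"
        by (simp_all add: \<beta>_def)
      define p where "p = Poly_Mapping.lookup v \<beta>"
      let ?N = "\<lambda>k. normal_coeff n ca da cb db (r - form n \<gamma>a (\<gamma>b + \<beta>) + of_nat k) (s - form n \<gamma>b \<beta> - of_nat k) p"
      have prod: "vertex_coeff n ca da (r - form n \<gamma>a (\<gamma>b + \<beta>)) (vertex_coeff n cb db (s - form n \<gamma>b \<beta>) p)
          = (\<Sum>k\<le>K. fconst (G k) * ?N k)"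
      proof (cases "p = 0")
        case True
        then show ?thesis by (simp add: linopD[OF linop_vertex_coeff] linopD[OF linop_normal_coeff])
      next
        case False
        from B[OF False[unfolded p_def]] obtain M where M: "deg_le (int M) p" "B \<le> form n \<gamma>b \<beta> - of_nat M"
          unfolding p_def by blast
        moreover have "of_nat K0 \<le> (of_nat K :: rat)" using K by simp
        ultimately have "s - form n \<gamma>b \<beta> + of_nat M < of_nat K + 1" using K0 by linarith
        from vertex_coeff_product[OF G M(1) this] show ?thesis .
      qed
      have arg: "r - form n \<gamma>a \<gamma>b + of_nat k - form n \<gamma>a \<beta> = r - form n \<gamma>a (\<gamma>b + \<beta>) + of_nat k"
        "s - of_nat k - form n \<gamma>b \<beta> = s - form n \<gamma>b \<beta> - of_nat k" for k
        by (simp_all add: form_add_right)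
      show "Poly_Mapping.lookup (vop n ca da \<gamma>a (\<lambda>_. 1) r (vop n cb db \<gamma>b \<chi> s v)) \<delta> = Poly_Mapping.lookup
       (\<Sum>k\<le>K. vscale (G k) (normal_product n ca da \<gamma>a cb db \<gamma>b \<chi> (r - form n \<gamma>a \<gamma>b + of_nat k) (s - of_nat k) v)) \<delta>"
        unfolding lookup_sum lookup_vscale lookup_vop lookup_normal_product \<beta>_def[symmetric] \<beta>1 p_def[symmetric]
          fscale_def linopD[OF linop_vertex_coeff] prod arg sum_distrib_left
        by (intro sum.cong refl) (simp add: fconst_simps mult_ac)
    qed
  qed
qed

text \<open>The value \<open>normal_product n \<dots> r (s - r)\<close> summed over \<open>r\<close> is the normally ordered product at
  \<open>z\<^sub>1 = \<rho> z\<^sub>2\<close>, which is again a vertex operator.\<close>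

lemma normal_product_diagonal:
  assumes \<gamma>: "\<gamma>a \<in> weight_lattice n" "\<gamma>b \<in> weight_lattice n" and v: "v \<in> V n"
    and inta: "\<And>\<beta>. \<beta> \<in> weight_lattice n \<Longrightarrow> form n \<gamma>a \<beta> \<in> \<int>"
    and intb: "\<And>\<beta>. \<beta> \<in> weight_lattice n \<Longrightarrow> of_nat (n + 1) * form n \<gamma>b \<beta> \<in> \<int>"
    and \<rho>: "\<rho> \<noteq> 0"
  shows "Sum_any (\<lambda>r::int. vscale (\<rho> powi r) (normal_product n ca da \<gamma>a cb db \<gamma>b \<chi> (of_int r) (s - of_int r) v)) =
    vop n (\<lambda>l r. \<rho> ^ r * ca l r + cb l r) (\<lambda>l r. inverse \<rho> ^ r * da l r + db l r) (\<gamma>a + \<gamma>b)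
      (\<lambda>\<beta>. \<rho> powi \<lfloor>form n \<gamma>a \<beta>\<rfloor> * cocycle n \<gamma>a \<gamma>b * \<chi> \<beta>) s v"
    (is "Sum_any ?f = _")
proof -
  have "(\<lambda>r s. normal_product n ca da \<gamma>a cb db \<gamma>b \<chi> r s v) \<in> laurent2 (n + 1) (V n)"
    by (rule normal_product_laurent2[OF \<gamma> v inta intb])
  then obtain B where B: "\<And>r s. r < B \<or> s < B \<Longrightarrow> normal_product n ca da \<gamma>a cb db \<gamma>b \<chi> r s v = 0"
    using laurent2E by blast
  have fin: "?f r = 0" if "r \<notin> {\<lfloor>B\<rfloor>..\<lceil>s - B\<rceil>}" for r :: int
  proof -
    have "of_int r < B \<or> s - of_int r < B" using that by (auto; linarith)
    from B[OF this] show ?thesis by simp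
  qed
  show ?thesis
  proof (rule poly_mapping_eqI)
    fix \<delta>
    define \<beta> where "\<beta> = \<delta> - (\<gamma>a + \<gamma>b)"
    define p where "p = Poly_Mapping.lookup v \<beta>"
    define \<kappa> where "\<kappa> = \<chi> \<beta> * cocycle n \<gamma>b \<beta> * cocycle n \<gamma>a (\<gamma>b + \<beta>)"
    let ?N = "\<lambda>x. normal_coeff n ca da cb db (x - form n \<gamma>a \<beta>) (s - x - form n \<gamma>b \<beta>) p"
    have "Poly_Mapping.lookup (Sum_any ?f) \<delta> = (\<Sum>r\<in>{\<lfloor>B\<rfloor>..\<lceil>s - B\<rceil>}. Poly_Mapping.lookup (?f r) \<delta>)"
      using fin by (subst Sum_any_eq_sum[of "{\<lfloor>B\<rfloor>..\<lceil>s - B\<rceil>}"]) (auto simp: lookup_sum)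
    also have "\<dots> = Sum_any (\<lambda>r. Poly_Mapping.lookup (?f r) \<delta>)"
      by (rule Sum_any_eq_sum[symmetric]) (simp_all only: finite_atLeastAtMost_int fin lookup_zero not_False_eq_True)
    also have "\<dots> = Sum_any (\<lambda>r::int. fconst \<kappa> * (fconst (\<rho> powi r) * ?N (of_int r)))"
      by (intro Sum_any.cong)
        (simp add: lookup_vscale fscale_def lookup_normal_product \<kappa>_def p_def \<beta>_def mult_ac)
    also have "\<dots> = fconst (\<rho> powi \<lfloor>form n \<gamma>a \<beta>\<rfloor> * cocycle n \<gamma>a \<gamma>b * \<chi> \<beta> * cocycle n (\<gamma>a + \<gamma>b) \<beta>) *
       vertex_coeff n (\<lambda>l r. \<rho> ^ r * ca l r + cb l r) (\<lambda>l r. inverse \<rho> ^ r * da l r + db l r)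
         (s - form n (\<gamma>a + \<gamma>b) \<beta>) p"
    proof (cases "p = 0")
      case True
      then show ?thesis by (simp add: linopD[OF linop_vertex_coeff] linopD[OF linop_normal_coeff])
    next
      case False
      then have "\<beta> \<in> weight_lattice n" using v by (auto simp: V_iff p_def)
      from inta[OF this] obtain f where f: "form n \<gamma>a \<beta> = of_int f" by (auto elim: Ints_cases)
      define u where "u = s - form n (\<gamma>a + \<gamma>b) \<beta>"
      \<comment> \<open>Bimultiplicativity of the cocycle splits off its constant value on the pair
        gamma_a, gamma_b and leaves the cocycle of the combined weight.\<close>
      have \<kappa>: "\<kappa> = cocycle n \<gamma>a \<gamma>b * \<chi> \<beta> * cocycle n (\<gamma>a + \<gamma>b) \<beta>"
        by (simp add: \<kappa>_def cocycle_def cocycle_exp_add_left cocycle_exp_add_right power_int_add)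
      have sc: "fconst k * Sum_any g = Sum_any (\<lambda>e. fconst k * g e)" if "finite {e. g e \<noteq> 0}"
        for k and g :: "int \<Rightarrow> fock"
        using that by (rule Sum_any_right_distrib)
      obtain M where M: "deg_le (int M) p" using deg_le_exists by metis
      have fin': "finite {e::int. fconst (\<rho> powi e) * normal_coeff n ca da cb db (of_int e) (u - of_int e) p \<noteq> 0}"
      proof (rule finite_subset)
        show "{e::int. fconst (\<rho> powi e) * normal_coeff n ca da cb db (of_int e) (u - of_int e) p \<noteq> 0}
          \<subseteq> {- int M..\<lfloor>u\<rfloor> + int M}"
        proof
          fix e assume e: "e \<in> {e::int. fconst (\<rho> powi e) * normal_coeff n ca da cb db (of_int e) (u - of_int e) p \<noteq> 0}"
          show "e \<in> {- int M..\<lfloor>u\<rfloor> + int M}"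
          proof (rule ccontr)
            assume "e \<notin> {- int M..\<lfloor>u\<rfloor> + int M}"
            then have "of_int e < - (of_nat M :: rat) \<or> u - of_int e < - of_nat M" by (auto; linarith)
            from normal_coeff_eq_0[OF M this, of n ca da cb db] e show False by simp
          qed
        qed
      qed simp
      \<comment> \<open>The shift r = e + f by the integer f = (gamma_a, beta) is the origin of the
        factor rho^(gamma_a, beta) in the new character.\<close>
      have bij: "bij (\<lambda>e::int. e + f)"
        by (rule bijI) (auto simp: inj_def intro: surjI[of _ "\<lambda>e. e - f"])
      have "Sum_any (\<lambda>r::int. fconst \<kappa> * (fconst (\<rho> powi r) * ?N (of_int r))) =
        Sum_any (\<lambda>e::int. fconst (\<kappa> * \<rho> powi f) * (fconst (\<rho> powi e) * normal_coeff n ca da cb db (of_int e) (u - of_int e) p))"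
        using \<rho> by (intro Sum_any.reindex_cong[OF bij])
          (auto simp: fun_eq_iff f u_def form_add_left power_int_add fconst_simps algebra_simps)
      also have "\<dots> = fconst (\<kappa> * \<rho> powi f) * vertex_coeff n (\<lambda>l r. \<rho> ^ r * ca l r + cb l r) (\<lambda>l r. inverse \<rho> ^ r * da l r + db l r) u p"
        unfolding normal_coeff_diagonal[OF \<rho>, symmetric] by (rule sc[symmetric, OF fin'])
      finally show ?thesis by (simp add: \<kappa> f u_def mult_ac)
    qed
    finally show "Poly_Mapping.lookup (Sum_any ?f) \<delta> = Poly_Mapping.lookup
      (vop n (\<lambda>l r. \<rho> ^ r * ca l r + cb l r) (\<lambda>l r. inverse \<rho> ^ r * da l r + db l r) (\<gamma>a + \<gamma>b)
      (\<lambda>\<beta>. \<rho> powi \<lfloor>form n \<gamma>a \<beta>\<rfloor> * cocycle n \<gamma>a \<gamma>b * \<chi> \<beta>) s v) \<delta>"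
      by (simp only: lookup_vop \<beta>_def p_def)
  qed
qed

section \<open>Bullet products of vertex operators\<close>

lemma qhalf_power: "qhalf ^ k = Fract ([:0, 1:] ^ k) 1"
  by (induction k) (simp_all add: qhalf_def One_fract_def)

lemma qhalf_power_eq_1: "qhalf ^ k = 1 \<Longrightarrow> k = 0"
proof -
  assume "qhalf ^ k = 1"
  then have "[:0, 1 :: complex:] ^ k = 1"
    by (simp add: qhalf_power One_fract_def eq_fract)
  then have "degree ([:0, 1 :: complex:] ^ k) = 0" by simp
  then show "k = 0" by (simp add: degree_power_eq)
qed

lemma qhalf_nonzero: "qhalf \<noteq> 0"
  by (simp add: qhalf_def Zero_fract_def eq_fract)

lemma qpow_nonzero [simp]: "qpow x \<noteq> 0"
  by (simp add: qpow_def qhalf_nonzero)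

lemma qpow_0 [simp]: "qpow 0 = 1"
  by (simp add: qpow_def)

text \<open>The floor in \<open>qpow\<close> is additive as soon as one of the two doubled exponents
  is an integer.\<close>

lemma qpow_add:
  assumes "2 * x \<in> \<int>"
  shows "qpow (x + y) = qpow x * qpow y"
proof -
  obtain i where "2 * x = of_int i" using assms by (auto elim: Ints_cases)
  then have "\<lfloor>2 * (x + y)\<rfloor> = \<lfloor>2 * x\<rfloor> + \<lfloor>2 * y\<rfloor>" by (simp add: distrib_left)
  then show ?thesis by (simp add: qpow_def power_int_add qhalf_nonzero)
qed

lemma qpow_minus: "2 * x \<in> \<int> \<Longrightarrow> qpow (- x) = inverse (qpow x)"
  using qpow_add[of x "- x"] by (simp add: field_simps)

lemma qpow_mult_nat: "2 * x \<in> \<int> \<Longrightarrow> qpow (x * of_nat k) = qpow x ^ k"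
proof (induction k)
  case (Suc k)
  have "qpow (x * of_nat (Suc k)) = qpow (x + x * of_nat k)" by (simp add: algebra_simps)
  then show ?case using Suc by (simp add: qpow_add)
qed simp

lemma qpow_mult_int:
  assumes x: "2 * x \<in> \<int>"
  shows "qpow (x * of_int k) = qpow x powi k"
proof (cases "k \<ge> 0")
  case True
  then obtain m where "k = int m" by (metis nonneg_int_cases)
  then show ?thesis using qpow_mult_nat[OF x] by simp
next
  case False
  then obtain m where k: "k = - int m" by (metis nonneg_int_cases linear neg_0_le_iff_le minus_minus)
  have "2 * (x * of_nat m) = (2 * x) * of_nat m" by simp
  also have "\<dots> \<in> \<int>" by (rule Ints_mult[OF x Ints_of_nat])
  finally show ?thesis
    by (simp add: k qpow_minus qpow_mult_nat[OF x] power_int_minus)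
qed

text \<open>The indeterminate q^(1/2) is no root of unity. This singles out the one t for which a
  dilated pole meets the diagonal.\<close>

lemma qpow_inj:
  assumes "2 * x \<in> \<int>" "2 * y \<in> \<int>" "qpow x = qpow y"
  shows "x = y"
proof -
  obtain i j where ij: "2 * x = of_int i" "2 * y = of_int j" using assms by (auto elim!: Ints_cases)
  have "qhalf powi i = qhalf powi j" using assms(3) by (simp add: qpow_def ij)
  then have "qhalf powi (i - j) = 1" "qhalf powi (j - i) = 1"
    by (simp_all add: power_int_diff qhalf_nonzero)
  moreover have "i - j = int (nat (i - j)) \<or> j - i = int (nat (j - i))" by linarith
  ultimately have "nat (i - j) = 0 \<and> i - j = int (nat (i - j)) \<or> nat (j - i) = 0 \<and> j - i = int (nat (j - i))"
    using qhalf_power_eq_1 by (metis power_int_of_nat)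
  then show ?thesis using ij by (auto split: if_splits)
qed

lemma hom_laurent_zero_arg: "a \<in> hom_laurent n N \<Longrightarrow> a r 0 = 0"
proof -
  assume "a \<in> hom_laurent n N"
  then have "a r (vscale 0 0) = vscale 0 (a r 0)"
    using V_zero unfolding hom_laurent_def linear_on_space_def by blast
  then show ?thesis by simp
qed

lemma hom_laurent_nonint: "a \<in> hom_laurent n 1 \<Longrightarrow> v \<in> V n \<Longrightarrow> r \<notin> \<int> \<Longrightarrow> a r v = 0"
  unfolding hom_laurent_def laurent_def by auto

lemma vscale_add: "vscale c (v + w) = vscale c v + vscale c w"
  by (auto intro!: vcoeff_eqI simp: distrib_left)

lemma vscale_diff: "vscale c (v - w) = vscale c v - vscale c w"
  by (auto intro!: vcoeff_eqI simp: right_diff_distrib)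

lemma dilate_hom_laurent:
  assumes "a \<in> hom_laurent n N" shows "dilate t a \<in> hom_laurent n N"
proof -
  have "dilate t a r (v + w) = dilate t a r v + dilate t a r w" "dilate t a r (vscale c v) = vscale c (dilate t a r v)"
    if "v \<in> V n" "w \<in> V n" for r v w c
    using assms that unfolding hom_laurent_def linear_on_space_def
    by (auto simp: dilate_def vscale_add vscale_vscale mult.commute)
  moreover have "(\<lambda>r. dilate t a r v) \<in> laurent N (V n)" if "v \<in> V n" for v
  proof -
    have "(\<lambda>r. a r v) \<in> laurent N (V n)" using assms that unfolding hom_laurent_def by blast
    then obtain B where "\<And>r. r < B \<Longrightarrow> a r v = 0" "\<And>r. a r v \<in> V n" "\<And>r. a r v \<noteq> 0 \<Longrightarrow> of_nat N * r \<in> \<int>"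
      unfolding laurent_def by blast
    then show ?thesis
      unfolding laurent_def dilate_def
      by (intro CollectI conjI allI impI exI[of _ B]) (metis V_vscale, metis vscale_simps(3), metis vscale_simps(3))
  qed
  ultimately show ?thesis unfolding hom_laurent_def linear_on_space_def by blast
qed

lemma laurent2D:
  assumes "f \<in> laurent2 N M"
  shows "f r s \<in> M" "f r s \<noteq> 0 \<Longrightarrow> r \<in> \<int>" "f r s \<noteq> 0 \<Longrightarrow> of_nat N * s \<in> \<int>"
  using assms unfolding laurent2_def by blast+

lemma laurent2I:
  assumes "\<And>r s. f r s \<in> M" "\<And>r s. f r s \<noteq> 0 \<Longrightarrow> r \<in> \<int>" "\<And>r s. f r s \<noteq> 0 \<Longrightarrow> of_nat N * s \<in> \<int>"
    "\<And>r s. r < B \<or> s < B \<Longrightarrow> f r s = 0"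
  shows "f \<in> laurent2 N M"
  using assms unfolding laurent2_def by blast

lemma laurent2_vscale:
  assumes f: "f \<in> laurent2 N (V n)"
  shows "(\<lambda>r s. vscale (k r s) (f r s)) \<in> laurent2 N (V n)"
proof -
  obtain B where B: "\<And>r s. r < B \<or> s < B \<Longrightarrow> f r s = 0" using laurent2E[OF f] by blast
  have nz: "f r s \<noteq> 0" if "vscale (k r s) (f r s) \<noteq> 0" for r s
    using that vscale_simps(3) by metis
  show ?thesis
    by (rule laurent2I[where B = B]) (use V_vscale laurent2D[OF f] nz B vscale_simps(3) in metis)+
qed

lemma laurent2_diff:
  assumes f: "f \<in> laurent2 N (V n)" and g: "g \<in> laurent2 N (V n)"
  shows "(\<lambda>r s. f r s - g r s) \<in> laurent2 N (V n)"
proof -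
  obtain B1 where B1: "\<And>r s. r < B1 \<or> s < B1 \<Longrightarrow> f r s = 0" using laurent2E[OF f] by blast
  obtain B2 where B2: "\<And>r s. r < B2 \<or> s < B2 \<Longrightarrow> g r s = 0" using laurent2E[OF g] by blast
  have nz: "f r s \<noteq> 0 \<or> g r s \<noteq> 0" if "f r s - g r s \<noteq> 0" for r s using that by auto
  show ?thesis
  proof (rule laurent2I[where B = "min B1 B2"])
    show "f r s - g r s \<in> V n" for r s by (intro V_diff laurent2D[OF f] laurent2D[OF g])
    show "r \<in> \<int>" if "f r s - g r s \<noteq> 0" for r s
      using nz[OF that] laurent2D(2)[OF f] laurent2D(2)[OF g] by blast
    show "of_nat N * s \<in> \<int>" if "f r s - g r s \<noteq> 0" for r s
      using nz[OF that] laurent2D(3)[OF f] laurent2D(3)[OF g] by blast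
    show "f r s - g r s = 0" if "r < min B1 B2 \<or> s < min B1 B2" for r s
      using B1[of r s] B2[of r s] that by auto
  qed
qed

lemma laurent2_shift:
  assumes "f \<in> laurent2 N M"
  shows "(\<lambda>r s. f (r + of_int i) (s + of_int j)) \<in> laurent2 N M"
proof -
  obtain B where B: "\<And>r s. r < B \<or> s < B \<Longrightarrow> f r s = 0" using assms unfolding laurent2_def by blast
  have int: "r \<in> \<int> \<and> of_nat N * s \<in> \<int>" if "f r s \<noteq> 0" for r s
    using assms that unfolding laurent2_def by blast
  have M: "f r s \<in> M" for r s using assms unfolding laurent2_def by blast
  show ?thesis
    unfolding laurent2_def
  proof (intro CollectI conjI allI impI exI)
    fix r s assume nz: "f (r + of_int i) (s + of_int j) \<noteq> 0"
    have "r + of_int i - of_int i \<in> \<int>" using int[OF nz] by (intro Ints_diff) auto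
    then show "r \<in> \<int>" by simp
    have "of_nat N * (s + of_int j) - of_nat N * of_int j \<in> \<int>"
      using int[OF nz] by (intro Ints_diff Ints_mult[OF Ints_of_nat Ints_of_int]) auto
    then show "of_nat N * s \<in> \<int>" by (simp add: algebra_simps)
  next
    fix r s assume "r < B - of_int (max i j) \<or> s < B - of_int (max i j)"
    then have "r + of_int i < B \<or> s + of_int j < B" by linarith
    then show "f (r + of_int i) (s + of_int j) = 0" by (rule B)
  qed (rule M)
qed

text \<open>Replacing z1 by q^t z1 in (z1 - c z2) a(z1) b(z2) = N(z1, z2) and dividing by q^t moves
  the pole to z1 = c q^-t z2 and turns N into q^-t N(q^t z1, z2). There is a residue at z1 = z2 only
  if c = q^t.\<close>

lemma nth_product_dilate:
  assumes a: "a \<in> hom_laurent n 1" and b: "b \<in> hom_laurent n (n + 1)"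
    and N: "\<And>v. v \<in> V n \<Longrightarrow> (\<lambda>r s. N r s v) \<in> laurent2 (n + 1) (V n)"
    and rel: "\<And>v r s. v \<in> V n \<Longrightarrow> a (r - 1) (b s v) - vscale c (a r (b (s - 1) v)) = N r s v"
    and v: "v \<in> V n" and t: "2 * t \<in> \<int>"
  shows "nth_product n (dilate t a) 0 b s v = (if c = qpow t
     then Sum_any (\<lambda>r::int. vscale (qpow (t * (of_int r - 1))) (N (of_int r) (s - of_int r) v)) else 0)"
proof -
  have bV: "b s w \<in> V n" if "w \<in> V n" for s w
    using b that unfolding hom_laurent_def laurent_def by auto
  have rel': "dilate t a (r - 1) (b s w) - vscale (c * qpow (- t)) (dilate t a r (b (s - 1) w)) =
      vscale (qpow (t * (r - 1))) (N r s w)" if w: "w \<in> V n" for w r s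
  proof (cases "r \<in> \<int>")
    case True
    then obtain i where i: "r = of_int i" by (auto elim: Ints_cases)
    have "qpow (- t) * qpow (t * r) = qpow (t * (r - 1))"
      using t by (simp add: algebra_simps flip: qpow_add)
    then show ?thesis
      unfolding rel[OF w, symmetric] dilate_def vscale_diff vscale_vscale by (simp add: mult_ac)
  next
    case False
    then have "r - 1 \<notin> \<int>" by (metis Ints_1 Ints_add diff_add_cancel)
    then have z: "a r (b (s - 1) w) = 0" "a (r - 1) (b s w) = 0"
      using hom_laurent_nonint[OF a bV[OF w]] False by auto
    then show ?thesis unfolding rel[OF w, symmetric] dilate_def by simp
  qed
  have "c * qpow (- t) = 1 \<longleftrightarrow> c = qpow t"
    by (simp add: qpow_minus[OF t] field_simps)
  then show ?thesis
    using nth_product_0[OF dilate_hom_laurent[OF a] b laurent2_vscale[OF N] rel' v] by simp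
qed

text \<open>The case c = 0 of \<open>nth_product_dilate\<close>, for z1 a(z1) b(z2): zero is not a
  power of q, so every summand vanishes.\<close>

lemma bullet_no_pole:
  assumes a: "a \<in> hom_laurent n 1" and b: "b \<in> hom_laurent n (n + 1)"
    and N: "\<And>v. v \<in> V n \<Longrightarrow> (\<lambda>r s. N r s v) \<in> laurent2 (n + 1) (V n)"
    and reg: "\<And>v r s. v \<in> V n \<Longrightarrow> a r (b s v) = N r s v"
    and v: "v \<in> V n"
  shows "bullet n a b s v = 0"
proof -
  have "nth_product n (dilate t a) 0 b s v = 0" if "2 * t \<in> \<int>" for t s
    using nth_product_dilate[OF a b, of "\<lambda>r s. N (r - 1) s" 0, OF _ _ v that]
      laurent2_shift[OF N, of _ "-1" 0] reg by simp
  then show ?thesis unfolding bullet_def Let_def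
    by (simp add: when_def cong: Sum_any.cong if_cong)
qed

text \<open>Only t = t0 contributes, by \<open>qpow_inj\<close>. The weight condition makes the
  exponent (wt a, wt b) + 1 zero, so no power of z is left, and the factor q^t cancels the q^-t from
  the dilation; what remains is N(q^t0 z, z).\<close>

lemma bullet_pole:
  assumes a: "a \<in> hom_laurent n 1" and b: "b \<in> hom_laurent n (n + 1)"
    and N: "\<And>v. v \<in> V n \<Longrightarrow> (\<lambda>r s. N r s v) \<in> laurent2 (n + 1) (V n)"
    and rel: "\<And>v r s. v \<in> V n \<Longrightarrow> a (r - 1) (b s v) - vscale (qpow (of_int t0)) (a r (b (s - 1) v)) = N r s v"
    and v: "v \<in> V n" and wt: "form n (wt n a) (wt n b) = -1"
  shows "bullet n a b s v = Sum_any (\<lambda>r::int. vscale (qpow (of_int t0) powi r) (N (of_int r) (s - of_int r) v))"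
proof -
  have t0: "2 * of_int t0 \<in> (\<int> :: rat set)" by (intro Ints_mult) auto
  let ?f = "\<lambda>t. vscale (qpow (- t * 0) * qpow t) (nth_product n (dilate t a) 0 b (s + 0) v) when 2 * t \<in> \<int>"
  have "bullet n a b s v = Sum_any ?f"
    unfolding bullet_def Let_def wt by simp
  also have "\<dots> = sum ?f {of_int t0}"
  proof (rule Sum_any_eq_sum)
    fix t :: rat assume "t \<notin> {of_int t0}"
    then show "?f t = 0"
      using nth_product_dilate[OF a b N rel v] qpow_inj[OF t0] by (auto simp: when_def)
  qed simp
  also have "\<dots> = vscale (qpow (of_int t0)) (nth_product n (dilate (of_int t0) a) 0 b s v)"
    using t0 by (simp add: when_def)
  also have "\<dots> = vscale (qpow (of_int t0)) (Sum_any (\<lambda>r::int. vscale (qpow (of_int t0 * (of_int r - 1))) (N (of_int r) (s - of_int r) v)))"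
    by (simp add: nth_product_dilate[OF a b N rel v t0])
  also have "\<dots> = Sum_any (\<lambda>r::int. vscale (qpow (of_int t0) powi r) (N (of_int r) (s - of_int r) v))"
  proof -
    obtain B where B: "\<And>r s. r < B \<or> s < B \<Longrightarrow> N r s v = 0"
      using laurent2E[OF N[OF v]] by blast
    let ?A = "{\<lfloor>B\<rfloor>..\<lceil>s - B\<rceil>}"
    have fin: "N (of_int r) (s - of_int r) v = 0" if "r \<notin> ?A" for r :: int
    proof -
      have "of_int r < B \<or> s - of_int r < B" using that by (auto; linarith)
      then show ?thesis by (rule B)
    qed
    have q: "qpow (of_int t0) * qpow (of_int t0 * (of_int r - 1)) = qpow (of_int t0) powi r" for r
      using qpow_mult_int[OF t0, of r] by (simp add: t0 algebra_simps flip: qpow_add)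
    have sc: "vscale k (sum g ?A) = (\<Sum>r\<in>?A. vscale k (g r))" for k and g :: "int \<Rightarrow> vspace"
      by (rule vcoeff_eqI) (simp add: sum_distrib_left)
    show ?thesis
      by (subst (1 2) Sum_any_eq_sum[of ?A]) (simp_all add: fin sc vscale_vscale q)
  qed
  finally show ?thesis .
qed

text \<open>The zero series has every weight, so the power of z in the product is arbitrary here,
  but all zeroth products are regular with N = 0.\<close>

lemma bullet_zero:
  assumes a: "a \<in> hom_laurent n 1" and b: "\<And>r v. v \<in> V n \<Longrightarrow> b r v = 0" and v: "v \<in> V n"
  shows "bullet n a b s v = 0"
proof (rule bullet_no_pole[OF a _ _ _ v])
  show "b \<in> hom_laurent n (n + 1)"
    using b V_zero unfolding hom_laurent_def linear_on_space_def laurent_def by (auto simp: V_add V_vscale)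
  show "(\<lambda>r s. (\<lambda>_ _ _. 0) r s v) \<in> laurent2 (n + 1) (V n)" for v
    using V_zero unfolding laurent2_def by auto
  show "a r (b s v) = (\<lambda>_ _ _. 0) r s v" if "v \<in> V n" for v r s
    using that b hom_laurent_zero_arg[OF a] by simp
qed

lemma exp_coeffs_cong:
  assumes "exp_coeffs g' G" "\<And>r. r \<ge> 1 \<Longrightarrow> g r = g' r"
  shows "exp_coeffs g G"
proof -
  have "(\<Sum>r=1..m. of_nat r * g r * G (m - r)) = (\<Sum>r=1..m. of_nat r * g' r * G (m - r))" for m
    using assms(2) by (intro sum.cong) auto
  then show ?thesis using assms(1) unfolding exp_coeffs_def by metis
qed

text \<open>The three kinds of contractions which occur are \<open>1\<close>, \<open>1 - c z\<^sub>2/z\<^sub>1\<close> and \<open>(1 - c z\<^sub>2/z\<^sub>1)\<^sup>-\<^sup>1\<close>.\<close>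

locale vertex_pair =
  fixes n :: nat and ca da cb db :: modes and \<gamma>a \<gamma>b :: weight
    and \<chi> :: "weight \<Rightarrow> qfield" and b :: op_series
  assumes \<gamma>: "\<gamma>a \<in> weight_lattice n" "\<gamma>b \<in> weight_lattice n"
    and inta: "\<And>\<beta>. \<beta> \<in> weight_lattice n \<Longrightarrow> form n \<gamma>a \<beta> \<in> \<int>"
    and intb: "\<And>\<beta>. \<beta> \<in> weight_lattice n \<Longrightarrow> of_nat (n + 1) * form n \<gamma>b \<beta> \<in> \<int>"
    and \<chi>: "\<chi> 0 \<noteq> 0"
    and b_eq: "\<And>v r. v \<in> V n \<Longrightarrow> b r v = vop n cb db \<gamma>b \<chi> r v"
begin

abbreviation "a \<equiv> vop n ca da \<gamma>a (\<lambda>_. 1)"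
abbreviation "NP \<equiv> normal_product n ca da \<gamma>a cb db \<gamma>b \<chi>"
abbreviation "NPk r s k \<equiv> NP (r - form n \<gamma>a \<gamma>b + of_nat k) (s - of_nat k)"
abbreviation "contraction \<equiv> (\<lambda>r. \<Sum>l=1..n. da l r * cb l r)"

lemma a_hom: "a \<in> hom_laurent n 1"
  by (rule vop_hom_laurent[OF \<gamma>(1)]) (simp add: inta)

lemma b_hom: "b \<in> hom_laurent n (n + 1)"
  by (rule hom_laurent_cong[OF vop_hom_laurent[OF \<gamma>(2) intb] b_eq])

lemma NP_laurent2: "v \<in> V n \<Longrightarrow> (\<lambda>r s. NP r s v) \<in> laurent2 (n + 1) (V n)"
  by (rule normal_product_laurent2[OF \<gamma> _ inta intb])

lemma form_int: "form n \<gamma>a \<gamma>b = of_int \<lfloor>form n \<gamma>a \<gamma>b\<rfloor>"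
  using inta[OF \<gamma>(2)] by (elim Ints_cases) simp

lemma product:
  assumes G: "exp_coeffs contraction G" and v: "v \<in> V n"
  obtains K0 where "\<And>K r. K \<ge> K0 \<Longrightarrow> a r (b s v) =
     (\<Sum>k\<le>K. vscale (G k) (NPk r s k v))"
proof -
  obtain K0 where "\<forall>K\<ge>K0. \<forall>r. a r (vop n cb db \<gamma>b \<chi> s v) =
     (\<Sum>k\<le>K. vscale (G k) (NPk r s k v))"
    using vop_product[OF G, where ca = ca and \<gamma>a = \<gamma>a and \<gamma>b = \<gamma>b and \<chi> = \<chi> and s = s and v = v] ..
  then show thesis unfolding b_eq[OF v, symmetric] by (intro that[of K0]) blast
qed

text \<open>The contraction is z1^(gamma_a, gamma_b), an integral power even if negative, which
  merely shifts the exponents of a Laurent series.\<close>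

lemma bullet_trivial_contraction:
  assumes g: "\<And>r. r \<ge> 1 \<Longrightarrow> contraction r = 0" and v: "v \<in> V n"
  shows "bullet n a b s v = 0"
proof (rule bullet_no_pole[OF a_hom b_hom _ _ v])
  let ?h = "- \<lfloor>form n \<gamma>a \<gamma>b\<rfloor>"
  let ?G = "\<lambda>m::nat. if m = 0 then 1 else 0 :: qfield"
  have G: "exp_coeffs contraction ?G"
    by (rule exp_coeffs_cong[OF exp_coeffs_zero g])
  show "(\<lambda>r s. NP (r + of_int ?h) (s + of_int 0) v) \<in> laurent2 (n + 1) (V n)" if "v \<in> V n" for v
    by (rule laurent2_shift[OF NP_laurent2[OF that]])
  show "a r (b s v) = NP (r + of_int ?h) (s + of_int 0) v" if v: "v \<in> V n" for v r s
  proof -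
    obtain K where "a r (b s v) = (\<Sum>k\<le>K. vscale (?G k) (NPk r s k v))"
      using product[OF G v, of s] by blast
    also have "\<dots> = (\<Sum>k\<in>{0}. vscale (?G k) (NPk r s k v))"
      by (rule sum.mono_neutral_right) auto
    finally show ?thesis by (subst (asm) form_int) simp
  qed
qed

text \<open>The contraction is a power of z1 times 1 - c z2/z1, a Laurent polynomial, so the product
  has no pole off the axes.\<close>

lemma bullet_linear_contraction:
  assumes g: "\<And>r. r \<ge> 1 \<Longrightarrow> contraction r = - (c ^ r / of_nat r)" and v: "v \<in> V n"
  shows "bullet n a b s v = 0"
proof (rule bullet_no_pole[OF a_hom b_hom _ _ v])
  let ?h = "- \<lfloor>form n \<gamma>a \<gamma>b\<rfloor>"
  let ?G = "\<lambda>m::nat. if m = 0 then 1 else if m = 1 then - c else 0"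
  have G: "exp_coeffs contraction ?G"
    by (rule exp_coeffs_cong[OF exp_coeffs_linear g])
  show "(\<lambda>r s. NP (r + of_int ?h) (s + of_int 0) v - vscale c (NP (r + of_int (?h + 1)) (s + of_int (-1)) v))
      \<in> laurent2 (n + 1) (V n)" if "v \<in> V n" for v
    by (intro laurent2_diff laurent2_vscale laurent2_shift[OF NP_laurent2[OF that]])
  show "a r (b s v) = NP (r + of_int ?h) (s + of_int 0) v - vscale c (NP (r + of_int (?h + 1)) (s + of_int (-1)) v)"
    if v: "v \<in> V n" for v r s
  proof -
    obtain K0 where K0: "\<And>K r. K \<ge> K0 \<Longrightarrow> a r (b s v) =
        (\<Sum>k\<le>K. vscale (?G k) (NPk r s k v))"
      using product[OF G v, of s] by blast
    have "a r (b s v) = (\<Sum>k\<le>K0 + 1. vscale (?G k) (NPk r s k v))"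
      by (rule K0) simp
    also have "\<dots> = (\<Sum>k\<in>{0, 1}. vscale (?G k) (NPk r s k v))"
      by (rule sum.mono_neutral_right) auto
    finally have eq: "a r (b s v) = (\<Sum>k\<in>{0, 1}. vscale (?G k) (NPk r s k v))" .
    obtain h where h: "form n \<gamma>a \<gamma>b = of_int h" using form_int by blast
    show ?thesis unfolding eq by (simp add: h algebra_simps)
  qed
qed

text \<open>With (gamma_a, gamma_b) = -1 the contraction is z1^-1 (1 - c z2/z1)^-1, the expansion of
  (z1 - c z2)^-1. The product is therefore the normally ordered product at z1 = c z2, which
  \<open>normal_product_diagonal\<close> identifies.\<close>

lemma bullet_geometric_contraction:
  assumes g: "\<And>r. r \<ge> 1 \<Longrightarrow> contraction r = qpow (of_int t) ^ r / of_nat r"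
    and h: "form n \<gamma>a \<gamma>b = -1" and v: "v \<in> V n"
  shows "bullet n a b s v = vop n (\<lambda>l r. qpow (of_int t) ^ r * ca l r + cb l r)
    (\<lambda>l r. inverse (qpow (of_int t)) ^ r * da l r + db l r) (\<gamma>a + \<gamma>b)
    (\<lambda>\<beta>. qpow (of_int t) powi \<lfloor>form n \<gamma>a \<beta>\<rfloor> * cocycle n \<gamma>a \<gamma>b * \<chi> \<beta>) s v"
proof -
  let ?c = "qpow (of_int t)"
  have G: "exp_coeffs contraction (\<lambda>m. ?c ^ m)"
    by (rule exp_coeffs_cong[OF exp_coeffs_geometric g])
  have wta: "wt n a = \<gamma>a"
    by (rule wt_vop[where c = ca and d = da and \<chi> = "\<lambda>_. 1"])
      (use \<gamma>(1) inta in \<open>auto intro!: Ints_mult Ints_add\<close>)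
  have wtb: "wt n b = \<gamma>b"
    by (rule wt_vop[where c = cb and d = db and \<chi> = \<chi>], rule b_eq[OF vacuum_V], rule \<gamma>(2), rule \<chi>, rule intb)
  have "bullet n a b s v = Sum_any (\<lambda>r::int. vscale (?c powi r) (NP (of_int r) (s - of_int r) v))"
  proof (rule bullet_pole[OF a_hom b_hom NP_laurent2 _ v])
    show "form n (wt n a) (wt n b) = -1" by (simp add: wta wtb h)
    show "a (r - 1) (b s v) - vscale ?c (a r (b (s - 1) v)) = NP r s v" if v: "v \<in> V n" for v r s
    proof -
      obtain K0 where "\<And>K r. K \<ge> K0 \<Longrightarrow> a r (b s v) =
          (\<Sum>k\<le>K. vscale (?c ^ k) (NPk r s k v))"
        using product[OF G v, of s] by blast
      note K0 = this[unfolded h diff_minus_eq_add]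
      obtain K1 where "\<And>K r. K \<ge> K1 \<Longrightarrow> a r (b (s - 1) v) =
          (\<Sum>k\<le>K. vscale (?c ^ k) (NP (r - form n \<gamma>a \<gamma>b + of_nat k) (s - 1 - of_nat k) v))"
        using product[OF G v, of "s - 1"] by blast
      note K1 = this[unfolded h diff_minus_eq_add]
      define K where "K = max K0 K1"
      have sc: "vscale k (sum f A) = (\<Sum>i\<in>A. vscale k (f i))" for k f and A :: "nat set"
        by (rule vcoeff_eqI) (simp add: sum_distrib_left)
      \<comment> \<open>Multiplying by z1 - c z2 telescopes: the term k = 0 is N, and the later
        ones, shifted by one, give c times the expansion at (r, s - 1). Hence one term more on this
        side.\<close>
      have "a (r - 1) (b s v) = (\<Sum>k\<le>Suc K. vscale (?c ^ k) (NP (r - 1 + 1 + of_nat k) (s - of_nat k) v))"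
        by (rule K0) (simp add: K_def)
      also have "\<dots> = NP r s v + (\<Sum>k\<le>K. vscale (?c ^ Suc k) (NP (r + of_nat (Suc k)) (s - of_nat (Suc k)) v))"
        by (simp add: sum.atMost_Suc_shift del: sum.atMost_Suc)
      also have "(\<Sum>k\<le>K. vscale (?c ^ Suc k) (NP (r + of_nat (Suc k)) (s - of_nat (Suc k)) v)) =
         vscale ?c (a r (b (s - 1) v))"
      proof -
        have "K1 \<le> K" by (simp add: K_def)
        from K1[OF this, of r] show ?thesis
          by (simp add: sc vscale_vscale algebra_simps)
      qed
      finally show ?thesis by simp
    qed
  qed
  then show ?thesis
    using normal_product_diagonal[OF \<gamma> v inta intb qpow_nonzero] by simp
qed

end

section \<open>The fundamental modules\<close>

text \<open>The basis of the \<open>i\<close>-th fundamental module is indexed by the \<open>i\<close>-element subsets \<open>S\<close> of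
  \<open>{1..n + 1}\<close>, and \<open>f\<^sub>j\<close> replaces \<open>j\<close> by \<open>j + 1\<close>.\<close>

definition lowerable :: "nat \<Rightarrow> nat set \<Rightarrow> bool" where
  "lowerable j S \<longleftrightarrow> j \<in> S \<and> Suc j \<notin> S"

definition raisable :: "nat \<Rightarrow> nat set \<Rightarrow> bool" where
  "raisable j S \<longleftrightarrow> j \<notin> S \<and> Suc j \<in> S"

definition lower :: "nat \<Rightarrow> nat set \<Rightarrow> nat set" where
  "lower j S = insert (Suc j) (S - {j})"

definition raise :: "nat \<Rightarrow> nat set \<Rightarrow> nat set" where
  "raise j S = insert j (S - {Suc j})"

text \<open>The h_j-eigenvalue of the basis vector of S: 1 if S is lowerable at j, -1 if it is
  raisable, 0 otherwise.\<close>

definition hpair :: "nat \<Rightarrow> nat set \<Rightarrow> int" where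
  "hpair j S = (if j \<in> S then 1 else 0) - (if Suc j \<in> S then 1 else 0)"

type_synonym wedge = "nat set \<Rightarrow> qfield"

text \<open>A vector is its coordinate function, on all sets of naturals at once. The coordinate of
  f_j at S is therefore read off at the preimage \<open>raise j S\<close>.\<close>

definition wedge_f :: "nat \<Rightarrow> wedge \<Rightarrow> wedge" where
  "wedge_f j \<phi> = (\<lambda>S. if raisable j S then \<phi> (raise j S) else 0)"

definition wedge_e :: "nat \<Rightarrow> wedge \<Rightarrow> wedge" where
  "wedge_e j \<phi> = (\<lambda>S. if lowerable j S then \<phi> (lower j S) else 0)"

definition wedge_k :: "int \<Rightarrow> nat \<Rightarrow> wedge \<Rightarrow> wedge" where
  "wedge_k \<epsilon> j \<phi> = (\<lambda>S. qpow (of_int (\<epsilon> * hpair j S)) * \<phi> S)"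

definition wedge_basis :: "nat set \<Rightarrow> wedge" where
  "wedge_basis S = (\<lambda>T. if T = S then 1 else 0)"

lemma qpow_of_int_inj: "qpow (of_int a) = qpow (of_int b) \<longleftrightarrow> a = b"
proof
  assume "qpow (of_int a) = qpow (of_int b)"
  then have "of_int a = (of_int b :: rat)" by (intro qpow_inj Ints_mult) auto
  then show "a = b" by simp
qed simp

lemma qpow_of_int_add: "qpow (of_int (a + b)) = qpow (of_int a) * qpow (of_int b)"
proof -
  have "2 * of_int a \<in> (\<int> :: rat set)" by (intro Ints_mult) auto
  from qpow_add[OF this] show ?thesis by simp
qed

lemma q_diff_nonzero: "qpow 1 - qpow (-1) \<noteq> 0"
  using qpow_of_int_inj[of 1 "-1"] by simp

lemma qint_simps: "qint 0 = 0" "qint 1 = 1" "qint (-1) = -1"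
proof -
  show "qint 0 = 0" by (simp add: qint_def)
  show "qint 1 = 1" using q_diff_nonzero by (simp add: qint_def)
  have "qint (-1) = (qpow (-1) - qpow 1) / (qpow 1 - qpow (-1))" by (simp add: qint_def)
  also have "\<dots> = - 1" using q_diff_nonzero by (simp add: divide_eq_eq)
  finally show "qint (-1) = -1" .
qed

text \<open>All eigenvalues of h_j are 1, 0 or -1, and \<open>qint\<close> fixes these numbers, so
  the quantum relation reduces to the classical one. For different indices the two moves
  commute.\<close>

lemma wedge_e_f:
  "wedge_e j (wedge_f k \<phi>) = (\<lambda>S. wedge_f k (wedge_e j \<phi>) S +
     (if j = k then 1 / (qpow 1 - qpow (-1)) * (wedge_k 1 j \<phi> S - wedge_k (-1) j \<phi> S) else 0))"
proof
  fix S
  show "wedge_e j (wedge_f k \<phi>) S = wedge_f k (wedge_e j \<phi>) S +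
     (if j = k then 1 / (qpow 1 - qpow (-1)) * (wedge_k 1 j \<phi> S - wedge_k (-1) j \<phi> S) else 0)"
  proof (cases "j = k")
    case True
    have h: "1 / (qpow 1 - qpow (-1)) * (wedge_k 1 j \<phi> S - wedge_k (-1) j \<phi> S) = qint (hpair j S) * \<phi> S"
      by (simp add: wedge_k_def qint_def diff_divide_distrib algebra_simps)
    have s: "raise j (lower j S) = S" if "lowerable j S"
      using that by (auto simp: raise_def lower_def lowerable_def)
    have t: "lower j (raise j S) = S" if "raisable j S"
      using that by (auto simp: raise_def lower_def raisable_def)
    have r: "raisable j (lower j S)" if "lowerable j S"
      using that by (auto simp: raisable_def lower_def lowerable_def)
    have l: "lowerable j (raise j S)" if "raisable j S"
      using that by (auto simp: raisable_def raise_def lowerable_def)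
    consider "lowerable j S" | "raisable j S" | "\<not> lowerable j S" "\<not> raisable j S" by blast
    then have "wedge_e j (wedge_f j \<phi>) S = wedge_f j (wedge_e j \<phi>) S + qint (hpair j S) * \<phi> S"
    proof cases
      case 1
      then have "hpair j S = 1" "\<not> raisable j S" by (auto simp: hpair_def lowerable_def raisable_def)
      then show ?thesis using 1 s r by (simp add: wedge_e_def wedge_f_def qint_simps)
    next
      case 2
      then have "hpair j S = -1" "\<not> lowerable j S" by (auto simp: hpair_def lowerable_def raisable_def)
      then show ?thesis using 2 t l by (simp add: wedge_e_def wedge_f_def qint_simps)
    next
      case 3
      then have "hpair j S = 0" by (auto simp: hpair_def lowerable_def raisable_def)
      then show ?thesis using 3 by (simp add: wedge_e_def wedge_f_def qint_simps)
    qed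
    then show ?thesis using True h by simp
  next
    case False
    have 1: "lowerable j S \<and> raisable k (lower j S) \<longleftrightarrow> raisable k S \<and> lowerable j (raise k S)"
      using False by (auto simp: lowerable_def raisable_def lower_def raise_def)
    have 2: "raise k (lower j S) = lower j (raise k S)" if "lowerable j S" "raisable k (lower j S)"
      using that False by (auto simp: lowerable_def raisable_def lower_def raise_def)
    show ?thesis
      using False 1 2 by (auto simp: wedge_e_def wedge_f_def)
  qed
qed

text \<open>Otherwise m, extended by 0 to the positions 0 and n + 1, would be an arithmetic
  progression vanishing at both ends. Hence some K_j tells a strictly lower weight from the highest
  one.\<close>

lemma cartan_nondegenerate:
  fixes m :: "nat \<Rightarrow> nat"
  assumes "k \<in> {1..n}" "m k \<noteq> 0"
  shows "\<exists>j\<in>{1..n}. (\<Sum>k=1..n. cartan k j * int (m k)) \<noteq> 0"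
proof (rule ccontr)
  assume "\<not> ?thesis"
  then have 0: "(\<Sum>k=1..n. cartan k j * int (m k)) = 0" if "j \<in> {1..n}" for j using that by blast
  define g where "g b = (if b \<in> {1..n} then int (m b) else 0)" for b
  have rec: "g (Suc j) = 2 * g j - g (j - 1)" if "j \<in> {1..n}" for j
  proof -
    have "0 = (\<Sum>k=1..n. of_int (cartan k j) * g k)"
      unfolding 0[OF that, symmetric] by (intro sum.cong) (auto simp: g_def)
    also have "\<dots> = 2 * g j - g (j - 1) - g (Suc j)"
      by (rule sum_cartan[OF that]) (auto simp: g_def)
    finally show ?thesis by simp
  qed
  have lin: "j \<le> n \<Longrightarrow> g j = int j * g 1 \<and> g (Suc j) = int (Suc j) * g 1" for j
  proof (induction j)
    case 0
    then show ?case by (simp add: g_def)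
  next
    case (Suc j)
    then show ?case using rec[of "Suc j"] by (simp add: algebra_simps)
  qed
  have "g (Suc n) = 0" by (simp add: g_def)
  then have "g 1 = 0" using lin[of n] by simp
  then have "g k = 0" using lin[of k] assms by simp
  then show False using assms by (simp add: g_def)
qed

section \<open>The irreducible module compared with the subset model\<close>

locale fundamental_module = Uq_irreducible_hw_module scale n L E F K K' "fund_weight i" v
  for scale :: "qfield \<Rightarrow> 'v::ab_group_add \<Rightarrow> 'v" and n L E F K K' i v +
  assumes i: "i \<in> {1..n}"
begin

lemma op_linear:
  assumes "j \<in> {1..n}" "op \<in> {E j, F j, K j, K' j}"
  shows "x \<in> L \<Longrightarrow> y \<in> L \<Longrightarrow> op (x + y) = op x + op y"
    and "x \<in> L \<Longrightarrow> op (scale c x) = scale c (op x)" and "op 0 = 0"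
proof -
  show 1: "x \<in> L \<Longrightarrow> y \<in> L \<Longrightarrow> op (x + y) = op x + op y"
    and 2: "x \<in> L \<Longrightarrow> op (scale c x) = scale c (op x)" for x y c
    using linear[OF assms] by (auto simp: linear_on_space_def)
  show "op 0 = 0" using 2[OF subspace_0[OF subspace_L], of 0] by simp
qed

lemma op_sum:
  assumes "j \<in> {1..n}" "op \<in> {E j, F j, K j, K' j}" "\<And>a. a \<in> A \<Longrightarrow> f a \<in> L"
  shows "op (sum f A) = (\<Sum>a\<in>A. op (f a))"
  using assms(3)
proof (induction A rule: infinite_finite_induct)
  case (insert a A)
  then have "sum f A \<in> L" by (intro subspace_sum[OF subspace_L]) auto
  with insert show ?case by (simp add: op_linear(1)[OF assms(1,2)])
qed (simp_all add: op_linear(3)[OF assms(1,2)])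

lemma hw: "v \<in> L" "v \<noteq> 0" "j \<in> {1..n} \<Longrightarrow> E j v = 0"
  "j \<in> {1..n} \<Longrightarrow> K j v = scale (qpow (of_int (if i = j then 1 else 0))) v"
  using highest_weight i by (auto simp: highest_weight_vector_def form_fund_simple)

lemma K_F_comm:
  assumes "j \<in> {1..n}" "k \<in> {1..n}" "x \<in> L"
  shows "K j (F k x) = scale (qpow (of_int (- cartan j k))) (F k (K j x))"
    and "K' j (F k x) = scale (qpow (of_int (cartan j k))) (F k (K' j x))"
proof -
  have L: "K j x \<in> L" "K' j x \<in> L" "F k x \<in> L" "F k (K' j x) \<in> L"
    using closed assms by blast+
  show "K j (F k x) = scale (qpow (of_int (- cartan j k))) (F k (K j x))"
    using K_F[OF assms(1,2) L(1)] K_inv(2)[OF assms(1,3)] by simp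
  have "F k (K' j x) = K' j (K j (F k (K' j x)))" using K_inv(2)[OF assms(1) L(4)] by simp
  also have "\<dots> = scale (qpow (of_int (- cartan j k))) (K' j (F k x))"
    using assms L by (simp add: K_F op_linear(2)[of j "K' j"])
  finally have "scale (qpow (of_int (cartan j k))) (F k (K' j x)) =
     scale (qpow (of_int (cartan j k + - cartan j k))) (K' j (F k x))"
    by (simp only: qpow_of_int_add scale_scale)
  then show "K' j (F k x) = scale (qpow (of_int (cartan j k))) (F k (K' j x))" by simp
qed

text \<open>The submodule of \<open>L \<oplus> wedge\<close> generated by the pair of highest weight vectors; it turns out to
  be the graph of an isomorphism.\<close>

inductive graph :: "'v \<Rightarrow> wedge \<Rightarrow> bool" where
  base: "graph v (wedge_basis {1..i})"
| F: "graph x m \<Longrightarrow> j \<in> {1..n} \<Longrightarrow> graph (F j x) (wedge_f j m)"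
| add: "graph x m \<Longrightarrow> graph y m' \<Longrightarrow> graph (x + y) (\<lambda>S. m S + m' S)"
| scale: "graph x m \<Longrightarrow> graph (scale c x) (\<lambda>S. c * m S)"

lemma graph_L: "graph x m \<Longrightarrow> x \<in> L"
  by (induction rule: graph.induct)
    (use closed subspace_add[OF subspace_L] subspace_scale[OF subspace_L] hw(1) in auto)

lemma graph_zero: "graph 0 (\<lambda>S. 0)"
  using graph.scale[OF graph.base, of 0] by simp

lemma graph_diff: "graph x m \<Longrightarrow> graph y m' \<Longrightarrow> graph (x - y) (\<lambda>S. m S - m' S)"
  using graph.add[OF _ graph.scale[of y m' "-1"], of x m] by simp

lemma hpair_raise: "raisable k S \<Longrightarrow> hpair j (raise k S) = hpair j S + cartan j k"
  by (auto simp: hpair_def raise_def raisable_def cartan_def)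

lemma wedge_k_f: "wedge_k \<epsilon> j (wedge_f k m) = (\<lambda>S. qpow (of_int (- \<epsilon> * cartan j k)) * wedge_f k (wedge_k \<epsilon> j m) S)"
proof
  fix S
  have "qpow (of_int (\<epsilon> * hpair j S)) = qpow (of_int (- \<epsilon> * cartan j k)) * qpow (of_int (\<epsilon> * hpair j (raise k S)))"
    if "raisable k S"
    unfolding qpow_of_int_add[symmetric] hpair_raise[OF that] by (simp add: algebra_simps)
  then show "wedge_k \<epsilon> j (wedge_f k m) S = qpow (of_int (- \<epsilon> * cartan j k)) * wedge_f k (wedge_k \<epsilon> j m) S"
    by (simp add: wedge_k_def wedge_f_def)
qed

lemma wedge_k_basis: "j \<ge> 1 \<Longrightarrow> wedge_k \<epsilon> j (wedge_basis {1..i}) =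
    (\<lambda>S. qpow (of_int (if i = j then \<epsilon> else 0)) * wedge_basis {1..i} S)"
  by (auto simp: wedge_k_def wedge_basis_def hpair_def fun_eq_iff)

lemma graph_K: "graph x m \<Longrightarrow> j \<in> {1..n} \<Longrightarrow> graph (K j x) (wedge_k 1 j m)"
proof (induction rule: graph.induct)
  case base
  then have "j \<ge> 1" by simp
  show ?case
    unfolding wedge_k_basis[OF \<open>j \<ge> 1\<close>] hw(4)[OF base] by (rule graph.scale[OF graph.base])
next
  case (F x m k)
  from graph.scale[OF graph.F[OF F.IH[OF F.prems] F.hyps(2)], of "qpow (of_int (- 1 * cartan j k))"]
  show ?case using F K_F_comm(1) graph_L by (simp only: wedge_k_f) simp
next
  case (add x m y m')
  then show ?case using graph.add[OF add.IH] graph_L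
    by (simp add: op_linear(1)[of j "K j"] wedge_k_def distrib_left)
next
  case (scale x m c)
  then show ?case using graph.scale[OF scale.IH, of c] graph_L
    by (simp add: op_linear(2)[of j "K j"] wedge_k_def mult.left_commute)
qed

lemma graph_K': "graph x m \<Longrightarrow> j \<in> {1..n} \<Longrightarrow> graph (K' j x) (wedge_k (-1) j m)"
proof (induction rule: graph.induct)
  case base
  let ?\<delta> = "if i = j then 1 else 0 :: int"
  have "v = scale (qpow (of_int ?\<delta>)) (K' j v)"
    using K_inv(2)[OF base hw(1)] hw(1) base by (simp add: hw(4) op_linear(2)[of j "K' j"])
  then have "scale (qpow (of_int (- ?\<delta>))) v = scale (qpow (of_int (- ?\<delta> + ?\<delta>))) (K' j v)"
    by (metis qpow_of_int_add scale_scale)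
  then have "K' j v = scale (qpow (of_int (- ?\<delta>))) v" by simp
  also have "- ?\<delta> = (if i = j then -1 else 0)" by simp
  finally have K'v: "K' j v = scale (qpow (of_int (if i = j then -1 else 0))) v" .
  have "j \<ge> 1" using base by simp
  show ?case
    unfolding wedge_k_basis[OF \<open>j \<ge> 1\<close>] K'v by (rule graph.scale[OF graph.base])
next
  case (F x m k)
  from graph.scale[OF graph.F[OF F.IH[OF F.prems] F.hyps(2)], of "qpow (of_int (- (-1) * cartan j k))"]
  show ?case using F K_F_comm(2) graph_L by (simp only: wedge_k_f) simp
next
  case (add x m y m')
  then show ?case using graph.add[OF add.IH] graph_L
    by (simp add: op_linear(1)[of j "K' j"] wedge_k_def distrib_left)
next
  case (scale x m c)
  then show ?case using graph.scale[OF scale.IH, of c] graph_L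
    by (simp add: op_linear(2)[of j "K' j"] wedge_k_def mult.left_commute)
qed

text \<open>The generation uses F only. An E is moved to the right past each F at the cost of the K
  terms of \<open>graph_K\<close> and \<open>graph_K'\<close>, until it kills both highest weight
  vectors.\<close>

lemma graph_E: "graph x m \<Longrightarrow> j \<in> {1..n} \<Longrightarrow> graph (E j x) (wedge_e j m)"
proof (induction rule: graph.induct)
  case base
  \<comment> \<open>A lowered set contains j + 1 but not j, which is impossible for {1..i} because j
    >= 1.\<close>
  have "lower j S \<noteq> {1..i}" if "lowerable j S" for S
  proof
    assume "lower j S = {1..i}"
    moreover have "j \<notin> lower j S" "Suc j \<in> lower j S" using that by (auto simp: lower_def lowerable_def)
    ultimately show False using base by auto
  qed
  then have "wedge_e j (wedge_basis {1..i}) = (\<lambda>S. 0)"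
    by (auto simp: wedge_e_def wedge_basis_def)
  then show ?case using graph_zero base by (simp add: hw)
next
  case (F x m k)
  have xL: "x \<in> L" using F.hyps graph_L by blast
  have EF: "E j (F k x) = F k (E j x) + (if j = k then scale (1 / (qpow 1 - qpow (-1))) (K j x - K' j x) else 0)"
    using E_F[OF F.prems F.hyps(2) xL] by (simp add: algebra_simps)
  have 1: "graph (F k (E j x)) (wedge_f k (wedge_e j m))"
    using graph.F[OF F.IH[OF F.prems] F.hyps(2)] .
  show ?case
  proof (cases "j = k")
    case True
    from graph.add[OF 1 graph.scale[OF graph_diff[OF graph_K[OF F.hyps(1) F.prems] graph_K'[OF F.hyps(1) F.prems]]],
      of "1 / (qpow 1 - qpow (-1))"]
    show ?thesis unfolding EF wedge_e_f using True by simp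
  next
    case False
    then show ?thesis unfolding EF wedge_e_f using 1 by simp
  qed
next
  case (add x m y m')
  then have "wedge_e j (\<lambda>S. m S + m' S) = (\<lambda>S. wedge_e j m S + wedge_e j m' S)"
    by (auto simp: wedge_e_def)
  then show ?case using add graph.add[OF add.IH] graph_L
    by (simp add: op_linear(1)[of j "E j"])
next
  case (scale x m c)
  then have "wedge_e j (\<lambda>S. c * m S) = (\<lambda>S. c * wedge_e j m S)"
    by (auto simp: wedge_e_def)
  then show ?case using scale graph.scale[OF scale.IH, of c] graph_L
    by (simp add: op_linear(2)[of j "E j"])
qed

text \<open>Vectors of weight \<open>\<lambda>\<^sub>i - \<Sum> m\<^sub>k \<alpha>\<^sub>k\<close>.\<close>

definition weight_vector :: "(nat \<Rightarrow> nat) \<Rightarrow> 'v \<Rightarrow> bool" where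
  "weight_vector m x \<longleftrightarrow> x \<in> L \<and> (\<forall>j\<in>{1..n}.
     K j x = scale (qpow (of_int ((if i = j then 1 else 0) - (\<Sum>k=1..n. cartan k j * int (m k))))) x)"

definition lower_vectors :: "'v set" where
  "lower_vectors = {x. \<exists>m. weight_vector m x \<and> (\<exists>k\<in>{1..n}. m k \<noteq> 0)}"

lemma weight_vector_F:
  assumes "weight_vector m x" "l \<in> {1..n}"
  shows "weight_vector (m(l := Suc (m l))) (F l x)"
proof -
  have xL: "x \<in> L" using assms by (simp add: weight_vector_def)
  have sum: "(\<Sum>k=1..n. cartan k j * int ((m(l := Suc (m l))) k)) = (\<Sum>k=1..n. cartan k j * int (m k)) + cartan l j" for j
  proof -
    have "(\<Sum>k=1..n. cartan k j * int ((m(l := Suc (m l))) k)) =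
        (\<Sum>k=1..n. cartan k j * int (m k) + (if k = l then cartan k j else 0))"
      by (intro sum.cong) (auto simp: algebra_simps)
    then show ?thesis using assms(2) by (simp add: sum.distrib sum.delta)
  qed
  have "K j (F l x) = scale (qpow (of_int ((if i = j then 1 else 0) -
      (\<Sum>k=1..n. cartan k j * int ((m(l := Suc (m l))) k))))) (F l x)" if j: "j \<in> {1..n}" for j
  proof -
    have "cartan j l = cartan l j" by (auto simp: cartan_def)
    then have e: "(if i = j then 1 else 0) - ((\<Sum>k=1..n. cartan k j * int (m k)) + cartan l j) =
       - cartan j l + ((if i = j then 1 else 0) - (\<Sum>k=1..n. cartan k j * int (m k)))" by simp
    have "K j x = scale (qpow (of_int ((if i = j then 1 else 0) - (\<Sum>k=1..n. cartan k j * int (m k))))) x"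
      using assms j by (simp add: weight_vector_def)
    then show ?thesis
      unfolding K_F_comm(1)[OF j assms(2) xL] sum e qpow_of_int_add
      using assms(2) xL by (simp add: op_linear(2)[of l "F l"])
  qed
  then show ?thesis using closed[OF assms(2)] xL by (simp add: weight_vector_def)
qed

lemma weight_vector_v: "weight_vector (\<lambda>_. 0) v"
  by (simp add: weight_vector_def hw)

lemma lower_vectors_F: "x \<in> lower_vectors \<Longrightarrow> l \<in> {1..n} \<Longrightarrow> F l x \<in> lower_vectors"
  unfolding lower_vectors_def using weight_vector_F by fastforce

lemma F_v_lower: "l \<in> {1..n} \<Longrightarrow> F l v \<in> lower_vectors"
  unfolding lower_vectors_def using weight_vector_F[OF weight_vector_v] by fastforce

lemma lower_vectors_L: "lower_vectors \<subseteq> L"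
  by (auto simp: lower_vectors_def weight_vector_def)

lemma span_lower_L: "span lower_vectors \<subseteq> L"
  by (rule span_minimal[OF lower_vectors_L subspace_L])

lemma span_lower_F:
  assumes "y \<in> span lower_vectors" "l \<in> {1..n}"
  shows "F l y \<in> span lower_vectors"
proof -
  have "y \<in> L \<and> F l y \<in> span lower_vectors"
    using assms(1)
  proof (induction rule: span_induct_alt)
    case base
    then show ?case using assms(2) subspace_0[OF subspace_L] by (simp add: op_linear(3)[of l "F l"] span_zero)
  next
    case (step c x y)
    have L: "x \<in> L" "y \<in> L" "scale c x \<in> L"
      using step lower_vectors_L subspace_scale[OF subspace_L] by auto
    have "F l (scale c x + y) = scale c (F l x) + F l y"
      using L assms(2) by (simp add: op_linear(1,2)[of l "F l"])
    then show ?case using step lower_vectors_F[OF _ assms(2)] L subspace_add[OF subspace_L]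
      by (simp add: span_add span_scale span_base)
  qed
  then show ?thesis ..
qed

text \<open>Subtracting an eigenvalue of a suitable \<open>K j\<close> removes one summand and rescales \<open>v\<close> by a nonzero
  factor.\<close>

lemma lower_independent:
  assumes "finite A" "A \<subseteq> lower_vectors" "(\<Sum>a\<in>A. scale (u a) a) = scale c v"
  shows "c = 0"
  using assms
proof (induction A arbitrary: u c rule: finite_induct)
  case empty
  then show ?case using hw(2) by simp
next
  case (insert a A)
  obtain m k where m: "weight_vector m a" "k \<in> {1..n}" "m k \<noteq> 0"
    using insert.prems(1) by (auto simp: lower_vectors_def)
  obtain j where j: "j \<in> {1..n}" "(\<Sum>k=1..n. cartan k j * int (m k)) \<noteq> 0"
    using cartan_nondegenerate[of k n m] m(2,3) by auto
  let ?s0 = "qpow (of_int (if i = j then 1 else 0))"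
  let ?s1 = "qpow (of_int ((if i = j then 1 else 0) - (\<Sum>k=1..n. cartan k j * int (m k))))"
  have ne: "?s0 \<noteq> ?s1" using j(2) by (simp only: qpow_of_int_inj)
  have AL: "b \<in> L" if "b \<in> insert a A" for b using insert.prems(1) lower_vectors_L that by blast
  have "\<forall>b\<in>insert a A. \<exists>s. K j b = scale s b"
    using insert.prems(1) j(1) by (auto simp: lower_vectors_def weight_vector_def)
  then obtain s where s: "\<And>b. b \<in> insert a A \<Longrightarrow> K j b = scale (s b) b" by metis
  have Ka: "K j a = scale ?s1 a" using m(1) j(1) by (simp add: weight_vector_def)
  have "K j (\<Sum>b\<in>insert a A. scale (u b) b) = (\<Sum>b\<in>insert a A. K j (scale (u b) b))"
    using j(1) AL subspace_scale[OF subspace_L] by (intro op_sum[of j]) auto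
  also have "\<dots> = K j (scale (u a) a) + (\<Sum>b\<in>A. K j (scale (u b) b))"
    using insert.hyps by simp
  also have "\<dots> = scale (u a * ?s1) a + (\<Sum>b\<in>A. scale (u b * s b) b)"
    using j(1) AL s Ka by (simp add: op_linear(2)[of j "K j"])
  finally have 1: "scale (c * ?s0) v = scale (u a * ?s1) a + (\<Sum>b\<in>A. scale (u b * s b) b)"
    using insert.prems(2) j(1) hw by (simp add: op_linear(2)[of j "K j"])
  have "scale (?s1 * c) v = scale ?s1 (\<Sum>b\<in>insert a A. scale (u b) b)"
    using insert.prems(2) by simp
  also have "\<dots> = scale (u a * ?s1) a + (\<Sum>b\<in>A. scale (?s1 * u b) b)"
    using insert.hyps by (simp add: scale_right_distrib scale_sum_right mult.commute)
  finally have "scale (c * ?s0) v - scale (?s1 * c) v = (\<Sum>b\<in>A. scale (u b * s b) b) - (\<Sum>b\<in>A. scale (?s1 * u b) b)"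
    unfolding 1 by simp
  then have "(\<Sum>b\<in>A. scale (u b * s b - ?s1 * u b) b) = scale (c * ?s0 - ?s1 * c) v"
    by (simp add: scale_left_diff_distrib sum_subtractf)
  then have "c * ?s0 - ?s1 * c = 0"
    using insert.prems(1) by (intro insert.IH) auto
  then have "c * (?s0 - ?s1) = 0" by (simp add: algebra_simps)
  then show "c = 0" using ne by simp
qed

lemma span_lower_v: "scale c v \<in> span lower_vectors \<Longrightarrow> c = 0"
  unfolding span_explicit using lower_independent by auto

text \<open>F lowers weights, and correspondingly {1..i} is never the result of a lowering, so its
  coordinate after F is 0. That coordinate thus measures the coefficient of v modulo lower
  weights.\<close>

lemma graph_decompose: "graph x m \<Longrightarrow> \<exists>y\<in>span lower_vectors. x = scale (m {1..i}) v + y"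
proof (induction rule: graph.induct)
  case base
  then show ?case by (intro bexI[of _ 0]) (simp_all add: wedge_basis_def span_zero)
next
  case (F x m j)
  then obtain y where y: "y \<in> span lower_vectors" "x = scale (m {1..i}) v + y" by blast
  have "\<not> raisable j {1..i}" using F(2) by (auto simp: raisable_def)
  then have 0: "wedge_f j m {1..i} = 0" by (simp add: wedge_f_def)
  have "F j x = scale (m {1..i}) (F j v) + F j y"
    using F(2) hw(1) y span_lower_L subspace_scale[OF subspace_L]
    by (auto simp: op_linear(1,2)[of j "F j"])
  also have "\<dots> \<in> span lower_vectors"
    using F_v_lower[OF F(2)] span_lower_F[OF y(1) F(2)] by (simp add: span_add span_scale span_base)
  finally show ?case
    by (intro bexI[of _ "F j x"]) (simp_all only: 0 scale_zero_left add_0_left)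
next
  case (add x m y m')
  then obtain z z' where "z \<in> span lower_vectors" "x = scale (m {1..i}) v + z"
    "z' \<in> span lower_vectors" "y = scale (m' {1..i}) v + z'" by blast
  then show ?case by (intro bexI[of _ "z + z'"]) (simp_all add: scale_left_distrib span_add algebra_simps)
next
  case (scale x m c)
  then obtain z where "z \<in> span lower_vectors" "x = scale (m {1..i}) v + z" by blast
  then show ?case by (intro bexI[of _ "scale c z"]) (simp_all add: scale_right_distrib span_scale)
qed

text \<open>The fibre over 0 is a submodule. It misses v, which would otherwise lie in the span of
  the lower weight vectors, so irreducibility leaves only 0.\<close>

lemma graph_kernel:
  assumes "graph x (\<lambda>S. 0)" shows "x = 0"
proof -
  define J where "J = {x. graph x (\<lambda>S. 0)}"
  have "v \<notin> J"
  proof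
    assume "v \<in> J"
    then obtain y where "y \<in> span lower_vectors" "v = y"
      using graph_decompose[of v "\<lambda>S. 0"] by (auto simp: J_def)
    then show False using span_lower_v[of 1] by simp
  qed
  moreover have "submodule J"
    unfolding submodule_def
  proof (intro conjI ballI)
    show "subspace J"
      unfolding subspace_def J_def using graph_zero graph.add[of _ "\<lambda>S. 0" _ "\<lambda>S. 0"] graph.scale[of _ "\<lambda>S. 0"] by auto
    show "J \<subseteq> L" using graph_L by (auto simp: J_def)
    fix j x assume j: "j \<in> {1..n}" and "x \<in> J"
    then have x: "graph x (\<lambda>S. 0)" by (simp add: J_def)
    show "E j x \<in> J" using graph_E[OF x j] by (simp add: J_def wedge_e_def)
    show "F j x \<in> J" using graph.F[OF x j] by (simp add: J_def wedge_f_def)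
    show "K j x \<in> J" using graph_K[OF x j] by (simp add: J_def wedge_k_def)
    show "K' j x \<in> J" using graph_K'[OF x j] by (simp add: J_def wedge_k_def)
  qed
  ultimately have "J = {0}" using irreducible hw(1) unfolding irreducible_module_def by blast
  then show ?thesis using assms by (auto simp: J_def)
qed

lemma graph_unique: "graph x m \<Longrightarrow> graph y m \<Longrightarrow> x = y"
  using graph_kernel[of "x - y"] graph_diff[of x m y m] by simp

lemma wedge_f_basis:
  "wedge_f j (wedge_basis S) = (if lowerable j S then wedge_basis (lower j S) else (\<lambda>S. 0))"
  by (auto simp: wedge_f_def wedge_basis_def fun_eq_iff raisable_def raise_def lowerable_def lower_def)

lemma wedge_e_basis:
  "wedge_e j (wedge_basis S) = (if raisable j S then wedge_basis (raise j S) else (\<lambda>S. 0))"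
  by (auto simp: wedge_e_def wedge_basis_def fun_eq_iff raisable_def raise_def lowerable_def lower_def)

text \<open>E j undoes F j on a lowerable basis vector, so F j x = 0 would force x = 0.\<close>

lemma F_basis_step:
  assumes "graph x (wedge_basis S)" "x \<noteq> 0" "j \<in> {1..n}" "lowerable j S"
  shows "graph (F j x) (wedge_basis (lower j S)) \<and> F j x \<noteq> 0"
proof
  show g: "graph (F j x) (wedge_basis (lower j S))"
    using graph.F[OF assms(1,3)] assms(4) by (simp add: wedge_f_basis)
  have "raisable j (lower j S)" "raise j (lower j S) = S"
    using assms(4) by (auto simp: raisable_def raise_def lowerable_def lower_def)
  then have "graph (E j (F j x)) (wedge_basis S)"
    using graph_E[OF g assms(3)] by (simp add: wedge_e_basis)
  then have "E j (F j x) = x" using assms(1) graph_unique by blast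
  then show "F j x \<noteq> 0" using assms(2,3) op_linear(3)[of j "E j"] by auto
qed

lemma F_basis_zero:
  assumes "graph x (wedge_basis S)" "j \<in> {1..n}" "\<not> lowerable j S"
  shows "F j x = 0"
  using graph.F[OF assms(1,2)] assms(3) graph_kernel by (simp add: wedge_f_basis)

text \<open>If S is raisable, F j undoes E j; otherwise E j x lies over 0 and
  \<open>graph_kernel\<close> applies.\<close>

lemma E_basis_nonzero_iff:
  assumes "graph x (wedge_basis S)" "x \<noteq> 0" "j \<in> {1..n}"
  shows "E j x \<noteq> 0 \<longleftrightarrow> raisable j S"
proof
  assume "raisable j S"
  then have "graph (E j x) (wedge_basis (raise j S))" "lowerable j (raise j S)" "lower j (raise j S) = S"
    using graph_E[OF assms(1,3)] by (auto simp: wedge_e_basis raisable_def raise_def lowerable_def lower_def)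
  then have "graph (F j (E j x)) (wedge_basis S)"
    using graph.F[OF _ assms(3)] by (metis wedge_f_basis)
  then have "F j (E j x) = x" using assms(1) graph_unique by blast
  then show "E j x \<noteq> 0" using assms(2,3) op_linear(3)[of j "F j"] by auto
next
  assume "E j x \<noteq> 0"
  then show "raisable j S"
    using graph_E[OF assms(1,3)] graph_kernel by (auto simp: wedge_e_basis split: if_splits)
qed

end

section \<open>Comparison of the two actions\<close>

text \<open>The exponentials start at mode 1. The restriction to r >= 1 matters, since
  \<open>heis\<close> at index 0 is a derivation and no creation operator.\<close>

lemma vertex_op_cong:
  assumes "\<And>r p. r \<ge> 1 \<Longrightarrow> C r p = C' r p" "\<And>r p. r \<ge> 1 \<Longrightarrow> A r p = A' r p"
  shows "vertex_op n C A \<gamma> \<chi> = vertex_op n C' A' \<gamma> \<chi>"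
proof -
  have "op_exp C = op_exp C'" "op_exp A = op_exp A'"
    by (intro ext op_exp_cong assms; assumption)+
  then show ?thesis unfolding vertex_op_def[abs_def] by simp
qed

text \<open>The commutator of a_j(r) with a_l(-r), for r > 0.\<close>

definition heis_bracket :: "nat \<Rightarrow> nat \<Rightarrow> nat \<Rightarrow> qfield" where
  "heis_bracket j l r = qint (cartan j l * int r) * qint (int r) / of_nat r"

lemma heis_neg: "r \<ge> 1 \<Longrightarrow> heis j (- int r) p = fvar (j, r) * p"
  by (simp add: heis_def)

lemma heis_pos: "heis j (int r) p = annih (heis_bracket j) r p"
  unfolding heis_def annih_def heis_bracket_def
  by (auto intro!: arg_cong[of _ _ "\<lambda>f. fock_deriv f p"] simp: fun_eq_iff)

definition single_mode :: "nat \<Rightarrow> (nat \<Rightarrow> qfield) \<Rightarrow> nat \<Rightarrow> nat \<Rightarrow> qfield" where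
  "single_mode j k l r = (if l = j then k r else 0)"

lemma creation_single_mode:
  assumes "j \<in> {1..n}" "r \<ge> 1"
  shows "fscale (k r) (heis j (- int r) p) = creation n (single_mode j k) r p"
proof -
  have "(\<Sum>l=1..n. fconst (single_mode j k l r) * fvar (l, r)) = (\<Sum>l=1..n. if l = j then fconst (k r) * fvar (l, r) else 0)"
    by (intro sum.cong) (auto simp: single_mode_def fconst_simps)
  also have "\<dots> = fconst (k r) * fvar (j, r)" using assms by (simp add: sum.delta)
  finally show ?thesis by (simp add: creation_def fscale_def heis_neg[OF assms(2)] mult.assoc)
qed

lemma fscale_heis_pos: "fscale (k r) (heis j (int r) p) = annih (\<lambda>l r. k r * heis_bracket j l r) r p"
  by (simp add: annih_scale heis_pos fscale_def)

abbreviation "plus_mode r \<equiv> qpow (- of_nat r / 2) / qint (int r)"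

abbreviation "minus_mode r \<equiv> qpow (of_nat r / 2) / qint (int r)"

lemma x_plus_vop:
  assumes "j \<in> {1..n}"
  shows "x_plus n j = vop n (single_mode j plus_mode)
    (\<lambda>l r. - plus_mode r * heis_bracket j l r) (simple_root n j) (\<lambda>_. 1)"
  unfolding x_plus_def vop_def o_def
  by (rule vertex_op_cong)
    (rule creation_single_mode[OF assms, where k = "\<lambda>r. plus_mode r"], assumption,
     rule fscale_heis_pos[where k = "\<lambda>r. - plus_mode r"])

lemma x_minus_vop:
  assumes "j \<in> {1..n}"
  shows "x_minus n j = vop n (single_mode j (\<lambda>r. - minus_mode r))
    (\<lambda>l r. minus_mode r * heis_bracket j l r) (- simple_root n j) (\<lambda>_. 1)"
  unfolding x_minus_def vop_def o_def
  by (rule vertex_op_cong)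
    (rule creation_single_mode[OF assms, where k = "\<lambda>r. - minus_mode r"], assumption,
     rule fscale_heis_pos[where k = "\<lambda>r. minus_mode r"])

lemma annih_zero: "annih (\<lambda>l r. 0) r p = 0"
  using annih_scale[of "\<lambda>_. 0" "\<lambda>l r. 0" r p] by (simp add: fconst_simps)

lemma annih_sum: "annih (\<lambda>l r. \<Sum>j\<in>A. d j l r) r p = (\<Sum>j\<in>A. annih (d j) r p)"
proof (induction A rule: infinite_finite_induct)
  case (insert x A)
  then show ?case using annih_add[of "d x" "\<lambda>l r. \<Sum>j\<in>A. d j l r" r p] by simp
qed (simp_all add: annih_zero)

text \<open>Contractions see only the creation modes of the right factor, so these are explicit,
  while the annihilation modes and the character are merely asserted to exist.\<close>

lemma Y_op_vop:
  obtains d \<chi> where "Y_op n i = vop n (\<lambda>l r. minus_mode r * dual_coeff n i l (- int r)) d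
      (fund_weight i) \<chi>" "\<chi> 0 \<noteq> 0"
proof
  let ?\<chi> = "\<lambda>\<beta>. qconst (exp (of_real pi * \<i> *
        (of_nat (if i = n then 0 else i) * of_rat (form n (fund_weight n) \<beta>))))"
  let ?d = "\<lambda>l r. \<Sum>j=1..n. - minus_mode r * dual_coeff n i j (int r) * heis_bracket j l r"
  show "Y_op n i = vop n (\<lambda>l r. minus_mode r * dual_coeff n i l (- int r)) ?d (fund_weight i) ?\<chi>"
    unfolding Y_op_def vop_def o_def
  proof (rule vertex_op_cong)
    fix r :: nat and p assume r: "r \<ge> 1"
    show "fscale (minus_mode r) (heis_dual n i (- int r) p) =
      creation n (\<lambda>l r. minus_mode r * dual_coeff n i l (- int r)) r p"
      unfolding heis_dual_def creation_def fscale_def heis_neg[OF r] fconst_simps(4) sum_distrib_left sum_distrib_right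
      by (simp only: mult.assoc)
    show "fscale (- minus_mode r) (heis_dual n i (int r) p) = annih ?d r p"
      unfolding annih_sum heis_dual_def fscale_def heis_pos sum_distrib_left mult.assoc[symmetric] fconst_simps(4)[symmetric]
      by (intro sum.cong refl) (rule annih_scale[symmetric, where k = "\<lambda>r. - minus_mode r * dual_coeff n i _ (int r)"])
  qed
  have "qconst c \<noteq> 0" if "c \<noteq> 0" for c
    using that by (simp add: qconst_def Zero_fract_def eq_fract)
  then show "?\<chi> 0 \<noteq> 0" by simp
qed

section \<open>Quantum integers and the inverse of the q-Cartan matrix\<close>

lemma qint_minus: "qint (- m) = - qint m"
  by (simp only: qint_def of_int_minus minus_minus minus_divide_left minus_diff_eq)

lemma qint_nonzero: "m \<noteq> 0 \<Longrightarrow> qint m \<noteq> 0"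
  using qpow_of_int_inj[of m "- m"] q_diff_nonzero by (simp add: qint_def)

lemma qpow_of_int_minus: "qpow (- of_int m) = 1 / qpow (of_int m)"
  using qpow_of_int_add[of m "- m"] by (simp add: field_simps)

lemma qint_alt: "qint m = (qpow (of_int m) - 1 / qpow (of_int m)) / (qpow 1 - qpow (-1))"
  by (simp add: qint_def qpow_of_int_minus)

text \<open>The q-analogue of (a + 1)(b + 1) - a b = a + b + 1; for a = 1 it is the three-term
  recurrence of [m r] in m.\<close>

lemma qint_determinant: "qint ((a + 1) * r) * qint ((b + 1) * r) - qint (a * r) * qint (b * r) = qint ((a + b + 1) * r) * qint r"
proof -
  have 1: "qpow (of_int ((m + 1) * r)) = qpow (of_int (m * r)) * qpow (of_int r)" for m
    unfolding qpow_of_int_add[symmetric] by (simp add: algebra_simps)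
  have 2: "qpow (of_int ((a + b) * r)) = qpow (of_int (a * r)) * qpow (of_int (b * r))"
    unfolding qpow_of_int_add[symmetric] by (simp add: algebra_simps)
  show ?thesis
    unfolding qint_alt 1 2 using q_diff_nonzero by (simp add: divide_simps) (simp add: algebra_simps)
qed

lemma qint_recurrence: "qint (2 * r) * qint (m * r) = qint r * (qint ((m - 1) * r) + qint ((m + 1) * r))"
  using qint_determinant[of 1 r "m - 1"] by (simp add: algebra_simps)

lemma sum_qint_cartan:
  assumes "j \<in> {1..n}" "g 0 = 0" "g (Suc n) = 0"
  shows "(\<Sum>b=1..n. qint (cartan j b * r) * g b) = qint (2 * r) * g j - qint r * (g (j - 1) + g (Suc j))"
proof -
  have "(\<Sum>b=1..n. qint (cartan j b * r) * g b) = (\<Sum>b\<in>{0..Suc n}. qint (cartan j b * r) * g b)"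
    using assms(2,3) by (intro sum.mono_neutral_left) (auto simp: not_le le_Suc_eq)
  also have "\<dots> = (\<Sum>b\<in>{j - 1, j, Suc j}. qint (cartan j b * r) * g b)"
    using assms(1) by (intro sum.mono_neutral_right) (auto simp: cartan_def qint_simps)
  also have "\<dots> = qint (2 * r) * g j - qint r * (g (j - 1) + g (Suc j))"
    using assms(1) by (cases j) (auto simp: cartan_def qint_minus algebra_simps)
  finally show ?thesis .
qed

text \<open>The coefficients form a discrete Green's function. As functions of l both branches solve
  \<open>qint_recurrence\<close>, they vanish at l = 0 and l = n + 1, and where they meet, at l = i,
  the jump is given by \<open>qint_determinant\<close>.\<close>

lemma dual_coeff_cartan:
  assumes i: "i \<in> {1..n}" and k: "k \<in> {1..n}" and r: "r \<noteq> 0"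
  shows "(\<Sum>l=1..n. qint (cartan k l * r) * dual_coeff n i l (- r)) = (if k = i then qint r else 0)"
proof -
  define B where "B m = qint (m * r)" for m
  have B1: "B 1 = qint r" "B 2 = qint (2 * r)" by (simp_all add: B_def)
  have nz: "B (int n + 1) \<noteq> 0" "B 1 \<noteq> 0" using r by (auto simp: B_def intro!: qint_nonzero)
  have rec: "B 2 * B m = B 1 * (B (m - 1) + B (m + 1))" for m
    using qint_recurrence[of r m] by (simp add: B_def)
  let ?lhs = "B 2 * dual_coeff n i k (- r) - B 1 * (dual_coeff n i (k - 1) (- r) + dual_coeff n i (Suc k) (- r))"
  define D where "D = B (int n + 1) * B 1"
  have D: "D \<noteq> 0" using nz by (simp add: D_def)
  have dc: "dual_coeff n i l (- r) = (if l \<le> i then B (int l) * B (int n - int i + 1) else B (int i) * B (int n - int l + 1)) / D" for l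
    by (simp add: dual_coeff_def B_def D_def qint_minus)
  have dc': "dual_coeff n i l (- r) = B (int i) * B (int n - int l + 1) / D" if "l \<ge> i" for l
    using that by (auto simp: dc)
  have "(\<Sum>l=1..n. qint (cartan k l * r) * dual_coeff n i l (- r)) =
     ?lhs"
    unfolding B1 using i by (intro sum_qint_cartan[OF k]) (auto simp: dc B_def qint_simps)
  also have "\<dots> = (if k = i then B 1 else 0)"
  proof (cases k i rule: linorder_cases)
    case less
    have "int (k - 1) = int k - 1" using k by auto
    then have "?lhs
       = (B 2 * B (int k) - B 1 * (B (int k - 1) + B (int k + 1))) * B (int n - int i + 1) / D"
      using less D by (simp add: dc field_simps)
    then show ?thesis using less rec[of "int k"] by simp
  next
    case greater
    have "int (k - 1) = int k - 1" using k by auto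
    then have "?lhs
       = (B 2 * B (int n - int k + 1) - B 1 * (B (int n - int k + 1 - 1) + B (int n - int k + 1 + 1))) * B (int i) / D"
      using greater D by (simp add: dc' field_simps)
    then show ?thesis using greater rec[of "int n - int k + 1"] by simp
  next
    case equal
    have int: "int (k - 1) = int k - 1" using k by auto
    have det: "B (int i + 1) * B (int n - int i + 1) - B (int i) * B (int n - int i) = D"
      using qint_determinant[of "int i" r "int n - int i"] by (simp add: B_def D_def)
    have "?lhs
       = (B 2 * B (int i) * B (int n - int i + 1) - B 1 * (B (int i - 1) * B (int n - int i + 1) + B (int i) * B (int n - int i))) / D"
      using equal D int by (simp add: dc field_simps)
    also have "\<dots> = B 1 * (B (int i + 1) * B (int n - int i + 1) - B (int i) * B (int n - int i)) / D"
      unfolding rec by (simp add: algebra_simps)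
    finally show ?thesis using equal D by (simp add: det)
  qed
  finally show ?thesis by (simp add: B1)
qed

text \<open>Up to the factor [r]/r this is the bracket of a_k(r) with the creation part c: all that
  contractions with x_k^+ and x_k^- see of c.\<close>

definition cartan_pairing :: "nat \<Rightarrow> modes \<Rightarrow> nat \<Rightarrow> nat \<Rightarrow> qfield" where
  "cartan_pairing n c k r = (\<Sum>l=1..n. qint (cartan k l * int r) * c l r)"

text \<open>The exponent of \<open>q\<close> attached to the position \<open>p\<close> of a subset \<open>S\<close>: up to a shift, the sum of the
  coordinates of the box which \<open>f\<^sub>p\<close> adds to the Young diagram corresponding to \<open>S\<close>.\<close>

definition level :: "nat \<Rightarrow> nat set \<Rightarrow> nat \<Rightarrow> int" where
  "level i S p = int p - int i + 2 * int (card {s \<in> S. p < s})"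

text \<open>Replacing j by j + 1 changes the number of elements above p only for p = j.\<close>

lemma level_lower:
  assumes "lowerable j S" "p \<noteq> j" "finite S"
  shows "level i (lower j S) p = level i S p"
proof -
  have "card {s \<in> lower j S. p < s} = card {s \<in> S. p < s}"
  proof (cases "p < j")
    case True
    have "{s \<in> lower j S. p < s} = insert (Suc j) ({s \<in> S. p < s} - {j})"
      using True by (auto simp: lower_def)
    moreover have "j \<in> {s \<in> S. p < s}" "Suc j \<notin> {s \<in> S. p < s} - {j}"
      using True assms(1) by (auto simp: lowerable_def)
    moreover have "finite {s \<in> S. p < s}" using assms(3) by simp
    ultimately show ?thesis by (metis card_insert_disjoint card.remove finite_Diff)
  next
    case False
    then have "{s \<in> lower j S. p < s} = {s \<in> S. p < s}"
      using assms(2) by (auto simp: lower_def)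
    then show ?thesis by simp
  qed
  then show ?thesis by (simp add: level_def)
qed

lemma level_Suc:
  assumes "Suc p \<in> S" "finite S"
  shows "level i S p = level i S (Suc p) + 1"
proof -
  have "{s \<in> S. p < s} = insert (Suc p) {s \<in> S. Suc p < s}" using assms(1) by auto
  then show ?thesis using assms(2) by (simp add: level_def)
qed

lemma level_Suc_notin:
  assumes "Suc p \<notin> S"
  shows "level i S p = level i S (Suc p) - 1"
proof -
  have "p < s \<longleftrightarrow> Suc p < s" if "s \<in> S" for s
    using assms that by (cases "s = Suc p") auto
  then have "{s \<in> S. p < s} = {s \<in> S. Suc p < s}" by blast
  then show ?thesis by (simp add: level_def)
qed

text \<open>r times the coefficient of (z2/z1)^r in the logarithm of the contraction with x_k^-. An
  element k of S gives a pole at z1 = q^(level + 1) z2, an element k + 1 a zero at z1 = q^(level +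
  2) z2, each with its own level; if both lie in S they cancel by \<open>level_Suc\<close>.\<close>

definition residue_term :: "nat \<Rightarrow> nat set \<Rightarrow> nat \<Rightarrow> nat \<Rightarrow> qfield" where
  "residue_term i S k r = (if k \<in> S then qpow (of_int (level i S k + 1)) ^ r else 0)
     - (if Suc k \<in> S then qpow (of_int (level i S (Suc k) + 2)) ^ r else 0)"

lemma residue_term_simps:
  assumes "finite S"
  shows "lowerable k S \<Longrightarrow> residue_term i S k r = qpow (of_int (level i S k + 1)) ^ r"
    "raisable k S \<Longrightarrow> residue_term i S k r = - (qpow (of_int (level i S (Suc k) + 2)) ^ r)"
    "\<not> lowerable k S \<Longrightarrow> \<not> raisable k S \<Longrightarrow> residue_term i S k r = 0"
  using assms by (auto simp: residue_term_def lowerable_def raisable_def level_Suc add.commute)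

lemma qpow_of_int_power: "qpow (of_int a) ^ r = qpow (of_int (a * int r))"
proof -
  have "2 * of_int a \<in> (\<int> :: rat set)" by (intro Ints_mult) auto
  from qpow_mult_nat[OF this, of r] show ?thesis by simp
qed

lemma qpow_of_int_add_power: "qpow (of_int (a + b)) ^ r = qpow (of_int a) ^ r * qpow (of_int b) ^ r"
  by (simp only: qpow_of_int_add power_mult_distrib)

text \<open>The subtracted term is the effect of x_j^- placed at its pole, seen through the q-Cartan
  matrix. For k = j the pole turns into a zero, since q^r [2r]/[r] = q^(2r) + 1; for k = j - 1 a
  zero disappears, and for k = j + 1 a pole appears.\<close>

lemma residue_term_lower:
  assumes S: "finite S" "lowerable j S" and r: "r \<ge> 1"
  shows "residue_term i (lower j S) k r = residue_term i S k r -
    qpow (of_int (level i S j + 1)) ^ r * (qpow (of_int (int r)) * qint (cartan k j * int r) / qint (int r))"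
proof -
  define T where "T = qpow (of_int (level i S j + 1)) ^ r"
  define X where "X = qpow (of_int 1) ^ r"
  have X: "X = qpow (of_int (int r))" "X \<noteq> 0" unfolding X_def qpow_of_int_power by simp_all
  have S': "finite (lower j S)" using S by (simp add: lower_def)
  have jS: "j \<in> S" "Suc j \<notin> S" using S by (auto simp: lowerable_def)
  have jS': "j \<notin> lower j S" "Suc j \<in> lower j S" by (auto simp: lower_def)
  have lev: "level i (lower j S) (Suc j) = level i S j + 1"
    using level_lower[OF S(2) _ S(1), of "Suc j" i] level_Suc_notin[OF jS(2), of i] by simp
  have qr: "qint (int r) \<noteq> 0" using r by (intro qint_nonzero) simp
  have "residue_term i (lower j S) k r = residue_term i S k r - T * (X * qint (cartan k j * int r) / qint (int r))"
  proof -
    consider "k = j" | "k = Suc j" | "Suc k = j" | "k \<noteq> j" "k \<noteq> Suc j" "Suc k \<noteq> j" by blast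
    then show ?thesis
    proof cases
      case 1
      have "qint (2 * int r) * qint (1 * int r) = qint (int r) * (qint ((1 - 1) * int r) + qint ((1 + 1) * int r))"
        by (rule qint_recurrence)
      have "qpow (of_int (2 * int r)) = X * X"
        unfolding X(1) qpow_of_int_add[symmetric] by simp
      then have "qint (2 * int r) = qint (int r) * (X + 1 / X)"
        unfolding qint_alt X(1)[symmetric] using X(2) q_diff_nonzero by (simp add: divide_simps) (simp add: algebra_simps)
      then have q2: "X * qint (2 * int r) / qint (int r) = X * X + 1"
        using qr X(2) by (simp add: field_simps)
      have "level i S j + 1 + 2 = (level i S j + 1) + (1 + 1)" by simp
      then have "qpow (of_int (level i S j + 1 + 2)) ^ r = T * (X * X)"
        unfolding T_def X_def by (simp only: qpow_of_int_add_power)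
      then have "residue_term i (lower j S) j r = - (T * (X * X))"
        using jS' by (simp add: residue_term_def lev)
      moreover have "residue_term i S j r = T" using jS by (simp add: residue_term_def T_def)
      ultimately show ?thesis using 1 q2 by (simp add: cartan_def algebra_simps)
    next
      case 2
      have "qpow (of_int (level i S j + 1 + 1)) ^ r = T * X"
        unfolding T_def X_def by (simp only: qpow_of_int_add_power)
      moreover have "Suc k \<in> lower j S \<longleftrightarrow> Suc k \<in> S" "level i (lower j S) (Suc k) = level i S (Suc k)"
        using 2 level_lower[OF S(2) _ S(1)] by (auto simp: lower_def)
      ultimately have "residue_term i (lower j S) k r = residue_term i S k r + T * X"
        using 2 jS jS' by (simp add: residue_term_def lev)
      then show ?thesis using 2 qr by (simp add: cartan_def qint_minus)
    next
      case 3
      have "level i S j + 2 = level i S j + 1 + 1" by simp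
      then have "qpow (of_int (level i S j + 2)) ^ r = T * X"
        unfolding T_def X_def by (simp only: qpow_of_int_add_power)
      moreover have "k \<in> lower j S \<longleftrightarrow> k \<in> S" "level i (lower j S) k = level i S k"
        using 3 level_lower[OF S(2) _ S(1)] by (auto simp: lower_def)
      ultimately have "residue_term i (lower j S) k r = residue_term i S k r + T * X"
        using 3 jS jS' by (simp add: residue_term_def)
      then show ?thesis using 3 qr by (simp add: cartan_def qint_minus)
    next
      case 4
      then have "k \<in> lower j S \<longleftrightarrow> k \<in> S" "Suc k \<in> lower j S \<longleftrightarrow> Suc k \<in> S"
        by (auto simp: lower_def)
      then have "residue_term i (lower j S) k r = residue_term i S k r"
        using 4 level_lower[OF S(2) _ S(1)] by (simp add: residue_term_def)
      then show ?thesis using 4 by (simp add: cartan_def qint_simps)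
    qed
  qed
  then show ?thesis by (simp only: T_def X(1))
qed

section \<open>Integrality of the form\<close>

lemma form_uminus_left: "form n (- \<mu>) \<nu> = - form n \<mu> \<nu>"
  using form_add_left[of n \<mu> "- \<mu>" \<nu>] by (simp add: form_zero_left)

lemma form_simple_root_Ints:
  assumes "j \<in> {1..n}" "\<beta> \<in> weight_lattice n"
  shows "form n (simple_root n j) \<beta> \<in> \<int>"
proof -
  have "form n (simple_root n j) \<beta> = form n (\<Sum>k\<in>Poly_Mapping.keys \<beta>. Poly_Mapping.single k (Poly_Mapping.lookup \<beta> k)) (simple_root n j)"
    by (subst form_commute, subst poly_mapping_sum_single[of \<beta>]) rule
  also have "\<dots> = (\<Sum>k\<in>Poly_Mapping.keys \<beta>. of_int (Poly_Mapping.lookup \<beta> k) * form n (fund_weight k) (simple_root n j))"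
    by (simp only: form_sum_left form_single_left)
  also have "\<dots> \<in> \<int>"
    using assms by (intro Ints_sum Ints_mult) (auto simp: weight_lattice_def form_fund_simple subset_iff)
  finally show ?thesis .
qed

lemma form_fractional: "of_nat (n + 1) * form n \<mu> \<nu> \<in> \<int>"
proof -
  have "of_nat (n + 1) * form n \<mu> \<nu> = (\<Sum>i = 1..n. \<Sum>j = 1..n.
     of_int (Poly_Mapping.lookup \<mu> i) * of_int (Poly_Mapping.lookup \<nu> j) *
       (of_nat (min i j) * (of_nat (n + 1) - of_nat (max i j))))"
    unfolding form_def sum_distrib_left
    by (intro sum.cong refl) (simp add: divide_simps)
  also have "\<dots> \<in> \<int>" by (intro Ints_sum Ints_mult Ints_diff) auto
  finally show ?thesis .
qed

lemma simple_root_lattice: "simple_root n j \<in> weight_lattice n"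
  by (auto simp: weight_lattice_def in_keys_iff lookup_simple_root split: if_splits)

lemma hpair_lower: "lowerable j S \<Longrightarrow> hpair k (lower j S) = hpair k S - cartan k j"
  by (auto simp: hpair_def lower_def lowerable_def cartan_def)

text \<open>The operator \<open>b\<close> is a vertex operator whose contraction with \<open>x\<^sub>k\<^sup>-\<close> is the rational function
  encoded by \<open>residue_term\<close>.\<close>

definition is_state :: "nat \<Rightarrow> nat \<Rightarrow> op_series \<Rightarrow> nat set \<Rightarrow> bool" where
  "is_state n i b S \<longleftrightarrow> finite S \<and> (\<exists>c d \<gamma> \<chi>. \<gamma> \<in> weight_lattice n \<and> \<chi> 0 \<noteq> 0 \<and>
     (\<forall>v\<in>V n. \<forall>r. b r v = vop n c d \<gamma> \<chi> r v) \<and>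
     (\<forall>k\<in>{1..n}. \<forall>r\<ge>1. cartan_pairing n c k r = qpow (- of_nat r / 2) * residue_term i S k r) \<and>
     (\<forall>k\<in>{1..n}. form n \<gamma> (simple_root n k) = of_int (hpair k S)))"

lemma is_stateI:
  assumes "finite S" "\<gamma> \<in> weight_lattice n" "\<chi> 0 \<noteq> 0"
    "\<And>v r. v \<in> V n \<Longrightarrow> b r v = vop n c d \<gamma> \<chi> r v"
    "\<And>k r. k \<in> {1..n} \<Longrightarrow> r \<ge> 1 \<Longrightarrow> cartan_pairing n c k r = qpow (- of_nat r / 2) * residue_term i S k r"
    "\<And>k. k \<in> {1..n} \<Longrightarrow> form n \<gamma> (simple_root n k) = of_int (hpair k S)"
  shows "is_state n i b S"
  unfolding is_state_def
  by (intro conjI exI[of _ c] exI[of _ d] exI[of _ \<gamma>] exI[of _ \<chi>] ballI allI impI assms)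

lemma qpow_half: "qpow (of_nat r / 2) * qpow (- of_nat r / 2) = 1"
  "qpow (of_nat r / 2) * qpow (of_nat r / 2) = qpow (of_int (int r))"
  "qpow (- of_nat r / 2) * qpow (- of_nat r / 2) = inverse (qpow (of_int (int r)))"
proof -
  have h: "2 * (of_nat r / 2) \<in> (\<int> :: rat set)" by simp
  show 1: "qpow (of_nat r / 2) * qpow (- of_nat r / 2) = 1"
    using qpow_add[OF h, of "- of_nat r / 2"] by simp
  show 2: "qpow (of_nat r / 2) * qpow (of_nat r / 2) = qpow (of_int (int r))"
    using qpow_add[OF h, of "of_nat r / 2"] by simp
  have "qpow (- of_nat r / 2) = inverse (qpow (of_nat r / 2))"
    using 1 by (simp add: inverse_unique)
  then show "qpow (- of_nat r / 2) * qpow (- of_nat r / 2) = inverse (qpow (of_int (int r)))"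
    by (simp only: 2[symmetric] inverse_mult_distrib)
qed

text \<open>The q^(r/2) in the modes of x_k^- cancels the normalising q^(-r/2), so R itself
  describes the contraction.\<close>

lemma contraction_minus:
  assumes "cartan_pairing n c k r = qpow (- of_nat r / 2) * R" "r \<ge> 1"
  shows "(\<Sum>l=1..n. minus_mode r * heis_bracket k l r * c l r) = R / of_nat r"
proof -
  have qr: "qint (int r) \<noteq> 0" using assms(2) by (intro qint_nonzero) simp
  have "(\<Sum>l=1..n. minus_mode r * heis_bracket k l r * c l r) =
    qpow (of_nat r / 2) / of_nat r * cartan_pairing n c k r"
    unfolding cartan_pairing_def sum_distrib_left heis_bracket_def using qr
    by (intro sum.cong refl) (simp add: field_simps)
  also have "\<dots> = qpow (of_nat r / 2) * qpow (- of_nat r / 2) * R / of_nat r"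
    by (simp add: assms(1))
  finally show ?thesis by (simp only: qpow_half mult_1_left)
qed

text \<open>The sign gives the reciprocal function; the two factors q^(-r/2) no longer cancel and
  replace z1 by q z1.\<close>

lemma contraction_plus:
  assumes "cartan_pairing n c k r = qpow (- of_nat r / 2) * R" "r \<ge> 1"
  shows "(\<Sum>l=1..n. - plus_mode r * heis_bracket k l r * c l r)
     = - (inverse (qpow (of_int (int r))) * R / of_nat r)"
proof -
  have qr: "qint (int r) \<noteq> 0" using assms(2) by (intro qint_nonzero) simp
  have "(\<Sum>l=1..n. - plus_mode r * heis_bracket k l r * c l r) =
    - (qpow (- of_nat r / 2) / of_nat r) * cartan_pairing n c k r"
    unfolding cartan_pairing_def sum_distrib_left heis_bracket_def using qr
    by (intro sum.cong refl) (simp add: field_simps)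
  also have "\<dots> = - (qpow (- of_nat r / 2) * qpow (- of_nat r / 2) * R / of_nat r)"
    by (simp add: assms(1))
  finally show ?thesis by (simp only: qpow_half)
qed

lemma is_state_Y:
  assumes "i \<in> {1..n}"
  shows "is_state n i (Y_op n i) {1..i}"
proof -
  obtain d \<chi> where Y: "Y_op n i = vop n (\<lambda>l r. minus_mode r * dual_coeff n i l (- int r)) d
      (fund_weight i) \<chi>" "\<chi> 0 \<noteq> 0"
    by (rule Y_op_vop)
  have "fund_weight i \<in> weight_lattice n"
    using assms by (auto simp: weight_lattice_def fund_weight_def)
  moreover have "cartan_pairing n (\<lambda>l r. minus_mode r * dual_coeff n i l (- int r)) k r
      = qpow (- of_nat r / 2) * residue_term i {1..i} k r" if k: "k \<in> {1..n}" and r: "r \<ge> 1" for k r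
  proof -
    have "cartan_pairing n (\<lambda>l r. minus_mode r * dual_coeff n i l (- int r)) k r =
       minus_mode r * (\<Sum>l=1..n. qint (cartan k l * int r) * dual_coeff n i l (- int r))"
      unfolding cartan_pairing_def sum_distrib_left by (intro sum.cong refl) (simp add: mult_ac)
    also have "\<dots> = (if k = i then qpow (of_nat r / 2) else 0)"
      using r qint_nonzero[of "int r"] by (subst dual_coeff_cartan[OF assms k]) auto
    also have "\<dots> = qpow (- of_nat r / 2) * residue_term i {1..i} k r"
    proof (cases "k = i")
      case True
      then have "lowerable k {1..i}" using k by (auto simp: lowerable_def)
      \<comment> \<open>No element of {1..i} exceeds i, and the shift by -i in \<open>level\<close>
        then makes the level at i zero, so the initial pole is at z1 = q z2.\<close>
      moreover have "{s \<in> {1..i}. i < s} = {}" by auto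
      then have "level i {1..i} i = 0" by (simp only: level_def card.empty)
      ultimately have "residue_term i {1..i} k r = qpow (of_int 1) ^ r"
        using True residue_term_simps(1)[of "{1..i}" k i r] by simp
      also have "\<dots> = qpow (of_nat r / 2) * qpow (of_nat r / 2)"
        unfolding qpow_half qpow_of_int_power by simp
      finally show ?thesis using True qpow_half(1)[of r] by (simp add: mult_ac)
    next
      case False
      \<comment> \<open>Here k >= 1 matters: {1..i} is raisable at 0.\<close>
      then have "\<not> lowerable k {1..i}" "\<not> raisable k {1..i}"
        using k by (auto simp: lowerable_def raisable_def)
      then show ?thesis using False residue_term_simps(3) by simp
    qed
    finally show ?thesis .
  qed
  moreover have "form n (fund_weight i) (simple_root n k) = of_int (hpair k {1..i})" if "k \<in> {1..n}" for k
    using assms that by (auto simp: form_fund_simple hpair_def)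
  ultimately show ?thesis
    unfolding is_state_def using Y by (intro conjI exI) auto
qed

section \<open>Multiplication by one more current\<close>

lemma x_minus_step:
  assumes b: "is_state n i b S" and j: "j \<in> {1..n}"
  shows "lowerable j S \<Longrightarrow> is_state n i (bullet n (x_minus n j) b) (lower j S)"
    and "\<not> lowerable j S \<Longrightarrow> v \<in> V n \<Longrightarrow> bullet n (x_minus n j) b s v = 0"
proof -
  obtain c d \<gamma> \<chi> where S: "finite S" and \<gamma>: "\<gamma> \<in> weight_lattice n" and \<chi>: "\<chi> 0 \<noteq> 0"
    and b_eq: "\<And>v r. v \<in> V n \<Longrightarrow> b r v = vop n c d \<gamma> \<chi> r v"
    and P: "\<And>k r. k \<in> {1..n} \<Longrightarrow> r \<ge> 1 \<Longrightarrow> cartan_pairing n c k r = qpow (- of_nat r / 2) * residue_term i S k r"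
    and h: "\<And>k. k \<in> {1..n} \<Longrightarrow> form n \<gamma> (simple_root n k) = of_int (hpair k S)"
    using b unfolding is_state_def by blast
  define cx where "cx = single_mode j (\<lambda>r. - minus_mode r)"
  define dx where "dx = (\<lambda>l r. minus_mode r * heis_bracket j l r)"
  have x: "x_minus n j = vop n cx dx (- simple_root n j) (\<lambda>_. 1)"
    unfolding cx_def dx_def by (rule x_minus_vop[OF j])
  interpret vertex_pair n cx dx c d "- simple_root n j" \<gamma> \<chi> b
    by unfold_locales
      (use weight_lattice_uminus simple_root_lattice form_simple_root_Ints[OF j] form_fractional \<gamma> \<chi> b_eq
        in \<open>auto simp: form_uminus_left simp del: of_nat_add of_nat_Suc\<close>)
  have con: "contraction r = residue_term i S j r / of_nat r" if "r \<ge> 1" for r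
    unfolding dx_def by (rule contraction_minus[OF P[OF j that] that])
  {
    assume "\<not> lowerable j S" "v \<in> V n"
    then show "bullet n (x_minus n j) b s v = 0"
      unfolding x using con residue_term_simps(2,3)[OF S, of j i]
      by (cases "raisable j S") (auto intro!: bullet_trivial_contraction bullet_linear_contraction)
  next
    assume l: "lowerable j S"
    define t where "t = level i S j + 1"
    have g: "contraction r = qpow (of_int t) ^ r / of_nat r" if "r \<ge> 1" for r
      using con[OF that] residue_term_simps(1)[OF S l, of i] by (simp add: t_def)
    \<comment> \<open>Lowerability yields the pole and also hpair j S = 1, hence exactly the
      exponent -1 of z1 that makes the contraction (z1 - c z2)^-1.\<close>
    have form: "form n (- simple_root n j) \<gamma> = -1"
      using h[OF j] l by (simp add: form_uminus_left form_commute[of n _ \<gamma>] hpair_def lowerable_def)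
    let ?c = "\<lambda>l r. qpow (of_int t) ^ r * cx l r + c l r"
    have pairing: "cartan_pairing n ?c k r = qpow (- of_nat r / 2) * residue_term i (lower j S) k r"
      if k: "k \<in> {1..n}" and r: "r \<ge> 1" for k r
    proof -
      have "(\<Sum>l=1..n. qint (cartan k l * int r) * cx l r) =
         (\<Sum>l=1..n. if l = j then qint (cartan k l * int r) * - minus_mode r else 0)"
        by (intro sum.cong) (auto simp: cx_def single_mode_def)
      also have "\<dots> = qint (cartan k j * int r) * - minus_mode r"
        using j by (simp add: sum.delta)
      finally have cx: "(\<Sum>l=1..n. qint (cartan k l * int r) * cx l r) =
         qint (cartan k j * int r) * - minus_mode r" .
      have "cartan_pairing n ?c k r = qpow (of_int t) ^ r * (\<Sum>l=1..n. qint (cartan k l * int r) * cx l r) + cartan_pairing n c k r"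
        by (simp add: cartan_pairing_def distrib_left sum.distrib sum_distrib_left mult.left_commute)
      also have "\<dots> = qpow (- of_nat r / 2) * residue_term i S k r -
          qpow (of_int t) ^ r * (qpow (of_nat r / 2) * qint (cartan k j * int r) / qint (int r))"
        unfolding cx P[OF k r] by (simp add: mult_ac)
      \<comment> \<open>Extracts the common factor q^(-r/2) of the normalisation; the remaining q^r
        is the one in \<open>residue_term_lower\<close>.\<close>
      also have "qpow (of_nat r / 2) = qpow (- of_nat r / 2) * qpow (of_int (int r))"
        unfolding qpow_half(2)[symmetric] using qpow_half(1)[of r] by (metis mult.assoc mult.commute mult_1)
      finally show ?thesis
        unfolding residue_term_lower[OF S l r] t_def by (simp add: algebra_simps)
    qed
    have h': "form n (- simple_root n j + \<gamma>) (simple_root n k) = of_int (hpair k (lower j S))"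
      if "k \<in> {1..n}" for k
      unfolding form_add_left form_uminus_left hpair_lower[OF l] h[OF that] form_simple_simple[OF j that]
      by (simp add: cartan_def)
    show "is_state n i (bullet n (x_minus n j) b) (lower j S)"
    proof (rule is_stateI[OF _ _ _ _ pairing h'])
      show "finite (lower j S)" using S by (simp add: lower_def)
      show "- simple_root n j + \<gamma> \<in> weight_lattice n"
        using weight_lattice_add weight_lattice_uminus simple_root_lattice \<gamma> by blast
      show "(\<lambda>\<beta>. qpow (of_int t) powi \<lfloor>form n (- simple_root n j) \<beta>\<rfloor> * cocycle n (- simple_root n j) \<gamma> * \<chi> \<beta>) 0 \<noteq> 0"
        using \<chi> by (simp add: cocycle_def)
    qed (unfold x, rule bullet_geometric_contraction[OF g form])
  }
qed

lemma nonzero_series_vop: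
  assumes "\<chi> 0 \<noteq> 0" "\<And>v r. v \<in> V n \<Longrightarrow> b r v = vop n c d \<gamma> \<chi> r v"
  shows "nonzero_series n b"
  unfolding nonzero_series_def using vop_vacuum_nonzero[of \<chi> n c d \<gamma>, OF assms(1)] assms(2) vacuum_V by metis

lemma x_plus_step:
  assumes b: "is_state n i b S" and j: "j \<in> {1..n}"
  shows "nonzero_series n (bullet n (x_plus n j) b) \<longleftrightarrow> raisable j S"
proof -
  obtain c d \<gamma> \<chi> where S: "finite S" and \<gamma>: "\<gamma> \<in> weight_lattice n" and \<chi>: "\<chi> 0 \<noteq> 0"
    and b_eq: "\<And>v r. v \<in> V n \<Longrightarrow> b r v = vop n c d \<gamma> \<chi> r v"
    and P: "\<And>k r. k \<in> {1..n} \<Longrightarrow> r \<ge> 1 \<Longrightarrow> cartan_pairing n c k r = qpow (- of_nat r / 2) * residue_term i S k r"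
    and h: "\<And>k. k \<in> {1..n} \<Longrightarrow> form n \<gamma> (simple_root n k) = of_int (hpair k S)"
    using b unfolding is_state_def by blast
  define cx where "cx = single_mode j plus_mode"
  define dx where "dx = (\<lambda>l r. - plus_mode r * heis_bracket j l r)"
  have x: "x_plus n j = vop n cx dx (simple_root n j) (\<lambda>_. 1)"
    unfolding cx_def dx_def by (rule x_plus_vop[OF j])
  interpret vertex_pair n cx dx c d "simple_root n j" \<gamma> \<chi> b
    by unfold_locales
      (use simple_root_lattice form_simple_root_Ints[OF j] form_fractional \<gamma> \<chi> b_eq
        in \<open>auto simp del: of_nat_add of_nat_Suc\<close>)
  have con: "contraction r = - (inverse (qpow (of_int (int r))) * residue_term i S j r / of_nat r)" if "r \<ge> 1" for r
    unfolding dx_def by (rule contraction_plus[OF P[OF j that] that])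
  \<comment> \<open>The factor q^-r lowers the exponent of each pole or zero by one; so the pole
    below is at level + 1, whereas \<open>residue_term\<close> has level + 2.\<close>
  have shift: "inverse (qpow (of_int (int r))) * qpow (of_int (a + 1)) ^ r = qpow (of_int a) ^ r" for a r
    unfolding qpow_of_int_add_power qpow_of_int_power[of 1] by simp
  show ?thesis
  proof (cases "raisable j S")
    case True
    define t where "t = level i S (Suc j) + 1"
    have g: "contraction r = qpow (of_int t) ^ r / of_nat r" if "r \<ge> 1" for r
      using con[OF that] residue_term_simps(2)[OF S True, of i r] shift[of r t] by (simp add: t_def add.assoc)
    have form: "form n (simple_root n j) \<gamma> = -1"
      using h[OF j] True by (simp add: form_commute[of n _ \<gamma>] hpair_def raisable_def)
    have "nonzero_series n (bullet n (x_plus n j) b)"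
      unfolding x
      by (rule nonzero_series_vop[OF _ bullet_geometric_contraction[OF g form]]) (use \<chi> in \<open>simp_all add: cocycle_def\<close>)
    then show ?thesis using True by simp
  next
    case False
    have "bullet n (x_plus n j) b s v = 0" if v: "v \<in> V n" for s v
    proof (cases "lowerable j S")
      case True
      have "contraction r = - (qpow (of_int (level i S j)) ^ r / of_nat r)" if "r \<ge> 1" for r
        using con[OF that] residue_term_simps(1)[OF S True, of i r] shift[of r "level i S j"] by simp
      then show ?thesis unfolding x by (rule bullet_linear_contraction[OF _ v])
    next
      case l: False
      have "contraction r = 0" if "r \<ge> 1" for r
        using con[OF that] residue_term_simps(3)[OF S l False, of i r] by simp
      then show ?thesis unfolding x by (rule bullet_trivial_contraction[OF _ v])
    qed
    then show ?thesis using False unfolding nonzero_series_def by simp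
  qed
qed

lemma x_hom_laurent:
  assumes "j \<in> {1..n}"
  shows "x_plus n j \<in> hom_laurent n 1" "x_minus n j \<in> hom_laurent n 1"
  unfolding x_plus_vop[OF assms] x_minus_vop[OF assms]
  by (rule vop_hom_laurent; use simple_root_lattice weight_lattice_uminus form_simple_root_Ints[OF assms]
      in \<open>auto simp: form_uminus_left\<close>)+

section \<open>The two products side by side\<close>

context fundamental_module
begin

text \<open>Either both objects are alive and belong to the same subset, or both are zero, which
  persists under all further steps. Vanishing of b is required on V only.\<close>

definition corresponds :: "op_series \<Rightarrow> 'v \<Rightarrow> bool" where
  "corresponds b u \<longleftrightarrow> (\<exists>S. is_state n i b S \<and> graph u (wedge_basis S) \<and> u \<noteq> 0) \<or>
     ((\<forall>v\<in>V n. \<forall>r. b r v = 0) \<and> u = 0)"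

lemma corresponds_Y: "corresponds (Y_op n i) v"
  unfolding corresponds_def using is_state_Y[OF i] graph.base hw(2) by blast

lemma corresponds_step:
  assumes "corresponds b u" "j \<in> {1..n}"
  shows "corresponds (bullet n (x_minus n j) b) (F j u)"
  using assms(1) unfolding corresponds_def[of b u]
proof (elim disjE exE conjE)
  fix S assume S: "is_state n i b S" "graph u (wedge_basis S)" "u \<noteq> 0"
  show ?thesis
    using x_minus_step[OF S(1) assms(2)] F_basis_step[OF S(2,3) assms(2)] F_basis_zero[OF S(2) assms(2)]
    unfolding corresponds_def by (cases "lowerable j S") auto
next
  assume z: "\<forall>v\<in>V n. \<forall>r. b r v = 0" "u = 0"
  have "bullet n (x_minus n j) b r w = 0" if "w \<in> V n" for r w
    by (rule bullet_zero[OF x_hom_laurent(2)[OF assms(2)] _ that]) (use z in auto)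
  moreover have "F j u = 0" using z assms(2) op_linear(3)[of j "F j"] by simp
  ultimately show ?thesis unfolding corresponds_def by blast
qed

text \<open>\<open>fold\<close> applies the head of the list first, which matches nesting from the
  right.\<close>

lemma corresponds_fold:
  assumes "\<And>m. m \<in> set ms \<Longrightarrow> j m \<in> {1..n}" "corresponds b u"
  shows "corresponds (fold (\<lambda>m. bullet n (x_minus n (j m))) ms b) (fold (\<lambda>m. F (j m)) ms u)"
  using assms
proof (induction ms arbitrary: b u)
  case (Cons a ms)
  have "corresponds (bullet n (x_minus n (j a)) b) (F (j a) u)"
    using Cons.prems by (intro corresponds_step) auto
  then show ?case using Cons by simp
qed simp

lemma corresponds_final:
  assumes "corresponds b u" "j \<in> {1..n}"
  shows "nonzero_series n (bullet n (x_plus n j) b) \<longleftrightarrow> E j u \<noteq> 0"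
  using assms(1) unfolding corresponds_def
proof (elim disjE exE conjE)
  fix S assume S: "is_state n i b S" "graph u (wedge_basis S)" "u \<noteq> 0"
  show ?thesis
    using x_plus_step[OF S(1) assms(2)] E_basis_nonzero_iff[OF S(2,3) assms(2)] by simp
next
  assume z: "\<forall>v\<in>V n. \<forall>r. b r v = 0" "u = 0"
  have "bullet n (x_plus n j) b r w = 0" if "w \<in> V n" for r w
    by (rule bullet_zero[OF x_hom_laurent(1)[OF assms(2)] _ that]) (use z in auto)
  moreover have "E j u = 0" using z assms(2) op_linear(3)[of j "E j"] by simp
  ultimately show ?thesis unfolding nonzero_series_def by auto
qed

end

theorem lemma2p10:
  fixes n i k :: nat and j :: "nat \<Rightarrow> nat"
    and scale :: "qfield \<Rightarrow> 'v::ab_group_add \<Rightarrow> 'v"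
    and L :: "'v set" and E F K K' :: "nat \<Rightarrow> 'v \<Rightarrow> 'v" and v :: 'v
  assumes "n \<ge> 1" and "i \<in> {1..n}" and "\<And>m. m \<in> {1..k + 1} \<Longrightarrow> j m \<in> {1..n}"
    and "Uq_irreducible_hw_module scale n L E F K K' (fund_weight i) v"
  shows "nonzero_series n
           (bullet n (x_plus n (j (k + 1)))
              (fold (\<lambda>m. bullet n (x_minus n (j m))) [1..<k + 1] (Y_op n i)))
         \<longleftrightarrow> E (j (k + 1)) (fold (\<lambda>m. F (j m)) [1..<k + 1] v) \<noteq> 0"
proof -
  interpret fundamental_module scale n L E F K K' i v
    using assms(2,4) by (intro fundamental_module.intro fundamental_module_axioms.intro)
  show ?thesis
    using assms(3) by (intro corresponds_final corresponds_fold corresponds_Y) auto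
qed

end
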